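(* Let $A$ be an idempotented $*$-algebra and let $B\subseteq A$ be an idempotented $*$-subalgebra. For every $V'\in\mathrm{Rep}^u(A)$ we have $$\mathrm{Spec}_B(\overline{BV'})=\mathcal{R}_{A/B}(\mathrm{Spec}_A(V')).$$ Moreover, for any irreducible unitary representation $U$ of $B$ with $U\prec\overline{BV'}$, there exists an irreducible unitary representation $V$ of $A$ with $V\prec V'$ such that $U\leq\overline{BV}$.
   Context: Algebras are associative $\mathbb{C}$-algebras, not necessarily unital. A $*$-algebra is an algebra $A$ with an additive, conjugate-linear map $*:A\to A$ with $(ab)^*=b^*a^*$ and $a^{**}=a$. It is idempotented if for every finite $T\subseteq A$ there is an idempotent $e=e^*\in A$ with $eae=a$ for all $a\in T$. An idempotented $*$-subalgebra of $A$ is a subalgebra $B$ with $B^*=B$ such that $(B,*|_B)$ is idempotented. A unitary representation of $A$ is a Hilbert space $V$ with a left $A$-module structure by bounded operators such that $\langle au,v\rangle=\langle u,a^*v\rangle$ for all $a\in A$, $u,v\in V$, and $AV$ is dense in $V$; $\mathrm{Rep}^u(A)$ denotes the class of these. It is irreducible if it is nonzero and has no closed $A$-submodules other than $0$ and $V$. $V_1\le V_2$ means that there is an injective inner-product-preserving $A$-homomorphism $V_1\to V_2$. $\widehat A$ is the set of unitary isomorphism classes $[V]$ of irreducible unitary representations. For $V$ irreducible and $V'$ a unitary representation, $V\prec V'$ means: for every unit $v\in V$, $\varepsilon>0$ and finite $T\subseteq A$ there is a unit $v'\in V'$ with $|\langle av,v\rangle-\langle av',v'\rangle|<\varepsilon$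 for all $a\in T$. $\mathrm{Spec}_A(V')=\{[V]\in\widehat A:V\prec V'\}$. For $V\in\mathrm{Rep}^u(A)$, the closure $\overline{BV}$ is a unitary representation of $B$. For $S\subseteq\widehat A$, $\mathcal{R}_{A/B}(S)=\bigcup_{[V]\in S}\mathrm{Spec}_B(\overline{BV})\subseteq\widehat B$. *)

theory Defs
  imports "HOL-Analysis.Analysis" "HOL-Library.Function_Algebras"
begin

section \<open>Complex vector spaces and star-algebras\<close>

class complex_vector = ab_group_add +
  fixes scaleC :: "complex \<Rightarrow> 'a \<Rightarrow> 'a"  (infixr "*\<^sub>C" 75)
  assumes scaleC_add_right: "c *\<^sub>C (x + y) = c *\<^sub>C x + c *\<^sub>C y"
    and scaleC_add_left: "(c + d) *\<^sub>C x = c *\<^sub>C x + d *\<^sub>C x"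
    and scaleC_scaleC: "c *\<^sub>C (d *\<^sub>C x) = (c * d) *\<^sub>C x"
    and scaleC_one: "1 *\<^sub>C x = x"

global_interpretation complex_vector: vector_space "scaleC :: complex \<Rightarrow> 'a \<Rightarrow> 'a :: complex_vector"
  defines csubspace_raw_def: csubspace = complex_vector.subspace
    and cspan_raw_def: cspan = complex_vector.span
  by unfold_locales (simp_all add: scaleC_add_right scaleC_add_left scaleC_scaleC scaleC_one)

instantiation complex :: complex_vector
begin
definition scaleC_complex :: "complex \<Rightarrow> complex \<Rightarrow> complex"
  where "scaleC_complex c x = c * x"
instance by standard (simp_all add: scaleC_complex_def algebra_simps)
end

instantiation "fun" :: (type, complex_vector) complex_vector
begin
definition scaleC_fun :: "complex \<Rightarrow> ('a \<Rightarrow> 'b) \<Rightarrow> 'a \<Rightarrow> 'b"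
  where "scaleC_fun c f = (\<lambda>x. c *\<^sub>C f x)"
instance
  by standard
    (simp_all add: scaleC_fun_def fun_eq_iff scaleC_add_right scaleC_add_left scaleC_scaleC scaleC_one)
end

class star_algebra = complex_vector + ring +
  fixes star :: "'a \<Rightarrow> 'a"
  assumes scaleC_mult_left: "(c *\<^sub>C x) * y = c *\<^sub>C (x * y)"
    and scaleC_mult_right: "x * (c *\<^sub>C y) = c *\<^sub>C (x * y)"
    and star_add: "star (x + y) = star x + star y"
    and star_scaleC: "star (c *\<^sub>C x) = cnj c *\<^sub>C star x"
    and star_mult: "star (x * y) = star y * star x"
    and star_star: "star (star x) = x"

text \<open>
  The algebras under consideration are subsets of a type of class \<open>star_algebra\<close> (possibly the whole
  type), so that an algebra and its subalgebras are treated by the same notions.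
\<close>

definition star_subalgebra :: "'a::star_algebra set \<Rightarrow> bool"
  where "star_subalgebra A \<longleftrightarrow>
    csubspace A \<and> (\<forall>a\<in>A. \<forall>b\<in>A. a * b \<in> A) \<and> (\<forall>a\<in>A. star a \<in> A)"

definition idempotented_star_algebra :: "'a::star_algebra set \<Rightarrow> bool"
  where "idempotented_star_algebra A \<longleftrightarrow> star_subalgebra A \<and>
    (\<forall>T. finite T \<longrightarrow> T \<subseteq> A \<longrightarrow>
      (\<exists>e\<in>A. e * e = e \<and> star e = e \<and> (\<forall>a\<in>T. e * a * e = a)))"


section \<open>Hilbert spaces\<close>

text \<open>
  A Hilbert space is a linear subspace of some complex vector space, with an inner product that is
  linear in the first argument; the inner product has no meaning outside the subspace.
\<close>

record 'v hilbert =
  hspace :: "'v set"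
  hinner :: "'v \<Rightarrow> 'v \<Rightarrow> complex"

definition hnorm :: "('v, 'm) hilbert_scheme \<Rightarrow> 'v \<Rightarrow> real"
  where "hnorm V u = sqrt (Re (hinner V u u))"

text \<open>
  The locale \<open>Metric_space\<close> requires nonnegativity and symmetry on the whole type, hence the value
  \<open>0\<close> outside \<open>hspace V\<close>.
\<close>

definition hdist :: "('v::complex_vector, 'm) hilbert_scheme \<Rightarrow> 'v \<Rightarrow> 'v \<Rightarrow> real"
  where "hdist V u v = (if u \<in> hspace V \<and> v \<in> hspace V then hnorm V (u - v) else 0)"

abbreviation htopology :: "('v::complex_vector, 'm) hilbert_scheme \<Rightarrow> 'v topology"
  where "htopology V \<equiv> Metric_space.mtopology (hspace V) (hdist V)"

locale hilbert_space =
  fixes V :: "('v::complex_vector, 'm) hilbert_scheme"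
  assumes hspace_subspace: "csubspace (hspace V)"
    and hinner_commute: "\<lbrakk>u \<in> hspace V; v \<in> hspace V\<rbrakk> \<Longrightarrow> hinner V v u = cnj (hinner V u v)"
    and hinner_add_left: "\<lbrakk>u \<in> hspace V; v \<in> hspace V; w \<in> hspace V\<rbrakk>
          \<Longrightarrow> hinner V (u + v) w = hinner V u w + hinner V v w"
    and hinner_scaleC_left: "\<lbrakk>u \<in> hspace V; v \<in> hspace V\<rbrakk>
          \<Longrightarrow> hinner V (c *\<^sub>C u) v = c * hinner V u v"
    and hinner_ge_zero: "u \<in> hspace V \<Longrightarrow> Re (hinner V u u) \<ge> 0"
    and hinner_eq_zero: "\<lbrakk>u \<in> hspace V; hinner V u u = 0\<rbrakk> \<Longrightarrow> u = 0"
    and hspace_mcomplete: "Metric_space.mcomplete (hspace V) (hdist V)"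


section \<open>Unitary representations\<close>

record ('a, 'v) hrep = "'v hilbert" +
  haction :: "'a \<Rightarrow> 'v \<Rightarrow> 'v"

text \<open>\<open>act_span A V\<close> is \<open>AV\<close>.\<close>

definition act_span :: "'a set \<Rightarrow> ('a, 'v::complex_vector) hrep \<Rightarrow> 'v set"
  where "act_span A V = cspan {haction V a v | a v. a \<in> A \<and> v \<in> hspace V}"

text \<open>
  Only the operators \<open>haction V a\<close> with \<open>a \<in> A\<close>, restricted to \<open>hspace V\<close>, are relevant for a
  representation of \<open>A\<close>.
\<close>

locale unitary_rep = hilbert_space V
  for A :: "'a::star_algebra set" and V :: "('a, 'v::complex_vector) hrep" +
  assumes haction_closed: "\<lbrakk>a \<in> A; v \<in> hspace V\<rbrakk> \<Longrightarrow> haction V a v \<in> hspace V"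
    and haction_add_right: "\<lbrakk>a \<in> A; u \<in> hspace V; v \<in> hspace V\<rbrakk>
          \<Longrightarrow> haction V a (u + v) = haction V a u + haction V a v"
    and haction_scaleC_right: "\<lbrakk>a \<in> A; v \<in> hspace V\<rbrakk>
          \<Longrightarrow> haction V a (c *\<^sub>C v) = c *\<^sub>C haction V a v"
    and haction_add_left: "\<lbrakk>a \<in> A; b \<in> A; v \<in> hspace V\<rbrakk>
          \<Longrightarrow> haction V (a + b) v = haction V a v + haction V b v"
    and haction_scaleC_left: "\<lbrakk>a \<in> A; v \<in> hspace V\<rbrakk>
          \<Longrightarrow> haction V (c *\<^sub>C a) v = c *\<^sub>C haction V a v"
    and haction_mult: "\<lbrakk>a \<in> A; b \<in> A; v \<in> hspace V\<rbrakk>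
          \<Longrightarrow> haction V (a * b) v = haction V a (haction V b v)"
    and haction_bounded: "a \<in> A \<Longrightarrow> \<exists>K. \<forall>v\<in>hspace V. hnorm V (haction V a v) \<le> K * hnorm V v"
    and haction_star: "\<lbrakk>a \<in> A; u \<in> hspace V; v \<in> hspace V\<rbrakk>
          \<Longrightarrow> hinner V (haction V a u) v = hinner V u (haction V (star a) v)"
    and act_span_dense: "htopology V closure_of act_span A V = hspace V"

definition irreducible_rep :: "'a::star_algebra set \<Rightarrow> ('a, 'v::complex_vector) hrep \<Rightarrow> bool"
  where "irreducible_rep A V \<longleftrightarrow> unitary_rep A V \<and> hspace V \<noteq> {0} \<and>
    (\<forall>W. csubspace W \<and> W \<subseteq> hspace V \<and> (\<forall>a\<in>A. \<forall>w\<in>W. haction V a w \<in> W) \<and> closedin (htopology V) W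
      \<longrightarrow> W = {0} \<or> W = hspace V)"

definition isometric_hom ::
    "'a set \<Rightarrow> ('a, 'v::complex_vector) hrep \<Rightarrow> ('a, 'w::complex_vector) hrep \<Rightarrow> ('v \<Rightarrow> 'w) \<Rightarrow> bool"
  where "isometric_hom A V W f \<longleftrightarrow>
    (\<forall>v\<in>hspace V. f v \<in> hspace W) \<and>
    (\<forall>u\<in>hspace V. \<forall>v\<in>hspace V. f (u + v) = f u + f v) \<and>
    (\<forall>c. \<forall>v\<in>hspace V. f (c *\<^sub>C v) = c *\<^sub>C f v) \<and>
    (\<forall>a\<in>A. \<forall>v\<in>hspace V. f (haction V a v) = haction W a (f v)) \<and>
    (\<forall>u\<in>hspace V. \<forall>v\<in>hspace V. hinner W (f u) (f v) = hinner V u v)"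

definition subrep :: "'a set \<Rightarrow> ('a, 'v::complex_vector) hrep \<Rightarrow> ('a, 'w::complex_vector) hrep \<Rightarrow> bool"
  where "subrep A V W \<longleftrightarrow> (\<exists>f. isometric_hom A V W f \<and> inj_on f (hspace V))"

definition unitarily_isomorphic ::
    "'a set \<Rightarrow> ('a, 'v::complex_vector) hrep \<Rightarrow> ('a, 'w::complex_vector) hrep \<Rightarrow> bool"
  where "unitarily_isomorphic A V W \<longleftrightarrow>
    (\<exists>f. isometric_hom A V W f \<and> bij_betw f (hspace V) (hspace W))"

definition weakly_contained ::
    "'a set \<Rightarrow> ('a, 'v::complex_vector) hrep \<Rightarrow> ('a, 'w::complex_vector) hrep \<Rightarrow> bool"
  where "weakly_contained A V V' \<longleftrightarrow>
    (\<forall>v\<in>hspace V. \<forall>\<epsilon>>0. \<forall>T. hnorm V v = 1 \<longrightarrow> finite T \<longrightarrow> T \<subseteq> A \<longrightarrow>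
      (\<exists>v'\<in>hspace V'. hnorm V' v' = 1 \<and>
        (\<forall>a\<in>T. cmod (hinner V (haction V a v) v - hinner V' (haction V' a v') v') < \<epsilon>)))"

text \<open>\<open>closure_rep B V\<close> is the closure of \<open>BV\<close>, as a representation of \<open>B\<close>.\<close>

definition closure_rep :: "'a set \<Rightarrow> ('a, 'v::complex_vector) hrep \<Rightarrow> ('a, 'v) hrep"
  where "closure_rep B V = V\<lparr>hspace := htopology V closure_of act_span B V\<rparr>"


section \<open>Unitary duals and spectra\<close>

text \<open>
  An irreducible unitary representation \<open>V\<close> of \<open>A\<close> is determined up to isomorphism by its matrix
  coefficients: for \<open>0 \<noteq> v \<in> V\<close> the linear map sending \<open>w\<close> to \<open>a \<mapsto> \<langle>w, av\<rangle>\<close> is injective. Hence every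
  isomorphism class is represented on a space of functions \<open>'a \<Rightarrow> complex\<close>; this is
  \<open>ex_universal_irreducible_rep\<close> below. So the isomorphism classes can be taken to be
  sets of representations on this type, without loss.
\<close>

type_synonym 'a universal_rep = "('a, 'a \<Rightarrow> complex) hrep"

definition iso_class ::
    "'a::star_algebra set \<Rightarrow> ('a, 'v::complex_vector) hrep \<Rightarrow> 'a universal_rep set"
  where "iso_class A V = {W. unitary_rep A W \<and> unitarily_isomorphic A V W}"

definition unitary_dual :: "'a::star_algebra set \<Rightarrow> 'a universal_rep set set"
  where "unitary_dual A = {iso_class A V | V :: 'a universal_rep. irreducible_rep A V}"

definition spectrum ::
    "'a::star_algebra set \<Rightarrow> ('a, 'v::complex_vector) hrep \<Rightarrow> 'a universal_rep set set"
  where "spectrum A V' =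
    {iso_class A V | V :: 'a universal_rep. irreducible_rep A V \<and> weakly_contained A V V'}"

definition spectrum_restriction ::
    "'a::star_algebra set \<Rightarrow> 'a set \<Rightarrow> 'a universal_rep set set \<Rightarrow> 'a universal_rep set set"
  where "spectrum_restriction A B S =
    \<Union>{spectrum B (closure_rep B V) | V :: 'a universal_rep. irreducible_rep A V \<and> iso_class A V \<in> S}"

lemma spectrum_subset_unitary_dual: "spectrum A V' \<subseteq> unitary_dual A"
  by (auto simp: spectrum_def unitary_dual_def)


section \<open>Existence of representatives on the universal type\<close>

context hilbert_space
begin

lemma zero_mem: "0 \<in> hspace V"
  and add_mem: "\<lbrakk>u \<in> hspace V; v \<in> hspace V\<rbrakk> \<Longrightarrow> u + v \<in> hspace V"
  and scaleC_mem: "u \<in> hspace V \<Longrightarrow> c *\<^sub>C u \<in> hspace V"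
  and diff_mem: "\<lbrakk>u \<in> hspace V; v \<in> hspace V\<rbrakk> \<Longrightarrow> u - v \<in> hspace V"
  using hspace_subspace
  by (auto intro: complex_vector.subspace_0 complex_vector.subspace_add
      complex_vector.subspace_scale complex_vector.subspace_diff)

lemma hinner_add_right:
  assumes "u \<in> hspace V" "v \<in> hspace V" "w \<in> hspace V"
  shows "hinner V w (u + v) = hinner V w u + hinner V w v"
  using assms by (metis add_mem complex_cnj_add hinner_add_left hinner_commute)

lemma hinner_scaleC_right:
  assumes "u \<in> hspace V" "v \<in> hspace V"
  shows "hinner V u (c *\<^sub>C v) = cnj c * hinner V u v"
  using assms by (metis complex_cnj_mult hinner_commute hinner_scaleC_left scaleC_mem)

lemma hinner_zero_left: "v \<in> hspace V \<Longrightarrow> hinner V 0 v = 0"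
  using hinner_add_left[OF zero_mem zero_mem] by simp

lemma hinner_zero_right: "v \<in> hspace V \<Longrightarrow> hinner V v 0 = 0"
  using hinner_add_right[OF zero_mem zero_mem] by simp

lemma hinner_diff_left:
  assumes "u \<in> hspace V" "v \<in> hspace V" "w \<in> hspace V"
  shows "hinner V (u - v) w = hinner V u w - hinner V v w"
  using hinner_add_left[OF diff_mem[OF assms(1,2)] assms(2,3)] by simp

lemma hinner_diff_right:
  assumes "u \<in> hspace V" "v \<in> hspace V" "w \<in> hspace V"
  shows "hinner V w (u - v) = hinner V w u - hinner V w v"
  using hinner_add_right[OF diff_mem[OF assms(1,2)] assms(2,3)] by simp

lemma hinner_self: "u \<in> hspace V \<Longrightarrow> hinner V u u = complex_of_real ((hnorm V u)\<^sup>2)"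
  using arg_cong[OF hinner_commute[of u u], of Im] hinner_ge_zero[of u]
  by (simp add: hnorm_def complex_eq_iff)

lemma hnorm_ge_zero: "u \<in> hspace V \<Longrightarrow> hnorm V u \<ge> 0"
  by (simp add: hnorm_def hinner_ge_zero)

lemma hnorm_eq_zero_iff: "u \<in> hspace V \<Longrightarrow> hnorm V u = 0 \<longleftrightarrow> u = 0"
  by (metis hinner_eq_zero hinner_self hinner_zero_left hnorm_def of_real_0 power_zero_numeral
      real_sqrt_zero zero_complex.sel(1))

lemma Cauchy_Schwarz:
  assumes u: "u \<in> hspace V" and v: "v \<in> hspace V"
  shows "cmod (hinner V u v) \<le> hnorm V u * hnorm V v"
proof (cases "v = 0")
  case True
  then show ?thesis using u by (simp add: hinner_zero_right hnorm_ge_zero zero_mem)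
next
  case False
  define n where "n = (hnorm V v)\<^sup>2"
  define z where "z = hinner V u v"
  define w where "w = of_real n *\<^sub>C u - z *\<^sub>C v"
  have n: "n > 0"
    using False v hnorm_eq_zero_iff by (simp add: n_def)
  have vv: "hinner V v v = of_real n" and uu: "hinner V u u = of_real ((hnorm V u)\<^sup>2)"
    using hinner_self u v by (simp_all add: n_def)
  have vu: "hinner V v u = cnj z"
    unfolding z_def using u v by (rule hinner_commute)
  have "hinner V w w = of_real n * (of_real n * hinner V u u - z * cnj z)"
    using u v
    by (simp add: w_def hinner_diff_left hinner_diff_right hinner_scaleC_left hinner_scaleC_right
        scaleC_mem diff_mem vv vu flip: z_def)
  also have "\<dots> = of_real (n * (n * (hnorm V u)\<^sup>2 - (cmod z)\<^sup>2))"
    by (simp only: uu flip: complex_norm_square) simp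
  finally have "Re (hinner V w w) = n * (n * (hnorm V u)\<^sup>2 - (cmod z)\<^sup>2)"
    by simp
  moreover have "Re (hinner V w w) \<ge> 0"
    using u v by (simp add: w_def hinner_ge_zero scaleC_mem diff_mem)
  ultimately have "(cmod z)\<^sup>2 \<le> (hnorm V u * hnorm V v)\<^sup>2"
    using n by (simp add: zero_le_mult_iff n_def power_mult_distrib mult.commute)
  then show ?thesis
    unfolding z_def using u v by (auto intro: power2_le_imp_le simp: hnorm_ge_zero)
qed

lemma hnorm_triangle:
  assumes u: "u \<in> hspace V" and v: "v \<in> hspace V"
  shows "hnorm V (u + v) \<le> hnorm V u + hnorm V v"
proof -
  have "complex_of_real ((hnorm V (u + v))\<^sup>2) = hinner V (u + v) (u + v)"
    using u v by (simp add: hinner_self add_mem)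
  also have "\<dots> = hinner V u u + hinner V v v + (hinner V u v + cnj (hinner V u v))"
    using u v hinner_commute[OF u v] by (simp add: hinner_add_left hinner_add_right add_mem)
  also have "\<dots> = of_real ((hnorm V u)\<^sup>2 + (hnorm V v)\<^sup>2 + 2 * Re (hinner V u v))"
    using u v by (simp only: hinner_self complex_add_cnj of_real_add)
  finally have "(hnorm V (u + v))\<^sup>2 = (hnorm V u)\<^sup>2 + (hnorm V v)\<^sup>2 + 2 * Re (hinner V u v)"
    by (simp only: of_real_eq_iff)
  also have "Re (hinner V u v) \<le> hnorm V u * hnorm V v"
    using Cauchy_Schwarz[OF u v] complex_Re_le_cmod order_trans by blast
  finally have "(hnorm V (u + v))\<^sup>2 \<le> (hnorm V u + hnorm V v)\<^sup>2"
    by (simp add: power2_sum)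
  then show ?thesis
    using u v by (auto intro: power2_le_imp_le simp: hnorm_ge_zero)
qed

lemma hnorm_minus_commute:
  assumes "u \<in> hspace V" "v \<in> hspace V"
  shows "hnorm V (u - v) = hnorm V (v - u)"
proof -
  have "hinner V (u - v) (u - v) = hinner V (v - u) (v - u)"
    using assms by (simp add: hinner_diff_left hinner_diff_right diff_mem)
  then show ?thesis by (simp add: hnorm_def)
qed

lemma metric: "Metric_space (hspace V) (hdist V)"
proof
  show "0 \<le> hdist V x y" for x y
    by (simp add: hdist_def hnorm_ge_zero diff_mem)
  show "hdist V x y = hdist V y x" for x y
    using hnorm_minus_commute by (auto simp: hdist_def)
  show "hdist V x y = 0 \<longleftrightarrow> x = y" if "x \<in> hspace V" "y \<in> hspace V" for x y
    using that by (simp add: hdist_def hnorm_eq_zero_iff diff_mem)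
  show "hdist V x z \<le> hdist V x y + hdist V y z"
    if "x \<in> hspace V" "y \<in> hspace V" "z \<in> hspace V" for x y z
    using that hnorm_triangle[of "x - y" "y - z"] by (simp add: hdist_def diff_mem)
qed

sublocale Metric_space "hspace V" "hdist V"
  by (rule metric)

lemma closedin_orthogonal:
  assumes x: "x \<in> hspace V"
  shows "closedin (htopology V) {w \<in> hspace V. hinner V w x = 0}"
  unfolding closedin_metric
proof (intro conjI allI impI)
  fix w assume "w \<in> hspace V - {w \<in> hspace V. hinner V w x = 0}"
  then have w: "w \<in> hspace V" and nz: "hinner V w x \<noteq> 0" by auto
  then have "x \<noteq> 0" using hinner_zero_right by auto
  then have nx: "hnorm V x > 0"
    using x hnorm_eq_zero_iff hnorm_ge_zero by force
  show "\<exists>r>0. disjnt {w \<in> hspace V. hinner V w x = 0} (mball w r)"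
  proof (intro exI conjI)
    show "0 < cmod (hinner V w x) / hnorm V x" using nz nx by simp
    have False
      if y: "y \<in> hspace V" "hinner V y x = 0" and lt: "hdist V w y < cmod (hinner V w x) / hnorm V x" for y
    proof -
      have "hnorm V (w - y) * hnorm V x < cmod (hinner V w x)"
        using lt w y nx by (simp add: hdist_def pos_less_divide_eq)
      moreover have "hinner V (w - y) x = hinner V w x"
        using w x y by (simp add: hinner_diff_left)
      ultimately show False
        using Cauchy_Schwarz[of "w - y" x] w x y by (simp add: diff_mem)
    qed
    then show "disjnt {w \<in> hspace V. hinner V w x = 0} (mball w (cmod (hinner V w x) / hnorm V x))"
      by (auto simp: disjnt_def)
  qed
qed auto

end

lemma (in unitary_rep) orthogonal_act_eq_zero:
  assumes v: "v \<in> hspace V"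
    and orth: "\<And>a u. \<lbrakk>a \<in> A; u \<in> hspace V\<rbrakk> \<Longrightarrow> hinner V (haction V a u) v = 0"
  shows "v = 0"
proof -
  let ?K = "{w \<in> hspace V. hinner V w v = 0}"
  have "csubspace ?K"
    unfolding complex_vector.subspace_def
    using v by (auto simp: zero_mem add_mem scaleC_mem hinner_zero_left hinner_add_left hinner_scaleC_left)
  moreover have "{haction V a u | a u. a \<in> A \<and> u \<in> hspace V} \<subseteq> ?K"
    using haction_closed orth by auto
  ultimately have "act_span A V \<subseteq> ?K"
    unfolding act_span_def by (rule complex_vector.span_minimal[rotated])
  then have "htopology V closure_of act_span A V \<subseteq> ?K"
    using closedin_orthogonal[OF v] by (rule closure_of_minimal)
  then have "hinner V v v = 0"
    using act_span_dense v by auto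
  then show ?thesis using hinner_eq_zero v by blast
qed

lemma hilbert_space_transport:
  assumes V: "hilbert_space V" and W: "bij_betw f (hspace V) (hspace W)"
    and f_add: "\<And>u v. \<lbrakk>u \<in> hspace V; v \<in> hspace V\<rbrakk> \<Longrightarrow> f (u + v) = f u + f v"
    and f_scale: "\<And>c v. v \<in> hspace V \<Longrightarrow> f (c *\<^sub>C v) = c *\<^sub>C f v"
    and f_inner: "\<And>u v. \<lbrakk>u \<in> hspace V; v \<in> hspace V\<rbrakk> \<Longrightarrow> hinner W (f u) (f v) = hinner V u v"
  shows "hilbert_space W"
    and "\<And>u v. \<lbrakk>u \<in> hspace V; v \<in> hspace V\<rbrakk> \<Longrightarrow> hdist W (f u) (f v) = hdist V u v"
    and "f 0 = 0"
proof -
  interpret V: hilbert_space V by fact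
  have im: "hspace W = f ` hspace V" using W by (simp add: bij_betw_def)
  have inj: "inj_on f (hspace V)" using W by (simp add: bij_betw_def)
  show f0: "f 0 = 0" using f_add[of 0 0] V.zero_mem by simp
  have f_diff: "f (u - v) = f u - f v" if "u \<in> hspace V" "v \<in> hspace V" for u v
    using f_add[of "u - v" v] that by (simp add: V.diff_mem)
  have f_norm: "hnorm W (f u) = hnorm V u" if "u \<in> hspace V" for u
    using that by (simp add: hnorm_def f_inner)
  show dist: "hdist W (f u) (f v) = hdist V u v" if "u \<in> hspace V" "v \<in> hspace V" for u v
    using that by (simp add: hdist_def im V.diff_mem f_norm flip: f_diff)
  have Wm: "Metric_space (hspace W) (hdist W)"
  proof
    have d: "hdist W x y = (if x \<in> hspace W \<and> y \<in> hspace W then hdist W x y else 0)" for x y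
      by (simp add: hdist_def)
    show "0 \<le> hdist W x y" for x y
      by (subst d) (auto simp: im dist)
    show "hdist W x y = hdist W y x" for x y
      by (subst d, subst (2) d) (auto simp: im dist V.commute)
    show "hdist W x y = 0 \<longleftrightarrow> x = y" if "x \<in> hspace W" "y \<in> hspace W" for x y
      using that inj by (auto simp: im dist inj_on_eq_iff)
    show "hdist W x z \<le> hdist W x y + hdist W y z"
      if "x \<in> hspace W" "y \<in> hspace W" "z \<in> hspace W" for x y z
      using that by (auto simp: im dist V.triangle)
  qed
  interpret W: Metric_space "hspace W" "hdist W" by (rule Wm)
  have complete: "W.mcomplete"
    unfolding W.mcomplete_def
  proof (intro allI impI)
    fix \<sigma> assume C: "W.MCauchy \<sigma>"
    define \<tau> where "\<tau> n = inv_into (hspace V) f (\<sigma> n)" for n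
    have \<sigma>: "\<sigma> n \<in> f ` hspace V" for n using C by (auto simp: W.MCauchy_def image_subset_iff simp flip: im)
    have \<tau>: "\<tau> n \<in> hspace V" "f (\<tau> n) = \<sigma> n" for n
      unfolding \<tau>_def using \<sigma>[of n] by (rule inv_into_into, rule f_inv_into_f)
    have dd: "hdist W (\<sigma> m) (\<sigma> n) = hdist V (\<tau> m) (\<tau> n)" for m n
      using dist[OF \<tau>(1)[of m] \<tau>(1)[of n]] by (simp add: \<tau>(2))
    have "V.MCauchy \<tau>"
      using C \<tau>(1) by (auto simp: W.MCauchy_def V.MCauchy_def dd)
    then obtain x where "limitin V.mtopology \<tau> x sequentially"
      using V.hspace_mcomplete by (auto simp: V.mcomplete_def)
    then have x: "x \<in> hspace V" "\<forall>\<epsilon>>0. \<exists>N. \<forall>n\<ge>N. hdist V (\<tau> n) x < \<epsilon>"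
      unfolding V.limit_metric_sequentially by blast+
    have "hdist W (\<sigma> n) (f x) = hdist V (\<tau> n) x" for n
      using dist[OF \<tau>(1)[of n] x(1)] by (simp add: \<tau>(2))
    moreover have "f x \<in> hspace W" "\<sigma> n \<in> hspace W" for n
      using x \<sigma> by (simp_all add: im)
    ultimately have "limitin W.mtopology \<sigma> (f x) sequentially"
      using x by (simp add: W.limit_metric_sequentially)
    then show "\<exists>x. limitin W.mtopology \<sigma> x sequentially" by blast
  qed
  have subspace: "csubspace (hspace W)"
    unfolding complex_vector.subspace_def
  proof (intro conjI ballI allI)
    show "0 \<in> hspace W" using f0 V.zero_mem im by (metis imageI)
    show "x + y \<in> hspace W" if "x \<in> hspace W" "y \<in> hspace W" for x y
      using that by (auto simp: im V.add_mem simp flip: f_add)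
    show "c *\<^sub>C x \<in> hspace W" if "x \<in> hspace W" for c x
      using that by (auto simp: im V.scaleC_mem simp flip: f_scale)
  qed
  show "hilbert_space W"
  proof (rule hilbert_space.intro)
    show "csubspace (hspace W)" by (rule subspace)
    show "Metric_space.mcomplete (hspace W) (hdist W)" by (rule complete)
    fix u v w c
    show "hinner W v u = cnj (hinner W u v)" if "u \<in> hspace W" "v \<in> hspace W"
      using that unfolding im by (elim imageE) (simp add: f_inner, rule V.hinner_commute)
    show "hinner W (u + v) w = hinner W u w + hinner W v w"
      if "u \<in> hspace W" "v \<in> hspace W" "w \<in> hspace W"
      using that by (auto simp: im f_inner V.add_mem V.hinner_add_left simp flip: f_add)
    show "hinner W (c *\<^sub>C u) v = c * hinner W u v" if "u \<in> hspace W" "v \<in> hspace W"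
      using that by (auto simp: im f_inner V.scaleC_mem V.hinner_scaleC_left simp flip: f_scale)
    show "Re (hinner W u u) \<ge> 0" if "u \<in> hspace W"
      using that by (auto simp: im f_inner V.hinner_ge_zero)
    show "u = 0" if "u \<in> hspace W" "hinner W u u = 0"
      using that V.hinner_eq_zero f0 unfolding im by (elim imageE) (simp add: f_inner, metis)
  qed
qed

text \<open>
  Irreducibility is transported along unitary isomorphisms; \<open>W\<close> is not assumed to be a
  representation.
\<close>

lemma irreducible_rep_transport:
  assumes A: "star_subalgebra A" and V: "irreducible_rep A V"
    and f: "isometric_hom A V W f" "bij_betw f (hspace V) (hspace W)"
  shows "irreducible_rep A W"
proof -
  interpret V: unitary_rep A V using V by (simp add: irreducible_rep_def)
  have f_add: "f (u + v) = f u + f v" if "u \<in> hspace V" "v \<in> hspace V" for u v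
    using f(1) that by (simp add: isometric_hom_def)
  have f_scale: "f (c *\<^sub>C v) = c *\<^sub>C f v" if "v \<in> hspace V" for c v
    using f(1) that by (simp add: isometric_hom_def)
  have f_act: "haction W a (f v) = f (haction V a v)" if "a \<in> A" "v \<in> hspace V" for a v
    using f(1) that by (simp add: isometric_hom_def)
  have f_inner: "hinner W (f u) (f v) = hinner V u v" if "u \<in> hspace V" "v \<in> hspace V" for u v
    using f(1) that by (simp add: isometric_hom_def)
  have im: "hspace W = f ` hspace V" and inj: "inj_on f (hspace V)"
    using f(2) by (simp_all add: bij_betw_def)
  note tr = hilbert_space_transport[OF V.hilbert_space_axioms f(2) f_add f_scale f_inner]
  interpret W: hilbert_space W by (rule tr(1))
  note dist = tr(2) and f0 = tr(3)
  have A_cl: "a + b \<in> A" "a * b \<in> A" "c *\<^sub>C a \<in> A" "star a \<in> A" if "a \<in> A" "b \<in> A" for a b c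
    using A that
    by (auto simp: star_subalgebra_def complex_vector.subspace_add complex_vector.subspace_scale)
  have norm: "hnorm W (f u) = hnorm V u" if "u \<in> hspace V" for u
    using that by (simp add: hnorm_def f_inner)
  have sub_im: "csubspace {v \<in> hspace V. f v \<in> S}" if "csubspace S" for S
    using that V.hspace_subspace f0
    unfolding complex_vector.subspace_def by (auto simp: f_add f_scale)
  have closed_im: "closedin (htopology V) {v \<in> hspace V. f v \<in> S}" if S: "closedin (htopology W) S" for S
    unfolding V.closedin_metric
  proof (intro conjI allI impI)
    fix x assume x: "x \<in> hspace V - {v \<in> hspace V. f v \<in> S}"
    then have "f x \<in> hspace W - S" by (auto simp: im)
    then obtain r where r: "r > 0" "disjnt S (W.mball (f x) r)"
      using S by (auto simp: W.closedin_metric)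
    have "disjnt {v \<in> hspace V. f v \<in> S} (V.mball x r)"
      unfolding disjnt_iff
    proof (intro allI notI)
      fix y assume "y \<in> {v \<in> hspace V. f v \<in> S} \<and> y \<in> V.mball x r"
      then have y: "y \<in> hspace V" "f y \<in> S" and "hdist V x y < r" by auto
      moreover from y x have "f x \<in> hspace W" "f y \<in> hspace W"
        by (simp_all add: im)
      ultimately have "f y \<in> W.mball (f x) r"
        using dist[of x y] x by simp
      then show False using r(2) y by (auto simp: disjnt_iff)
    qed
    then show "\<exists>r>0. disjnt {v \<in> hspace V. f v \<in> S} (V.mball x r)" using r by blast
  qed auto
  have dense: "htopology W closure_of act_span A W = hspace W"
  proof
    show "htopology W closure_of act_span A W \<subseteq> hspace W"
      using closure_of_subset_topspace[of "htopology W"] by simp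
    have cW: "csubspace (act_span A W)"
      by (simp add: act_span_def complex_vector.subspace_span)
    have "haction V a u \<in> {v \<in> hspace V. f v \<in> act_span A W}" if "a \<in> A" "u \<in> hspace V" for a u
    proof -
      have "haction W a (f u) \<in> act_span A W"
        unfolding act_span_def
        by (rule complex_vector.span_base) (use that im in blast)
      then show ?thesis using that by (simp add: f_act V.haction_closed)
    qed
    then have "act_span A V \<subseteq> {v \<in> hspace V. f v \<in> act_span A W}"
      using sub_im[OF cW] unfolding act_span_def[of A V]
      by (intro complex_vector.span_minimal) auto
    then have *: "f x \<in> act_span A W" "x \<in> hspace V" if "x \<in> act_span A V" for x
      using that by auto
    show "hspace W \<subseteq> htopology W closure_of act_span A W"
    proof
      fix y assume "y \<in> hspace W"
      then obtain x where x: "x \<in> hspace V" "y = f x" by (auto simp: im)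
      have near: "\<exists>z\<in>act_span A V. z \<in> V.mball x r" if "r > 0" for r
        using V.act_span_dense x(1) that by (auto simp: V.metric_closure_of)
      have "\<exists>z\<in>act_span A W. z \<in> W.mball y r" if "r > 0" for r
      proof -
        obtain z where z: "z \<in> act_span A V" "hdist V x z < r"
          using near[of r] \<open>r > 0\<close> by auto
        then have "f z \<in> hspace W" "hdist W y (f z) < r"
          using x dist * by (simp_all add: im)
        then show ?thesis
          using *(1)[OF z(1)] \<open>y \<in> hspace W\<close> by auto
      qed
      then show "y \<in> htopology W closure_of act_span A W"
        using \<open>y \<in> hspace W\<close> by (simp add: W.metric_closure_of)
    qed
  qed
  have "unitary_rep A W"
  proof
    fix a b u v c
    show "haction W a v \<in> hspace W" if "a \<in> A" "v \<in> hspace W"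
      using that by (auto simp: im f_act V.haction_closed)
    show "haction W a (u + v) = haction W a u + haction W a v"
      if "a \<in> A" "u \<in> hspace W" "v \<in> hspace W"
      using that
      by (auto simp: im f_act V.haction_closed V.haction_add_right V.add_mem simp flip: f_add)
    show "haction W a (c *\<^sub>C v) = c *\<^sub>C haction W a v" if "a \<in> A" "v \<in> hspace W"
      using that
      by (auto simp: im f_act V.haction_closed V.haction_scaleC_right V.scaleC_mem simp flip: f_scale)
    show "haction W (a + b) v = haction W a v + haction W b v"
      if "a \<in> A" "b \<in> A" "v \<in> hspace W"
      using that
      by (auto simp: im f_act A_cl V.haction_closed V.haction_add_left simp flip: f_add)
    show "haction W (c *\<^sub>C a) v = c *\<^sub>C haction W a v" if "a \<in> A" "v \<in> hspace W"
      using that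
      by (auto simp: im f_act A_cl V.haction_closed V.haction_scaleC_left simp flip: f_scale)
    show "haction W (a * b) v = haction W a (haction W b v)"
      if "a \<in> A" "b \<in> A" "v \<in> hspace W"
      using that by (auto simp: im f_act A_cl V.haction_closed V.haction_mult)
    show "\<exists>K. \<forall>v\<in>hspace W. hnorm W (haction W a v) \<le> K * hnorm W v" if "a \<in> A"
      using V.haction_bounded[OF that] that by (auto simp: im f_act norm V.haction_closed)
    show "hinner W (haction W a u) v = hinner W u (haction W (star a) v)"
      if "a \<in> A" "u \<in> hspace W" "v \<in> hspace W"
      using that by (auto simp: im f_act f_inner A_cl V.haction_closed V.haction_star)
  qed (rule dense)
  moreover have "hspace W \<noteq> {0}"
  proof
    assume "hspace W = {0}"
    then have "hspace V \<subseteq> {0}"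
      using inj f0 V.zero_mem unfolding im inj_on_def by (metis imageI singletonD singletonI subsetI)
    then show False using V V.zero_mem by (auto simp: irreducible_rep_def)
  qed
  moreover have "S = {0} \<or> S = hspace W"
    if S: "csubspace S" "S \<subseteq> hspace W" "\<forall>a\<in>A. \<forall>w\<in>S. haction W a w \<in> S" "closedin (htopology W) S" for S
  proof -
    let ?S = "{v \<in> hspace V. f v \<in> S}"
    have "\<forall>a\<in>A. \<forall>w\<in>?S. haction V a w \<in> ?S"
      using S(3) by (auto simp: V.haction_closed simp flip: f_act)
    then have "?S = {0} \<or> ?S = hspace V"
      using V sub_im[OF S(1)] closed_im[OF S(4)] by (auto simp: irreducible_rep_def)
    moreover have "S = f ` ?S" using S(2) unfolding im by blast
    ultimately have "S = f ` {0} \<or> S = f ` hspace V" by (elim disjE) simp_all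
    then show ?thesis by (simp add: f0 im)
  qed
  ultimately show ?thesis by (auto simp: irreducible_rep_def)
qed

theorem ex_universal_irreducible_rep:
  fixes V :: "('a::star_algebra, 'v::complex_vector) hrep"
  assumes A: "star_subalgebra A" and V: "irreducible_rep A V"
  shows "\<exists>W :: 'a universal_rep. irreducible_rep A W \<and> unitarily_isomorphic A V W"
proof -
  interpret V: unitary_rep A V using V by (simp add: irreducible_rep_def)
  obtain v where v: "v \<in> hspace V" "v \<noteq> 0"
    using V V.zero_mem by (auto simp: irreducible_rep_def)
  define f :: "'v \<Rightarrow> 'a \<Rightarrow> complex"
    where "f w = (\<lambda>a. if a \<in> A then hinner V w (haction V a v) else 0)" for w
  have f_add: "f (u + w) = f u + f w" if "u \<in> hspace V" "w \<in> hspace V" for u w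
    using that v by (auto simp: f_def fun_eq_iff V.haction_closed V.hinner_add_left)
  have f_scale: "f (c *\<^sub>C w) = c *\<^sub>C f w" if "w \<in> hspace V" for c w
    using that v
    by (auto simp: f_def fun_eq_iff V.haction_closed V.hinner_scaleC_left scaleC_fun_def scaleC_complex_def)
  have A_cl: "a * b \<in> A" "star a \<in> A" if "a \<in> A" "b \<in> A" for a b
    using A that by (auto simp: star_subalgebra_def)
  define S where "S = {w \<in> hspace V. \<forall>a\<in>A. hinner V w (haction V a v) = 0}"
  have "S = {0}"
  proof -
    have "csubspace S"
      unfolding complex_vector.subspace_def S_def using v
      by (auto simp: V.zero_mem V.add_mem V.scaleC_mem V.hinner_zero_left V.hinner_add_left
          V.hinner_scaleC_left V.haction_closed)
    moreover have "\<forall>a\<in>A. \<forall>w\<in>S. haction V a w \<in> S"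
      using v by (auto simp: S_def V.haction_closed V.haction_star A_cl simp flip: V.haction_mult)
    moreover have "closedin (htopology V) S"
    proof -
      have "S = \<Inter>(insert (hspace V) ((\<lambda>a. {w \<in> hspace V. hinner V w (haction V a v) = 0}) ` A))"
        by (auto simp: S_def)
      moreover have "closedin (htopology V) \<dots>"
        using v V.haction_closed V.closedin_orthogonal closedin_topspace[of "htopology V"]
        by (intro closedin_Inter) auto
      ultimately show ?thesis by simp
    qed
    ultimately have "S = {0} \<or> S = hspace V"
      using V by (auto simp: irreducible_rep_def S_def)
    moreover have "S \<noteq> hspace V"
    proof
      assume S: "S = hspace V"
      have "hinner V (haction V a u) v = 0" if "a \<in> A" "u \<in> hspace V" for a u
      proof -
        have "u \<in> S" using S that by simp
        then show ?thesis using that v A_cl by (simp add: V.haction_star S_def)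
      qed
      then show False using V.orthogonal_act_eq_zero v by blast
    qed
    ultimately show ?thesis by blast
  qed
  have inj: "inj_on f (hspace V)"
  proof (rule inj_onI)
    fix u w assume uw: "u \<in> hspace V" "w \<in> hspace V" "f u = f w"
    have "hinner V u (haction V a v) = hinner V w (haction V a v)" if "a \<in> A" for a
      using fun_cong[OF uw(3), of a] that by (simp add: f_def)
    then have "u - w \<in> S"
      using uw v by (simp add: S_def V.diff_mem V.hinner_diff_left V.haction_closed)
    then show "u = w" using \<open>S = {0}\<close> by simp
  qed
  define g where "g = inv_into (hspace V) f"
  have g: "g (f w) = w" if "w \<in> hspace V" for w
    using that inj by (simp add: g_def)
  define W :: "'a universal_rep"
    where "W = \<lparr>hspace = f ` hspace V, hinner = (\<lambda>x y. hinner V (g x) (g y)),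
      haction = (\<lambda>a x. f (haction V a (g x)))\<rparr>"
  have "isometric_hom A V W f"
    by (simp add: isometric_hom_def W_def f_add f_scale g V.haction_closed)
  moreover have "bij_betw f (hspace V) (hspace W)"
    using inj by (simp add: W_def bij_betw_def)
  ultimately show ?thesis
    using irreducible_rep_transport[OF A V] by (auto simp: unitarily_isomorphic_def)
qed

end

theory Submission
  imports Defs
begin

text \<open>
  Let \<open>u\<close> be a unit vector of \<open>U\<close> fixed by a projection \<open>e \<in> B\<close>, and let \<open>D\<close> be the pointwise closure
  of the set of vector states \<open>a \<mapsto> \<langle>av, v\<rangle>\<close> of \<open>A\<close> for unit vectors \<open>v \<in> eV'\<close>. The set \<open>D\<close> is compact, and
  since \<open>U\<close> is weakly contained in the closure of \<open>BV'\<close>, some elements of \<open>D\<close> extend the state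
  \<open>b \<mapsto> \<langle>bu, u\<rangle>\<close> of \<open>B\<close>. Take an extreme one among them, \<open>\<psi>\<close>, and let \<open>V\<close> be its GNS representation.
  Vector states of \<open>V\<close> at unit vectors fixed by \<open>e\<close> lie in \<open>D\<close> again, so \<open>V\<close> is weakly contained in
  \<open>V'\<close>. If \<open>P\<close> is the projection to a closed \<open>A\<close>-submodule of \<open>V\<close>, then \<open>\<langle>bP\<xi>, P\<xi>\<rangle>\<close> is proportional to
  \<open>\<langle>bu, u\<rangle>\<close> for \<open>b \<in> B\<close> by Schur's lemma for \<open>U\<close>, so extremality makes \<open>P\<xi>\<close> a multiple of the cyclic
  vector \<open>\<xi>\<close>; hence \<open>V\<close> is irreducible. No convexity of \<open>D\<close> is needed, so neither the Hahn-Banach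
  theorem nor Milman's theorem enters.
\<close>

section \<open>Pointwise closure and extreme points\<close>

text \<open>\<open>A\<close> has no unit, so a pointwise limit of vector states could lose mass,
  down to the zero functional. The projection \<open>e\<close> prevents this: at unit vectors of eV'
  every state has the value 1 at \<open>e\<close>, a condition on a single coordinate that survives
  limits, and \<open>e\<close> also takes the place of the unit in the GNS construction. Since
  \<open>P\<close> commutes with \<open>e\<close>, both components of \<xi> are fixed by
  \<open>e\<close>, so their normalized states stay in \<open>D\<close>. An extension of the state
  of \<open>U\<close> exists in \<open>D\<close> because restriction of functionals to
  \<open>B\<close> is continuous: the image of \<open>D\<close> is compact, hence closed, and it
  contains the vector states of \<open>B\<close> that approximate the state of \<open>U\<close>. The
  embedding of \<open>U\<close> into \<open>V\<close> is bu \<mapsto> b\<xi>, whose image lies in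
  the closure of BV. The reverse inclusion of spectra is transitivity of weak containment; there the
  approximating vector has to be moved into BV', again by a projection of \<open>B\<close>.\<close>

lemma closure_fun_iff:
  fixes f :: "'i \<Rightarrow> 'b::metric_space"
  shows "f \<in> closure S \<longleftrightarrow> (\<forall>T. finite T \<longrightarrow> (\<forall>\<epsilon>>0. \<exists>g\<in>S. \<forall>i\<in>T. dist (g i) (f i) < \<epsilon>))"
    (is "?L \<longleftrightarrow> ?R")
proof
  assume L: ?L
  show ?R
  proof (intro allI impI)
    fix T :: "'i set" and \<epsilon> :: real
    assume "finite T" "\<epsilon> > 0"
    have "open {g :: 'i \<Rightarrow> 'b. \<forall>i\<in>T. g (id i) \<in> ball (f i) \<epsilon>}"
      by (rule product_topology_basis') (use \<open>finite T\<close> in auto)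
    moreover have "f \<in> {g. \<forall>i\<in>T. g (id i) \<in> ball (f i) \<epsilon>}"
      using \<open>\<epsilon> > 0\<close> by simp
    ultimately have "S \<inter> {g. \<forall>i\<in>T. g (id i) \<in> ball (f i) \<epsilon>} \<noteq> {}"
      using L unfolding closure_iff_nhds_not_empty by (metis (no_types, lifting) order_refl)
    then show "\<exists>g\<in>S. \<forall>i\<in>T. dist (g i) (f i) < \<epsilon>"
      by (auto simp: dist_commute)
  qed
next
  assume R: ?R
  show ?L
    unfolding closure_iff_nhds_not_empty
  proof (intro allI impI)
    fix U V :: "('i \<Rightarrow> 'b) set"
    assume "V \<subseteq> U" "open V" "f \<in> V"
    then have "openin (product_topology (\<lambda>_. euclidean) UNIV) V"
      by (simp add: open_fun_def)
    from product_topology_open_contains_basis[OF this \<open>f \<in> V\<close>]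
    obtain X where X: "f \<in> (\<Pi>\<^sub>E i\<in>UNIV. X i)" "\<And>i. open (X i)" "finite {i. X i \<noteq> UNIV}"
        "(\<Pi>\<^sub>E i\<in>UNIV. X i) \<subseteq> V"
      by auto
    have "\<forall>i. \<exists>r>0. ball (f i) r \<subseteq> X i"
    proof
      fix i
      have "f i \<in> X i" using X(1) by (rule PiE_mem) simp
      then show "\<exists>r>0. ball (f i) r \<subseteq> X i"
        using X(2)[of i] by (simp add: open_contains_ball)
    qed
    then obtain r where r: "\<And>i. r i > 0" "\<And>i. ball (f i) (r i) \<subseteq> X i"
      by metis
    \<comment> \<open>Only finitely many factors \<open>X i\<close> are proper, so a common radius
      exists; the entry 1 covers the case that none is.\<close>
    define \<epsilon> where "\<epsilon> = Min (insert 1 (r ` {i. X i \<noteq> UNIV}))"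
    have "\<epsilon> > 0"
      using X(3) r(1) by (auto simp: \<epsilon>_def)
    then obtain g where g: "g \<in> S" "\<And>i. X i \<noteq> UNIV \<Longrightarrow> dist (g i) (f i) < \<epsilon>"
      using R[rule_format, OF X(3), of \<epsilon>] by auto
    have "g i \<in> X i" for i
    proof (cases "X i = UNIV")
      case False
      then have "\<epsilon> \<le> r i" using X(3) by (auto simp: \<epsilon>_def)
      then show ?thesis
        using g(2)[OF False] r(2)[of i] by (auto simp: dist_commute subset_iff)
    qed simp
    then have "g \<in> V" using X(4) by auto
    then show "S \<inter> U \<noteq> {}" using g(1) \<open>V \<subseteq> U\<close> by blast
  qed
qed

text \<open>Tychonoff's theorem for closed discs. A radius 0 forces the value 0, which is how
  functions vanishing outside an algebra or a subspace are kept in a compact set.\<close>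

lemma compact_Pi_cball: "compact {f :: 'i \<Rightarrow> complex. \<forall>i. cmod (f i) \<le> K i}"
proof -
  have "compactin (product_topology (\<lambda>_. euclidean) UNIV) (\<Pi>\<^sub>E i\<in>UNIV. cball (0::complex) (K i))"
    by (simp add: compactin_PiE)
  moreover have "(\<Pi>\<^sub>E i\<in>UNIV. cball (0::complex) (K i)) = {f. \<forall>i. cmod (f i) \<le> K i}"
    by (auto simp: PiE_def Pi_def)
  ultimately show ?thesis
    by (simp add: euclidean_product_topology)
qed

text \<open>The product is Hausdorff. This is what makes continuous images of compact sets of
  functionals closed.\<close>

lemma compact_imp_closed_fun:
  fixes D :: "('i \<Rightarrow> 'b::metric_space) set"
  assumes "compact D"
  shows "closed D"
proof -
  have "Hausdorff_space (product_topology (\<lambda>_ :: 'i. euclidean :: 'b topology) UNIV)"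
    by (simp add: Hausdorff_space_product_topology)
  then have "closedin euclidean D"
    using assms by (intro compactin_imp_closedin) (simp_all add: euclidean_product_topology)
  then show ?thesis by simp
qed

text \<open>
  The set \<open>D\<close> is not assumed to be convex: a minimal closed face of \<open>D\<close> is a singleton since
  each of its coordinates can be maximized.
\<close>

lemma compact_extreme_point:
  fixes D :: "('i \<Rightarrow> complex) set"
  assumes D: "compact D" "D \<noteq> {}"
  shows "\<exists>z\<in>D. \<forall>t x y. 0 < t \<longrightarrow> t < 1 \<longrightarrow> x \<in> D \<longrightarrow> y \<in> D \<longrightarrow>
    (\<forall>i. z i = of_real t * x i + of_real (1 - t) * y i) \<longrightarrow> x = z \<and> y = z"
proof -
  \<comment> \<open>The usual closed faces, except that the endpoints range over \<open>D\<close>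
    while the rest of the segment may leave \<open>D\<close>.\<close>
  define face where "face F \<longleftrightarrow> F \<subseteq> D \<and> closed F \<and> F \<noteq> {} \<and>
    (\<forall>t x y z. 0 < t \<longrightarrow> t < 1 \<longrightarrow> x \<in> D \<longrightarrow> y \<in> D \<longrightarrow> z \<in> F \<longrightarrow>
      (\<forall>i. z i = of_real t * x i + of_real (1 - t) * y i) \<longrightarrow> x \<in> F \<and> y \<in> F)" for F
  have faceD: "F \<subseteq> D" "closed F" "F \<noteq> {}" if "face F" for F
    using that unfolding face_def by simp_all
  have "closed D" using D(1) by (rule compact_imp_closed_fun)
  \<comment> \<open>Zorn's lemma yields inclusion-maximal sets, so it is applied to the complements
    of faces to obtain a minimal face.\<close>
  have "\<exists>M\<in>uminus ` Collect face. \<forall>X\<in>uminus ` Collect face. M \<subseteq> X \<longrightarrow> X = M"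
  proof (rule subset_Zorn_nonempty)
    have "face D" using D \<open>closed D\<close> by (auto simp: face_def)
    then show "uminus ` Collect face \<noteq> {}" by blast
    fix \<C> assume \<C>: "\<C> \<noteq> {}" "subset.chain (uminus ` Collect face) \<C>"
    define \<F> where "\<F> = uminus ` \<C>"
    have faces: "face F" if "F \<in> \<F>" for F
      using \<C>(2) that unfolding subset_chain_def \<F>_def by auto
    have "X \<subseteq> Y \<or> Y \<subseteq> X" if "X \<in> \<C>" "Y \<in> \<C>" for X Y
      using \<C>(2) that unfolding subset_chain_def by simp
    then have chain: "F \<subseteq> G \<or> G \<subseteq> F" if "F \<in> \<F>" "G \<in> \<F>" for F G
      using that unfolding \<F>_def by (elim imageE) (metis Compl_subset_Compl_iff)
    have "\<F> \<noteq> {}" using \<C>(1) by (simp add: \<F>_def)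
    \<comment> \<open>Compactness reduces this to finite subfamilies, and a finite nonempty
      subfamily of a chain has a smallest member, which is its intersection.\<close>
    have "D \<inter> \<Inter>\<F> \<noteq> {}"
    proof (rule compact_imp_fip[OF D(1)])
      show "closed F" if "F \<in> \<F>" for F using faces faceD(2) that by simp
      fix \<G> assume \<G>: "finite \<G>" "\<G> \<subseteq> \<F>"
      show "D \<inter> \<Inter>\<G> \<noteq> {}"
      proof (cases "\<G> = {}")
        case False
        have "\<exists>F\<in>\<G>. \<forall>G\<in>\<G>. F \<subseteq> G"
          using \<G>(1) False \<G>(2)
        proof (induction rule: finite_ne_induct)
          case (insert F \<G>)
          then obtain F' where "F' \<in> \<G>" "\<forall>G\<in>\<G>. F' \<subseteq> G" by auto
          moreover have "F \<subseteq> F' \<or> F' \<subseteq> F"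
            using calculation chain[of F F'] insert.prems by auto
          ultimately show ?case by (metis insert_iff order_refl order_trans)
        qed simp
        then obtain F where "F \<in> \<G>" "F \<subseteq> \<Inter>\<G>" by blast
        then have "face F" using faces \<G>(2) by blast
        then show ?thesis using \<open>F \<subseteq> \<Inter>\<G>\<close> faceD(1,3)[of F] by blast
      qed (use D in simp)
    qed
    then have "face (\<Inter>\<F>)"
      unfolding face_def
    proof (intro conjI allI impI)
      show "\<Inter>\<F> \<subseteq> D" using faces faceD(1) \<open>\<F> \<noteq> {}\<close> by blast
      show "closed (\<Inter>\<F>)" using faces faceD(2) by (intro closed_Inter) simp
      show "\<Inter>\<F> \<noteq> {}" using \<open>D \<inter> \<Inter>\<F> \<noteq> {}\<close> by blast
      fix t x y z
      assume t: "0 < t" "t < 1" "x \<in> D" "y \<in> D" and z: "z \<in> \<Inter>\<F>"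
        "\<forall>i. z i = of_real t * x i + of_real (1 - t) * y i"
      have "x \<in> F \<and> y \<in> F" if "F \<in> \<F>" for F
      proof -
        have "z \<in> F" using z(1) that by blast
        then show ?thesis using faces[OF that] t z(2) unfolding face_def by metis
      qed
      then show "x \<in> \<Inter>\<F>" "y \<in> \<Inter>\<F>" by auto
    qed
    moreover have "\<Union>\<C> = - \<Inter>\<F>" by (auto simp: \<F>_def)
    ultimately show "\<Union>\<C> \<in> uminus ` Collect face" by blast
  qed
  then obtain M where M0: "face M" "\<And>F. face F \<Longrightarrow> - M \<subseteq> - F \<Longrightarrow> - F = - M"
    by auto
  have M: "face M" "\<And>F. face F \<Longrightarrow> F \<subseteq> M \<Longrightarrow> F = M"
    using M0(1) by (simp, use M0(2) in \<open>simp add: Compl_subset_Compl_iff\<close>)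
  \<comment> \<open>The maximizers of a real functional of one coordinate form a face inside
    \<open>M\<close>, hence all of \<open>M\<close>. The factor \<open>c\<close> gives access to
    real and imaginary parts, through the values 1 and -\<i>.\<close>
  have const: "Re (c * x i) = Re (c * y i)" if xy: "x \<in> M" "y \<in> M" for c i x y
  proof -
    define l where "l f = Re (c * f i)" for f :: "'i \<Rightarrow> complex"
    have l_cont: "continuous_on UNIV l"
      unfolding l_def by (intro continuous_intros continuous_on_product_coordinates)
    have "compact M"
      using faceD(1,2)[OF M(1)] D(1) by (metis closed_Int_compact inf.absorb1)
    then obtain m where m: "m \<in> M" "\<And>x. x \<in> M \<Longrightarrow> l x \<le> l m"
      using continuous_attains_sup[of M l] faceD(3)[OF M(1)] continuous_on_subset[OF l_cont, of M]
      by auto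
    have "face {x \<in> M. l x = l m}"
      unfolding face_def
    proof (intro conjI allI impI)
      have "closed (M \<inter> l -` {l m})"
        using faceD(2)[OF M(1)] l_cont by (intro closed_Int closed_vimage) auto
      then show "closed {x \<in> M. l x = l m}" by (simp add: vimage_def Int_def)
      show "{x \<in> M. l x = l m} \<noteq> {}" using m by blast
      show "{x \<in> M. l x = l m} \<subseteq> D" using faceD(1)[OF M(1)] by auto
      fix t x y z
      assume t: "0 < t" "t < 1" and xyz: "x \<in> D" "y \<in> D" "z \<in> {x \<in> M. l x = l m}"
        and z: "\<forall>i. z i = of_real t * x i + of_real (1 - t) * y i"
      then have in_M: "x \<in> M" "y \<in> M"
        using M(1) unfolding face_def by (metis (no_types, lifting) mem_Collect_eq)+
      have "l z = t * l x + (1 - t) * l y"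
        unfolding l_def z[rule_format] by (simp add: algebra_simps)
      then have "t * (l m - l x) + (1 - t) * (l m - l y) = 0"
        using xyz(3) by (simp add: algebra_simps)
      moreover have "t * (l m - l x) \<ge> 0" "(1 - t) * (l m - l y) \<ge> 0"
        using t m in_M by simp_all
      ultimately have "t * (l m - l x) = 0" "(1 - t) * (l m - l y) = 0"
        by linarith+
      then show "x \<in> {x \<in> M. l x = l m}" "y \<in> {x \<in> M. l x = l m}"
        using t in_M by simp_all
    qed
    then have "{x \<in> M. l x = l m} = M" by (intro M(2)) auto
    then have "l x = l m" "l y = l m" using xy by auto
    then show ?thesis by (simp add: l_def)
  qed
  have single: "x = y" if "x \<in> M" "y \<in> M" for x y
    using const[OF that, of 1] const[OF that, of "- \<i>"] by (auto simp: fun_eq_iff complex_eq_iff)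
  obtain z where "z \<in> M" using faceD(3)[OF M(1)] by blast
  then have "z \<in> D" using faceD(1)[OF M(1)] by blast
  moreover have "x = z \<and> y = z"
    if "0 < t" "t < 1" "x \<in> D" "y \<in> D" "\<forall>i. z i = of_real t * x i + of_real (1 - t) * y i" for t x y
  proof -
    have "x \<in> M \<and> y \<in> M"
      using M(1) \<open>z \<in> M\<close> that unfolding face_def by metis
    then show ?thesis using single \<open>z \<in> M\<close> by blast
  qed
  ultimately show ?thesis by blast
qed

section \<open>Semi-inner products\<close>

lemma scaleC_minus1: "(- 1) *\<^sub>C x = - x"
  by (simp add: complex_vector.scale_minus_left scaleC_one)

text \<open>Definiteness and completeness are left out so that the same estimates serve three kinds
  of forms: the GNS form built from a functional, invariant forms on an irreducible representation,
  and the inner product of a Hilbert space.\<close>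

locale semi_inner =
  fixes X :: "'x::complex_vector set" and s :: "'x \<Rightarrow> 'x \<Rightarrow> complex"
  assumes subspace: "csubspace X"
    and commute: "\<lbrakk>x \<in> X; y \<in> X\<rbrakk> \<Longrightarrow> s y x = cnj (s x y)"
    and add_left: "\<lbrakk>x \<in> X; y \<in> X; z \<in> X\<rbrakk> \<Longrightarrow> s (x + y) z = s x z + s y z"
    and scaleC_left: "\<lbrakk>x \<in> X; y \<in> X\<rbrakk> \<Longrightarrow> s (c *\<^sub>C x) y = c * s x y"
    and ge_zero: "x \<in> X \<Longrightarrow> Re (s x x) \<ge> 0"
begin

definition seminorm :: "'x \<Rightarrow> real"
  where "seminorm x = sqrt (Re (s x x))"

lemma zero_in: "0 \<in> X"
  and add_in: "\<lbrakk>x \<in> X; y \<in> X\<rbrakk> \<Longrightarrow> x + y \<in> X"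
  and scaleC_in: "x \<in> X \<Longrightarrow> c *\<^sub>C x \<in> X"
  and diff_in: "\<lbrakk>x \<in> X; y \<in> X\<rbrakk> \<Longrightarrow> x - y \<in> X"
  using subspace
  by (auto intro: complex_vector.subspace_0 complex_vector.subspace_add
      complex_vector.subspace_scale complex_vector.subspace_diff)

lemma add_right: "\<lbrakk>x \<in> X; y \<in> X; z \<in> X\<rbrakk> \<Longrightarrow> s z (x + y) = s z x + s z y"
  by (metis add_in add_left commute complex_cnj_add)

lemma scaleC_right: "\<lbrakk>x \<in> X; y \<in> X\<rbrakk> \<Longrightarrow> s x (c *\<^sub>C y) = cnj c * s x y"
  by (metis scaleC_in scaleC_left commute complex_cnj_mult)

lemma diff_left: "\<lbrakk>x \<in> X; y \<in> X; z \<in> X\<rbrakk> \<Longrightarrow> s (x - y) z = s x z - s y z"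
  using add_left[of "x - y" y z] by (simp add: diff_in)

lemma diff_right: "\<lbrakk>x \<in> X; y \<in> X; z \<in> X\<rbrakk> \<Longrightarrow> s z (x - y) = s z x - s z y"
  using add_right[of "x - y" y z] by (simp add: diff_in)

lemma zero_left: "x \<in> X \<Longrightarrow> s 0 x = 0"
  using add_left[of 0 0 x] by (simp add: zero_in)

lemma seminorm_ge_zero: "x \<in> X \<Longrightarrow> 0 \<le> seminorm x"
  by (simp add: seminorm_def ge_zero)

lemma self_eq: "x \<in> X \<Longrightarrow> s x x = of_real ((seminorm x)\<^sup>2)"
  using commute[of x x] by (simp add: seminorm_def ge_zero complex_eq_iff)

lemma Cauchy_Schwarz_square:
  assumes x: "x \<in> X" and y: "y \<in> X"
  shows "(cmod (s x y))\<^sup>2 \<le> Re (s x x) * Re (s y y)"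
proof -
  define z where "z = s x y"
  define a where "a = Re (s x x)"
  define b where "b = Re (s y y)"
  define k where "k = (cmod z)\<^sup>2"
  have xx: "s x x = of_real a" and yy: "s y y = of_real b"
    unfolding a_def b_def by (metis self_eq Re_complex_of_real x, metis self_eq Re_complex_of_real y)
  have yx: "s y x = cnj z" unfolding z_def by (rule commute[OF x y])
  have zz: "z * cnj z = of_real k" unfolding k_def by (rule complex_norm_square[symmetric])
  \<comment> \<open>With \<open>z = s x y\<close> the phase is already contained in the direction
    \<open>z *\<^sub>C y\<close>, so a real parameter \<open>t\<close> is enough. Keeping
    \<open>t\<close> free covers the degenerate case \<open>b = 0\<close>, where dividing by
    \<open>b\<close> is impossible.\<close>
  have pos: "0 \<le> a - 2 * t * k + t\<^sup>2 * k * b" for t :: real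
  proof -
    let ?w = "x - (of_real t * z) *\<^sub>C y"
    have "s ?w ?w = of_real a - of_real t * (z * cnj z) - of_real t * (z * cnj z)
        + of_real t * of_real t * of_real b * (z * cnj z)"
      using x y
      by (simp add: diff_left diff_right scaleC_left scaleC_right diff_in scaleC_in xx yy yx
          algebra_simps flip: z_def)
    also have "\<dots> = of_real (a - 2 * t * k + t\<^sup>2 * k * b)"
      unfolding zz by (simp add: power2_eq_square)
    finally have "Re (s ?w ?w) = a - 2 * t * k + t\<^sup>2 * k * b"
      by simp
    then show ?thesis
      using ge_zero[of ?w] x y by (simp add: diff_in scaleC_in)
  qed
  have "a \<ge> 0" "b \<ge> 0" "k \<ge> 0" using x y ge_zero by (simp_all add: a_def b_def k_def)
  show ?thesis
  proof (cases "b = 0")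
    case True
    have "k = 0"
    proof (rule ccontr)
      assume "k \<noteq> 0"
      \<comment> \<open>For b = 0 the expression at t = (a + 1) / k equals -a - 2.\<close>
      then show False using pos[of "(a + 1) / k"] True \<open>a \<ge> 0\<close> by simp
    qed
    then show ?thesis using True by (simp add: k_def z_def b_def)
  next
    case False
    then have "b > 0" using \<open>b \<ge> 0\<close> by simp
    have "0 \<le> b * (a - 2 * (1 / b) * k + (1 / b)\<^sup>2 * k * b)"
      using pos[of "1 / b"] \<open>b > 0\<close> by (intro mult_nonneg_nonneg) auto
    also have "\<dots> = a * b - k"
      using \<open>b > 0\<close> by (simp add: field_simps power2_eq_square)
    finally show ?thesis by (simp add: k_def z_def a_def b_def)
  qed
qed

lemma Cauchy_Schwarz: "\<lbrakk>x \<in> X; y \<in> X\<rbrakk> \<Longrightarrow> cmod (s x y) \<le> seminorm x * seminorm y"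
  using real_sqrt_le_mono[OF Cauchy_Schwarz_square[of x y]] by (simp add: seminorm_def real_sqrt_mult)

text \<open>Test with y = x. Estimates of norms by duality go through this rule: the triangle
  inequality, and later the norm of the completion.\<close>

lemma seminorm_leI:
  assumes x: "x \<in> X" and C: "C \<ge> 0" and le: "\<And>y. y \<in> X \<Longrightarrow> cmod (s x y) \<le> C * seminorm y"
  shows "seminorm x \<le> C"
proof (rule ccontr)
  assume "\<not> seminorm x \<le> C"
  moreover have "seminorm x * seminorm x \<le> C * seminorm x"
    using le[OF x] self_eq[OF x] by (simp add: power2_eq_square norm_mult seminorm_ge_zero[OF x])
  ultimately show False using C by simp
qed

lemma seminorm_add:
  assumes "x \<in> X" "y \<in> X"
  shows "seminorm (x + y) \<le> seminorm x + seminorm y"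
proof (rule seminorm_leI)
  show "cmod (s (x + y) z) \<le> (seminorm x + seminorm y) * seminorm z" if "z \<in> X" for z
    using norm_triangle_ineq[of "s x z" "s y z"] Cauchy_Schwarz[of x z] Cauchy_Schwarz[of y z] assms that
    by (simp add: add_left distrib_right)
qed (use assms in \<open>simp_all add: add_in seminorm_ge_zero\<close>)

lemma seminorm_scaleC: "x \<in> X \<Longrightarrow> seminorm (c *\<^sub>C x) = cmod c * seminorm x"
proof -
  assume x: "x \<in> X"
  have "s (c *\<^sub>C x) (c *\<^sub>C x) = (c * cnj c) * s x x"
    using x by (simp add: scaleC_left scaleC_right scaleC_in)
  also have "\<dots> = of_real ((cmod c)\<^sup>2 * (seminorm x)\<^sup>2)"
    using x by (simp only: self_eq complex_norm_square[symmetric]) simp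
  finally have "Re (s (c *\<^sub>C x) (c *\<^sub>C x)) = (cmod c)\<^sup>2 * (seminorm x)\<^sup>2" by simp
  then show ?thesis
    using x by (simp add: seminorm_def[of "c *\<^sub>C x"] real_sqrt_mult seminorm_ge_zero)
qed

lemma seminorm_zero: "seminorm 0 = 0"
  by (simp add: seminorm_def zero_left zero_in)

lemma seminorm_diff:
  assumes "x \<in> X" "y \<in> X"
  shows "seminorm (x - y) \<le> seminorm x + seminorm y"
    and "seminorm x \<le> seminorm (x - y) + seminorm y"
    and "seminorm (x - y) = seminorm (y - x)"
proof -
  have m: "(- 1) *\<^sub>C z = - z" for z :: 'x by (simp add: scaleC_minus1)
  show "seminorm (x - y) \<le> seminorm x + seminorm y"
    using seminorm_add[OF assms(1) scaleC_in[OF assms(2), of "- 1"]] seminorm_scaleC[OF assms(2), of "- 1"]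
    by (simp add: m)
  show "seminorm x \<le> seminorm (x - y) + seminorm y"
    using seminorm_add[of "x - y" y] assms by (simp add: diff_in)
  show "seminorm (x - y) = seminorm (y - x)"
    using seminorm_scaleC[of "x - y" "- 1"] assms by (simp add: diff_in m)
qed

end

section \<open>Convergence in Hilbert spaces\<close>

text \<open>The rewrite rule lets the facts about the seminorm of the locale be used as facts about
  \<open>hnorm\<close>.\<close>

sublocale hilbert_space \<subseteq> S: semi_inner "hspace V" "hinner V"
  rewrites "semi_inner.seminorm (hinner V) = hnorm V"
proof -
  show *: "semi_inner (hspace V) (hinner V)"
    by unfold_locales
      (auto intro: hspace_subspace hinner_commute hinner_add_left hinner_scaleC_left hinner_ge_zero)
  show "semi_inner.seminorm (hinner V) = hnorm V"
    by (simp add: fun_eq_iff semi_inner.seminorm_def[OF *] hnorm_def)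
qed

text \<open>Norm convergence. Membership is part of it because \<open>hnorm\<close> means nothing
  outside \<open>hspace V\<close>; closures and closed sets are handled through such
  sequences.\<close>

definition hlim :: "('v::complex_vector, 'm) hilbert_scheme \<Rightarrow> (nat \<Rightarrow> 'v) \<Rightarrow> 'v \<Rightarrow> bool"
  where "hlim V \<sigma> x \<longleftrightarrow> range \<sigma> \<subseteq> hspace V \<and> x \<in> hspace V \<and> (\<lambda>n. hnorm V (\<sigma> n - x)) \<longlonglongrightarrow> 0"

context hilbert_space
begin

lemma hlimD: "hlim V \<sigma> x \<Longrightarrow> \<sigma> n \<in> hspace V" "hlim V \<sigma> x \<Longrightarrow> x \<in> hspace V"
    "hlim V \<sigma> x \<Longrightarrow> (\<lambda>n. hnorm V (\<sigma> n - x)) \<longlonglongrightarrow> 0"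
  by (auto simp: hlim_def)

lemma hlim_const: "x \<in> hspace V \<Longrightarrow> hlim V (\<lambda>_. x) x"
  by (simp add: hlim_def image_subset_iff S.seminorm_zero)

lemma hlimI_le:
  assumes "\<And>n. \<sigma> n \<in> hspace V" "x \<in> hspace V" "\<And>n. hnorm V (\<sigma> n - x) \<le> f n" "f \<longlonglongrightarrow> 0"
  shows "hlim V \<sigma> x"
proof -
  have "(\<lambda>n. hnorm V (\<sigma> n - x)) \<longlonglongrightarrow> 0"
    by (rule tendsto_sandwich[OF _ _ tendsto_const assms(4)])
      (use assms in \<open>auto intro!: always_eventually S.seminorm_ge_zero diff_mem\<close>)
  then show ?thesis using assms by (auto simp: hlim_def)
qed

lemma hlim_add:
  assumes "hlim V \<sigma> x" "hlim V \<tau> y"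
  shows "hlim V (\<lambda>n. \<sigma> n + \<tau> n) (x + y)"
proof (rule hlimI_le)
  note a = hlimD[OF assms(1)] and b = hlimD[OF assms(2)]
  show "hnorm V (\<sigma> n + \<tau> n - (x + y)) \<le> hnorm V (\<sigma> n - x) + hnorm V (\<tau> n - y)" for n
    using hnorm_triangle[of "\<sigma> n - x" "\<tau> n - y"] a b by (simp add: diff_mem algebra_simps)
  show "(\<lambda>n. hnorm V (\<sigma> n - x) + hnorm V (\<tau> n - y)) \<longlonglongrightarrow> 0"
    using tendsto_add[OF a(3) b(3)] by simp
qed (use hlimD[OF assms(1)] hlimD[OF assms(2)] in \<open>simp_all add: add_mem\<close>)

lemma hlim_scaleC:
  assumes "hlim V \<sigma> x"
  shows "hlim V (\<lambda>n. c *\<^sub>C \<sigma> n) (c *\<^sub>C x)"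
proof (rule hlimI_le)
  note a = hlimD[OF assms]
  have "c *\<^sub>C \<sigma> n - c *\<^sub>C x = c *\<^sub>C (\<sigma> n - x)" for n
    by (rule complex_vector.scale_right_diff_distrib[symmetric])
  then show "hnorm V (c *\<^sub>C \<sigma> n - c *\<^sub>C x) \<le> cmod c * hnorm V (\<sigma> n - x)" for n
    using a by (simp add: S.seminorm_scaleC diff_mem)
  show "(\<lambda>n. cmod c * hnorm V (\<sigma> n - x)) \<longlonglongrightarrow> 0"
    using tendsto_mult_left[OF a(3), of "cmod c"] by simp
qed (use hlimD[OF assms] in \<open>simp_all add: scaleC_mem\<close>)

lemma hlim_diff:
  assumes "hlim V \<sigma> x" "hlim V \<tau> y"
  shows "hlim V (\<lambda>n. \<sigma> n - \<tau> n) (x - y)"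
  using hlim_add[OF assms(1) hlim_scaleC[OF assms(2), of "- 1"]]
  by (simp add: scaleC_minus1)

lemma hlim_norm:
  assumes "hlim V \<sigma> x"
  shows "(\<lambda>n. hnorm V (\<sigma> n)) \<longlonglongrightarrow> hnorm V x"
proof -
  note a = hlimD[OF assms]
  have "\<bar>hnorm V (\<sigma> n) - hnorm V x\<bar> \<le> hnorm V (\<sigma> n - x)" for n
    using S.seminorm_diff(2)[OF a(1,2), of n] S.seminorm_diff(2)[OF a(2,1), of n]
      S.seminorm_diff(3)[OF a(1,2), of n]
    by linarith
  then have "(\<lambda>n. hnorm V (\<sigma> n) - hnorm V x) \<longlonglongrightarrow> 0"
    by (intro Lim_null_comparison[OF _ a(3)] always_eventually allI) simp
  then show ?thesis by (simp add: LIM_zero_iff)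
qed

lemma hlim_inner:
  assumes "hlim V \<sigma> x" "hlim V \<tau> y"
  shows "(\<lambda>n. hinner V (\<sigma> n) (\<tau> n)) \<longlonglongrightarrow> hinner V x y"
proof -
  note a = hlimD[OF assms(1)] and b = hlimD[OF assms(2)]
  have "hinner V (\<sigma> n) (\<tau> n) - hinner V x y
      = hinner V (\<sigma> n - x) (\<tau> n) + hinner V x (\<tau> n - y)" for n
    using a(1,2) b(1,2) by (simp add: S.diff_left S.diff_right)
  then have "norm (hinner V (\<sigma> n) (\<tau> n) - hinner V x y)
      \<le> hnorm V (\<sigma> n - x) * hnorm V (\<tau> n) + hnorm V x * hnorm V (\<tau> n - y)" for n
    using norm_triangle_ineq[of "hinner V (\<sigma> n - x) (\<tau> n)" "hinner V x (\<tau> n - y)"]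
      S.Cauchy_Schwarz[OF diff_mem[OF a(1,2)] b(1), of n n] S.Cauchy_Schwarz[OF a(2) diff_mem[OF b(1,2)], of n] by simp
  moreover have "(\<lambda>n. hnorm V (\<sigma> n - x) * hnorm V (\<tau> n) + hnorm V x * hnorm V (\<tau> n - y))
      \<longlonglongrightarrow> 0 * hnorm V y + hnorm V x * 0"
    by (intro tendsto_intros a(3) b(3) hlim_norm[OF assms(2)])
  moreover from calculation have "(\<lambda>n. hnorm V (\<sigma> n - x) * hnorm V (\<tau> n) + hnorm V x * hnorm V (\<tau> n - y)) \<longlonglongrightarrow> 0"
    by simp
  ultimately have "(\<lambda>n. hinner V (\<sigma> n) (\<tau> n) - hinner V x y) \<longlonglongrightarrow> 0"
    by (metis (no_types, lifting) Lim_null_comparison always_eventually)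
  then show ?thesis by (simp add: LIM_zero_iff)
qed

lemma limitin_iff_hlim:
  assumes "\<And>n. \<sigma> n \<in> hspace V"
  shows "limitin mtopology \<sigma> x sequentially \<longleftrightarrow> hlim V \<sigma> x"
  using assms
  by (auto simp: limit_metric_sequentially hlim_def LIMSEQ_def hdist_def diff_mem S.seminorm_ge_zero
      image_subset_iff)

lemma hlim_complete:
  assumes \<sigma>: "\<And>n. \<sigma> n \<in> hspace V"
    and Cauchy: "\<And>\<epsilon>. \<epsilon> > 0 \<Longrightarrow> \<exists>N. \<forall>m\<ge>N. \<forall>n\<ge>N. hnorm V (\<sigma> m - \<sigma> n) < \<epsilon>"
  obtains x where "hlim V \<sigma> x"
proof -
  have "MCauchy \<sigma>"
    using assms by (auto simp: MCauchy_def hdist_def)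
  then obtain x where "limitin mtopology \<sigma> x sequentially"
    using hspace_mcomplete by (auto simp: mcomplete_def)
  then show thesis using limitin_iff_hlim \<sigma> that by blast
qed

lemma closure_of_iff_approx:
  assumes "W \<subseteq> hspace V"
  shows "x \<in> mtopology closure_of W \<longleftrightarrow> x \<in> hspace V \<and> (\<forall>\<epsilon>>0. \<exists>y\<in>W. hnorm V (y - x) < \<epsilon>)"
proof -
  have *: "y \<in> mball x r \<longleftrightarrow> hnorm V (y - x) < r" if "x \<in> hspace V" "y \<in> W" for y r
    using that assms S.seminorm_diff(3)[of x y] by (auto simp: in_mball hdist_def)
  have "(\<exists>y\<in>W. y \<in> mball x r) \<longleftrightarrow> (\<exists>y\<in>W. hnorm V (y - x) < r)" if "x \<in> hspace V" for r
    using * that by blast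
  then show ?thesis by (auto simp: metric_closure_of)
qed

lemma ex_hlim_of_approx:
  assumes "W \<subseteq> hspace V" "x \<in> hspace V" "\<And>\<epsilon>. \<epsilon> > 0 \<Longrightarrow> \<exists>y\<in>W. hnorm V (y - x) < \<epsilon>"
  obtains \<sigma> where "\<And>n. \<sigma> n \<in> W" "hlim V \<sigma> x"
proof -
  have "\<forall>n. \<exists>y\<in>W. hnorm V (y - x) < inverse (real (Suc n))"
    using assms(3) by simp
  then obtain \<sigma> where \<sigma>: "\<And>n. \<sigma> n \<in> W" "\<And>n. hnorm V (\<sigma> n - x) < inverse (real (Suc n))"
    by metis
  then have "hlim V \<sigma> x"
    using assms by (intro hlimI_le[OF _ _ less_imp_le[OF \<sigma>(2)] LIMSEQ_inverse_real_of_nat]) auto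
  then show thesis using that \<sigma>(1) by blast
qed

lemma closure_of_iff_hlim:
  assumes "W \<subseteq> hspace V"
  shows "x \<in> mtopology closure_of W \<longleftrightarrow> (\<exists>\<sigma>. (\<forall>n. \<sigma> n \<in> W) \<and> hlim V \<sigma> x)"
proof
  assume "x \<in> mtopology closure_of W"
  then show "\<exists>\<sigma>. (\<forall>n. \<sigma> n \<in> W) \<and> hlim V \<sigma> x"
    unfolding closure_of_iff_approx[OF assms] using ex_hlim_of_approx[OF assms] by metis
next
  assume "\<exists>\<sigma>. (\<forall>n. \<sigma> n \<in> W) \<and> hlim V \<sigma> x"
  then obtain \<sigma> where \<sigma>: "\<And>n. \<sigma> n \<in> W" "hlim V \<sigma> x" by blast
  have "\<exists>y\<in>W. hnorm V (y - x) < \<epsilon>" if "\<epsilon> > 0" for \<epsilon>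
  proof -
    have "\<forall>\<^sub>F n in sequentially. hnorm V (\<sigma> n - x) < \<epsilon>"
      using order_tendstoD(2)[OF hlimD(3)[OF \<sigma>(2)] that] .
    then obtain n where "hnorm V (\<sigma> n - x) < \<epsilon>"
      by (auto simp: eventually_sequentially)
    then show ?thesis using \<sigma>(1) by blast
  qed
  then show "x \<in> mtopology closure_of W"
    using hlimD(2)[OF \<sigma>(2)] by (simp add: closure_of_iff_approx[OF assms])
qed

lemma closedin_hlim:
  assumes "closedin mtopology W" "\<And>n. \<sigma> n \<in> W" "hlim V \<sigma> x"
  shows "x \<in> W"
  using assms closure_of_iff_hlim[of W x] closedin_subset[OF assms(1)] closure_of_closedin[OF assms(1)]
  by (auto simp: closedin_def)

lemma csubspace_closure_of:
  assumes "csubspace W" "W \<subseteq> hspace V"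
  shows "csubspace (mtopology closure_of W)"
  unfolding complex_vector.subspace_def
proof (intro conjI ballI allI)
  note W = complex_vector.subspace_0[OF assms(1)] complex_vector.subspace_add[OF assms(1)]
    complex_vector.subspace_scale[OF assms(1)]
  note iff = closure_of_iff_hlim[OF assms(2)]
  show "0 \<in> mtopology closure_of W"
    unfolding iff using W(1) hlim_const zero_mem by (intro exI[of _ "\<lambda>_. 0"]) auto
  show "x + y \<in> mtopology closure_of W" if xy: "x \<in> mtopology closure_of W" "y \<in> mtopology closure_of W" for x y
  proof -
    obtain \<sigma> \<tau> where "\<And>n. \<sigma> n \<in> W" "hlim V \<sigma> x" "\<And>n. \<tau> n \<in> W" "hlim V \<tau> y"
      using xy unfolding iff by (elim exE conjE) blast
    then show ?thesis
      unfolding iff using W(2) hlim_add by (intro exI[of _ "\<lambda>n. \<sigma> n + \<tau> n"]) blast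
  qed
  show "c *\<^sub>C x \<in> mtopology closure_of W" if "x \<in> mtopology closure_of W" for c x
    using that unfolding iff by (metis W(3) hlim_scaleC)
qed

end

lemma hilbert_spaceI:
  assumes "semi_inner (hspace V) (hinner V)"
    and definite: "\<And>u. \<lbrakk>u \<in> hspace V; hinner V u u = 0\<rbrakk> \<Longrightarrow> u = 0"
    and complete: "\<And>\<sigma>. \<lbrakk>\<And>n. \<sigma> n \<in> hspace V;
        \<And>\<epsilon>. \<epsilon> > 0 \<Longrightarrow> \<exists>N. \<forall>m\<ge>N. \<forall>n\<ge>N. hnorm V (\<sigma> m - \<sigma> n) < \<epsilon>\<rbrakk> \<Longrightarrow> \<exists>x. hlim V \<sigma> x"
  shows "hilbert_space V"
proof -
  interpret S: semi_inner "hspace V" "hinner V" by fact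
  have sn: "S.seminorm = hnorm V" by (simp add: fun_eq_iff S.seminorm_def hnorm_def)
  note norm = S.seminorm_ge_zero[unfolded sn] S.seminorm_diff[unfolded sn] S.seminorm_add[unfolded sn]
  have zero: "hnorm V x = 0 \<longleftrightarrow> x = 0" if "x \<in> hspace V" for x
    using definite[OF that] S.self_eq[OF that] S.seminorm_zero unfolding sn by auto
  interpret M: Metric_space "hspace V" "hdist V"
  proof
    show "0 \<le> hdist V x y" for x y
      by (simp add: hdist_def norm S.diff_in)
    show "hdist V x y = hdist V y x" for x y
      using norm(4) by (simp add: hdist_def)
    show "hdist V x y = 0 \<longleftrightarrow> x = y" if "x \<in> hspace V" "y \<in> hspace V" for x y
      using that zero[of "x - y"] by (simp add: hdist_def S.diff_in)
    show "hdist V x z \<le> hdist V x y + hdist V y z"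
      if "x \<in> hspace V" "y \<in> hspace V" "z \<in> hspace V" for x y z
      using that norm(5)[of "x - y" "y - z"] by (simp add: hdist_def S.diff_in)
  qed
  have "M.mcomplete"
    unfolding M.mcomplete_def
  proof (intro allI impI)
    fix \<sigma> assume C: "M.MCauchy \<sigma>"
    then have \<sigma>: "\<sigma> n \<in> hspace V" for n by (auto simp: M.MCauchy_def)
    then have "\<exists>N. \<forall>m\<ge>N. \<forall>n\<ge>N. hnorm V (\<sigma> m - \<sigma> n) < \<epsilon>" if "\<epsilon> > 0" for \<epsilon>
      using C that by (simp add: M.MCauchy_def hdist_def)
    with \<sigma> obtain x where "hlim V \<sigma> x" using complete by blast
    then have "limitin M.mtopology \<sigma> x sequentially"
      using \<sigma> by (auto simp: M.limit_metric_sequentially hlim_def LIMSEQ_def hdist_def S.diff_in norm)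
    then show "\<exists>x. limitin M.mtopology \<sigma> x sequentially" ..
  qed
  then show ?thesis
    by unfold_locales
      (auto intro: S.subspace S.commute S.add_left S.scaleC_left S.ge_zero definite)
qed

lemma (in hilbert_space) hilbert_space_closed_subspace:
  assumes W: "csubspace W" "closedin mtopology W"
  shows "hilbert_space (V\<lparr>hspace := W\<rparr>)"
proof (rule hilbert_spaceI)
  have sub: "W \<subseteq> hspace V" using closedin_subset[OF W(2)] by simp
  show "semi_inner (hspace (V\<lparr>hspace := W\<rparr>)) (hinner (V\<lparr>hspace := W\<rparr>))"
    by unfold_locales
      (use W(1) sub in \<open>auto intro: hinner_commute hinner_add_left hinner_scaleC_left hinner_ge_zero\<close>)
  show "u = 0" if "u \<in> hspace (V\<lparr>hspace := W\<rparr>)" "hinner (V\<lparr>hspace := W\<rparr>) u u = 0" for u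
    using that hinner_eq_zero sub by auto
  fix \<sigma> assume \<sigma>: "\<And>n :: nat. \<sigma> n \<in> hspace (V\<lparr>hspace := W\<rparr>)"
    "\<And>\<epsilon>. \<epsilon> > 0 \<Longrightarrow> \<exists>N. \<forall>m\<ge>N. \<forall>n\<ge>N. hnorm (V\<lparr>hspace := W\<rparr>) (\<sigma> m - \<sigma> n) < \<epsilon>"
  have norm: "hnorm (V\<lparr>hspace := W\<rparr>) x = hnorm V x" for x by (simp add: hnorm_def)
  have "\<sigma> n \<in> hspace V" for n using \<sigma>(1) sub by auto
  then obtain x where x: "hlim V \<sigma> x"
    using hlim_complete[of \<sigma>] \<sigma>(2) unfolding norm by blast
  have "x \<in> W"
    by (rule closedin_hlim[OF W(2) _ x]) (use \<sigma>(1) in simp)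
  moreover have "range \<sigma> \<subseteq> W" using \<sigma>(1) by auto
  ultimately have "hlim (V\<lparr>hspace := W\<rparr>) \<sigma> x"
    using hlimD(3)[OF x] unfolding hlim_def norm by simp
  then show "\<exists>x. hlim (V\<lparr>hspace := W\<rparr>) \<sigma> x" ..
qed

section \<open>The Riesz representation theorem and orthogonal projections\<close>

text \<open>The representing vector minimizes \<open>x \<mapsto> \<parallel>x\<parallel>\<^sup>2 - 2 Re (F x)\<close>.\<close>

lemma (in hilbert_space) Riesz_representation:
  assumes F_add: "\<And>x y. \<lbrakk>x \<in> hspace V; y \<in> hspace V\<rbrakk> \<Longrightarrow> F (x + y) = F x + F y"
    and F_scale: "\<And>c x. x \<in> hspace V \<Longrightarrow> F (c *\<^sub>C x) = c * F x"
    and F_le: "\<And>x. x \<in> hspace V \<Longrightarrow> cmod (F x) \<le> K * hnorm V x"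
  shows "\<exists>m\<in>hspace V. \<forall>x\<in>hspace V. F x = hinner V x m"
proof -
  \<comment> \<open>Completing the square gives J x \<ge> -K^2, hence a finite infimum.\<close>
  define J where "J x = (hnorm V x)\<^sup>2 - 2 * Re (F x)" for x
  define d where "d = Inf (J ` hspace V)"
  have "- (K\<^sup>2) \<le> J x" if "x \<in> hspace V" for x
  proof -
    have "Re (F x) \<le> K * hnorm V x"
      using F_le[OF that] complex_Re_le_cmod order_trans by blast
    moreover have "0 \<le> (hnorm V x - K)\<^sup>2" by simp
    ultimately show ?thesis by (simp add: J_def power2_diff algebra_simps)
  qed
  then have bdd: "bdd_below (J ` hspace V)" by (auto intro!: bdd_belowI)
  then have d_le: "d \<le> J x" if "x \<in> hspace V" for x
    using that by (auto simp: d_def intro: cInf_lower)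
  have "\<exists>x\<in>hspace V. J x < d + inverse (real (Suc n))" for n
    using cInf_lessD[of "J ` hspace V" "d + inverse (real (Suc n))"] zero_mem
    by (auto simp flip: d_def)
  then obtain \<sigma> where \<sigma>: "\<And>n. \<sigma> n \<in> hspace V" "\<And>n. J (\<sigma> n) < d + inverse (real (Suc n))"
    by metis
  \<comment> \<open>Exact second-order expansion along a line. It is used at t = 1/2 and t = 1 for
    the Cauchy property of a minimizing sequence, and at arbitrary t for the vanishing of the
    derivative in the limit.\<close>
  have J_shift: "J (x + of_real t *\<^sub>C h) = J x + 2 * t * (Re (hinner V x h) - Re (F h)) + t\<^sup>2 * (hnorm V h)\<^sup>2"
    if "x \<in> hspace V" "h \<in> hspace V" for x h t
  proof -
    have sq: "(hnorm V y)\<^sup>2 = Re (hinner V y y)" if "y \<in> hspace V" for y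
      using hinner_self[OF that] by simp
    have "Re (hinner V h x) = Re (hinner V x h)"
      using hinner_commute[of x h] that by simp
    then have "(hnorm V (x + of_real t *\<^sub>C h))\<^sup>2
        = (hnorm V x)\<^sup>2 + 2 * t * Re (hinner V x h) + t * t * (hnorm V h)\<^sup>2"
      using that sq[of "x + of_real t *\<^sub>C h"] sq[of x] sq[of h]
      by (simp add: scaleC_mem add_mem S.add_left S.add_right S.scaleC_left S.scaleC_right algebra_simps)
    then show ?thesis
      using that F_add[of x "of_real t *\<^sub>C h"]
      by (simp add: J_def scaleC_mem F_scale algebra_simps power2_eq_square[of t])
  qed
  \<comment> \<open>The linear term \<open>k\<close> cancels in J (\<sigma> m) + J (\<sigma> n) - 2
    J (midpoint) = q / 2, and the value at the midpoint is at least \<open>d\<close>.\<close>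
  have near: "(hnorm V (\<sigma> m - \<sigma> n))\<^sup>2 \<le> 2 * (inverse (real (Suc m)) + inverse (real (Suc n)))" for m n
  proof -
    let ?h = "\<sigma> m - \<sigma> n"
    have h: "?h \<in> hspace V" by (simp add: \<sigma> diff_mem)
    define q where "q = (hnorm V ?h)\<^sup>2"
    define k where "k = Re (hinner V (\<sigma> n) ?h) - Re (F ?h)"
    have "J (\<sigma> n + of_real 1 *\<^sub>C ?h) = J (\<sigma> m)"
      by (simp add: scaleC_one)
    then have "J (\<sigma> m) = J (\<sigma> n) + 2 * k + q"
      using J_shift[OF \<sigma>(1)[of n] h, of 1] by (simp add: k_def q_def)
    moreover have "J (\<sigma> n + of_real (1/2) *\<^sub>C ?h) = J (\<sigma> n) + k + q / 4"
      using J_shift[OF \<sigma>(1)[of n] h, of "1/2"] by (simp add: k_def q_def power2_eq_square)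
    moreover have "d \<le> J (\<sigma> n + of_real (1/2) *\<^sub>C ?h)"
      by (intro d_le add_mem scaleC_mem h \<sigma>)
    ultimately show ?thesis
      using \<sigma>(2)[of m] \<sigma>(2)[of n] unfolding q_def[symmetric] by argo
  qed
  obtain m where m: "hlim V \<sigma> m"
  proof (rule hlim_complete[of \<sigma>])
    fix \<epsilon> :: real assume "\<epsilon> > 0"
    then obtain N where N: "inverse (real (Suc N)) < \<epsilon>\<^sup>2 / 4"
      using reals_Archimedean[of "\<epsilon>\<^sup>2 / 4"] by auto
    have "hnorm V (\<sigma> i - \<sigma> j) < \<epsilon>" if "i \<ge> N" "j \<ge> N" for i j
    proof (rule power_less_imp_less_base[of _ 2])
      have "inverse (real (Suc i)) \<le> inverse (real (Suc N))" "inverse (real (Suc j)) \<le> inverse (real (Suc N))"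
        using that by (auto intro: le_imp_inverse_le)
      then show "(hnorm V (\<sigma> i - \<sigma> j))\<^sup>2 < \<epsilon>\<^sup>2"
        using near[of i j] N by argo
    qed (use \<open>\<epsilon> > 0\<close> in simp)
    then show "\<exists>N. \<forall>m\<ge>N. \<forall>n\<ge>N. hnorm V (\<sigma> m - \<sigma> n) < \<epsilon>" by blast
  qed (use \<sigma> in auto)
  note m_in = hlimD(2)[OF m]
  have Re_eq: "Re (hinner V m h) = Re (F h)" if h: "h \<in> hspace V" for h
  proof -
    define k where "k = Re (hinner V m h) - Re (F h)"
    define q where "q = (hnorm V h)\<^sup>2"
    \<comment> \<open>Since J (\<sigma> n) exceeds \<open>d\<close> by less than 1 / (n + 1), the
      increment of \<open>J\<close> from \<sigma> n is at least -1 / (n + 1), and this passes to the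
      limit. A nonnegative quadratic polynomial in t without constant term has no linear term; t =
      -k / q shows it, and t = -k if q = 0.\<close>
    have pos: "0 \<le> 2 * t * k + t\<^sup>2 * q" for t
    proof (rule LIMSEQ_le_const)
      show "(\<lambda>n. 2 * t * (Re (hinner V (\<sigma> n) h) - Re (F h)) + t\<^sup>2 * q + inverse (real (Suc n)))
          \<longlonglongrightarrow> 2 * t * k + t\<^sup>2 * q"
      proof -
        have "(\<lambda>n. 2 * t * (Re (hinner V (\<sigma> n) h) - Re (F h)) + t\<^sup>2 * q + inverse (real (Suc n)))
            \<longlonglongrightarrow> 2 * t * (Re (hinner V m h) - Re (F h)) + t\<^sup>2 * q + 0"
          by (intro tendsto_intros LIMSEQ_inverse_real_of_nat hlim_inner[OF m hlim_const[OF h]])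
        then show ?thesis by (simp add: k_def)
      qed
      have "0 \<le> 2 * t * (Re (hinner V (\<sigma> n) h) - Re (F h)) + t\<^sup>2 * q + inverse (real (Suc n))" for n
      proof -
        have "d \<le> J (\<sigma> n + of_real t *\<^sub>C h)"
          by (intro d_le add_mem scaleC_mem h \<sigma>)
        then show ?thesis
          using \<sigma>(2)[of n] unfolding J_shift[OF \<sigma>(1) h] q_def by argo
      qed
      then show "\<exists>N. \<forall>n\<ge>N. 0 \<le> 2 * t * (Re (hinner V (\<sigma> n) h) - Re (F h)) + t\<^sup>2 * q + inverse (real (Suc n))"
        by blast
    qed
    have "q \<ge> 0" by (simp add: q_def)
    have "k * k \<le> 0"
    proof (cases "q = 0")
      case True
      then show ?thesis using pos[of "- k"] by simp
    next
      case False
      then have "q > 0" using \<open>q \<ge> 0\<close> by simp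
      have "0 \<le> q * (2 * (- k / q) * k + (- k / q)\<^sup>2 * q)"
        using pos[of "- k / q"] \<open>q > 0\<close> by (intro mult_nonneg_nonneg) auto
      also have "\<dots> = - (k * k)" using \<open>q > 0\<close> by (simp add: field_simps power2_eq_square)
      finally show ?thesis by simp
    qed
    then have "k = 0" by (metis mult_eq_0_iff order_antisym zero_le_square)
    then show ?thesis by (simp add: k_def)
  qed
  have "F h = hinner V h m" if h: "h \<in> hspace V" for h
  proof -
    have "Re (hinner V m (\<i> *\<^sub>C h)) = Re (F (\<i> *\<^sub>C h))"
      using h by (intro Re_eq scaleC_mem)
    then have "Im (hinner V m h) = - Im (F h)"
      using h m_in by (simp add: S.scaleC_right F_scale)
    then show ?thesis
      using Re_eq[OF h] hinner_commute[OF m_in h] by (simp add: complex_eq_iff)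
  qed
  then show ?thesis using m_in by blast
qed

text \<open>The Riesz representation theorem on \<open>W\<close>, applied to w \<mapsto> <w, v>: the
  representing vector is the projection of \<open>v\<close>.\<close>

lemma (in hilbert_space) orthogonal_projection:
  assumes W: "csubspace W" "closedin mtopology W" and v: "v \<in> hspace V"
  shows "\<exists>m\<in>W. \<forall>w\<in>W. hinner V w (v - m) = 0"
proof -
  have sub: "W \<subseteq> hspace V" using closedin_subset[OF W(2)] by simp
  interpret W: hilbert_space "V\<lparr>hspace := W\<rparr>"
    by (rule hilbert_space_closed_subspace[OF W])
  have "\<exists>m\<in>hspace (V\<lparr>hspace := W\<rparr>). \<forall>x\<in>hspace (V\<lparr>hspace := W\<rparr>).
      hinner V x v = hinner (V\<lparr>hspace := W\<rparr>) x m"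
  proof (rule W.Riesz_representation)
    show "cmod (hinner V x v) \<le> hnorm V v * hnorm (V\<lparr>hspace := W\<rparr>) x"
      if "x \<in> hspace (V\<lparr>hspace := W\<rparr>)" for x
      using S.Cauchy_Schwarz[of x v] that sub v by (auto simp: hnorm_def mult.commute)
  qed (use sub v in \<open>auto simp: S.add_left S.scaleC_left subset_iff\<close>)
  then show ?thesis
    using sub v by (auto simp: S.diff_right subset_iff)
qed

section \<open>Schur's lemma\<close>

text \<open>
  A maximizer of a linear functional on the compact convex set of all invariant forms between
  \<open>0\<close> and the inner product can be chosen extreme. If \<open>T\<close> is the operator of an extreme form, then
  \<open>T\<close> is the midpoint of \<open>T\<^sup>2\<close> and \<open>2T - T\<^sup>2\<close>, so \<open>T\<close> is a projection and hence \<open>0\<close> or \<open>1\<close>. Since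
  the functional used below vanishes at both, it vanishes identically. This avoids the spectral theorem.
\<close>

lemma Schur_form:
  fixes V :: "('a::star_algebra, 'v::complex_vector) hrep"
  assumes B: "star_subalgebra B" and V: "irreducible_rep B V"
    and s: "semi_inner (hspace V) s"
    and s_le: "\<And>x. x \<in> hspace V \<Longrightarrow> Re (s x x) \<le> Re (hinner V x x)"
    and s_act: "\<And>b x y. \<lbrakk>b \<in> B; x \<in> hspace V; y \<in> hspace V\<rbrakk>
      \<Longrightarrow> s (haction V b x) y = s x (haction V (star b) y)"
  shows "\<exists>c. \<forall>x\<in>hspace V. \<forall>y\<in>hspace V. s x y = c * hinner V x y"
proof -
  interpret V: unitary_rep B V using V by (simp add: irreducible_rep_def)
  define H where "H = hspace V"
  define q where "q x = Re (hinner V x x)" for x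
  have H0: "0 \<in> H" and H_add: "\<And>x y. \<lbrakk>x \<in> H; y \<in> H\<rbrakk> \<Longrightarrow> x + y \<in> H"
    and H_scale: "\<And>c x. x \<in> H \<Longrightarrow> c *\<^sub>C x \<in> H" and H_diff: "\<And>x y. \<lbrakk>x \<in> H; y \<in> H\<rbrakk> \<Longrightarrow> x - y \<in> H"
    and H_act: "\<And>b x. \<lbrakk>b \<in> B; x \<in> H\<rbrakk> \<Longrightarrow> haction V b x \<in> H"
    unfolding H_def by (fact V.zero_mem V.add_mem V.scaleC_mem V.diff_mem V.haction_closed)+
  have starB: "star b \<in> B" if "b \<in> B" for b
    using B that by (simp add: star_subalgebra_def)
  have q_ge: "q x \<ge> 0" if "x \<in> H" for x
    using that V.hinner_ge_zero by (simp add: q_def H_def)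
  have inner_self: "hinner V x x = of_real (q x)" if "x \<in> H" for x
    using V.hinner_self[of x] that unfolding H_def q_def by simp
  \<comment> \<open>Forms are encoded as functions on pairs that vanish outside H \<times> H, so
    that Cauchy-Schwarz bounds every coordinate and Tychonoff's theorem applies; each single
    condition involves finitely many coordinates and is closed.\<close>
  define K where "K = {f :: 'v \<times> 'v \<Rightarrow> complex.
    (\<forall>x y. (x \<notin> H \<or> y \<notin> H) \<longrightarrow> f (x, y) = 0) \<and>
    (\<forall>x y. x \<in> H \<and> y \<in> H \<longrightarrow> f (y, x) = cnj (f (x, y))) \<and>
    (\<forall>x y z. x \<in> H \<and> y \<in> H \<and> z \<in> H \<longrightarrow> f (x + y, z) = f (x, z) + f (y, z)) \<and>
    (\<forall>c x y. x \<in> H \<and> y \<in> H \<longrightarrow> f (c *\<^sub>C x, y) = c * f (x, y)) \<and>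
    (\<forall>x. x \<in> H \<longrightarrow> 0 \<le> Re (f (x, x))) \<and>
    (\<forall>x. x \<in> H \<longrightarrow> Re (f (x, x)) \<le> q x) \<and>
    (\<forall>b x y. b \<in> B \<and> x \<in> H \<and> y \<in> H \<longrightarrow> f (haction V b x, y) = f (x, haction V (star b) y))}"
  have coord: "continuous_on UNIV (\<lambda>f :: 'v \<times> 'v \<Rightarrow> complex. f p)" for p
    by (rule continuous_on_product_coordinates)
  have K_outside: "f (x, y) = 0" if "f \<in> K" "x \<notin> H \<or> y \<notin> H" for f x y
    using that unfolding K_def by blast
  have K_commute: "f (y, x) = cnj (f (x, y))" if "f \<in> K" "x \<in> H" "y \<in> H" for f x y
    using that unfolding K_def by blast
  have K_semi: "semi_inner H (\<lambda>x y. f (x, y))" if "f \<in> K" for f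
  proof
    show "csubspace H" unfolding H_def by (rule V.hspace_subspace)
    show "f (y, x) = cnj (f (x, y))" if "x \<in> H" "y \<in> H" for x y
      using K_commute[OF \<open>f \<in> K\<close> that] .
    show "f (x + y, z) = f (x, z) + f (y, z)" if "x \<in> H" "y \<in> H" "z \<in> H" for x y z
      using \<open>f \<in> K\<close> that unfolding K_def by blast
    show "f (c *\<^sub>C x, y) = c * f (x, y)" if "x \<in> H" "y \<in> H" for c x y
      using \<open>f \<in> K\<close> that unfolding K_def by blast
    show "0 \<le> Re (f (x, x))" if "x \<in> H" for x
      using \<open>f \<in> K\<close> that unfolding K_def by blast
  qed
  have K_le: "Re (f (x, x)) \<le> q x" if "f \<in> K" "x \<in> H" for f x
    using that unfolding K_def by blast
  have K_act: "f (haction V b x, y) = f (x, haction V (star b) y)"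
    if "f \<in> K" "b \<in> B" "x \<in> H" "y \<in> H" for f b x y
    using that unfolding K_def by blast
  have K_I: "(\<lambda>(x, y). if x \<in> H \<and> y \<in> H then f x y else 0) \<in> K"
    if f: "semi_inner H f" and f_le: "\<And>x. x \<in> H \<Longrightarrow> Re (f x x) \<le> q x"
      and f_act: "\<And>b x y. \<lbrakk>b \<in> B; x \<in> H; y \<in> H\<rbrakk> \<Longrightarrow> f (haction V b x) y = f x (haction V (star b) y)"
    for f
  proof -
    interpret f: semi_inner H f by fact
    show ?thesis
      unfolding K_def
      by (simp add: H_add H_scale H_act starB f_le f_act f.add_left f.scaleC_left f.ge_zero)
        (metis f.commute)
  qed
  have CS: "(cmod (f (x, y)))\<^sup>2 \<le> Re (f (x, x)) * Re (f (y, y))" if "f \<in> K" "x \<in> H" "y \<in> H" for f x y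
    using semi_inner.Cauchy_Schwarz_square[OF K_semi[OF that(1)] that(2,3)] .
  have f_ge: "0 \<le> Re (f (x, x))" if "f \<in> K" "x \<in> H" for f x
    using that unfolding K_def by blast
  have bound: "cmod (f (x, y)) \<le> sqrt (q x * q y)" if "f \<in> K" "x \<in> H" "y \<in> H" for f x y
  proof (rule real_le_rsqrt)
    show "(cmod (f (x, y)))\<^sup>2 \<le> q x * q y"
      using CS[OF that] mult_mono[OF K_le[OF that(1,2)] K_le[OF that(1,3)] q_ge[OF that(2)] f_ge[OF that(1,3)]]
      by linarith
  qed
  have "compact K"
  proof -
    define k where "k p = (if fst p \<in> H \<and> snd p \<in> H then sqrt (q (fst p) * q (snd p)) else 0)" for p
    have "closed K"
      unfolding K_def
      by (intro closed_Collect_conj closed_Collect_all closed_Collect_imp open_Collect_const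
          closed_Collect_eq closed_Collect_le continuous_intros coord)
    then have "compact ({f. \<forall>p. cmod (f p) \<le> k p} \<inter> K)"
      by (rule compact_Int_closed[OF compact_Pi_cball])
    moreover have "cmod (f p) \<le> k p" if "f \<in> K" for f p
      using bound[OF that, of "fst p" "snd p"] K_outside[OF that, of "fst p" "snd p"] by (simp add: k_def)
    then have "{f. \<forall>p. cmod (f p) \<le> k p} \<inter> K = K" by blast
    ultimately show ?thesis by simp
  qed
  \<comment> \<open>Applied also with \<open>x\<close> and \<open>y\<close> exchanged, this becomes
    an equality, so f (x, x) / q x is the same for all x \<noteq> 0.\<close>
  have le: "Re (f (x, x)) * q y \<le> Re (f (y, y)) * q x" if f: "f \<in> K" and xy: "x \<in> H" "y \<in> H" for f x y
  proof -
    define l where "l f = Re (f (x, x)) * q y - Re (f (y, y)) * q x" for f :: "'v \<times> 'v \<Rightarrow> complex"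
    have l_cont: "continuous_on UNIV l"
      unfolding l_def by (intro continuous_intros coord)
    obtain g where g: "g \<in> K" "\<And>f. f \<in> K \<Longrightarrow> l f \<le> l g"
      using continuous_attains_sup[OF \<open>compact K\<close> _ continuous_on_subset[OF l_cont]] f by blast
    define F where "F = K \<inter> l -` {l g}"
    have "compact F"
      unfolding F_def by (intro compact_Int_closed closed_vimage \<open>compact K\<close> l_cont) auto
    moreover have "F \<noteq> {}" using g by (auto simp: F_def)
    ultimately obtain z where z: "z \<in> F" and z_ext: "\<And>t u v. \<lbrakk>0 < t; t < 1; u \<in> F; v \<in> F;
        \<And>i. z i = of_real t * u i + of_real (1 - t) * v i\<rbrakk> \<Longrightarrow> u = z \<and> v = z"
      using compact_extreme_point[of F] by metis
    have zK: "z \<in> K" using z by (simp add: F_def)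
    \<comment> \<open>Extremality in \<open>F\<close> gives extremality in \<open>K\<close> at
      midpoints: if two values that are at most \<open>l g\<close> average to \<open>l g\<close>,
      both are maximal, so \<open>u\<close> and \<open>v\<close> lie in \<open>F\<close>.\<close>
    have ext: "u = z" if uv: "u \<in> K" "v \<in> K" and mid: "\<And>p. 2 * z p = u p + v p" for u v
    proof -
      have m: "2 * Re (z p) = Re (u p) + Re (v p)" for p
        using arg_cong[OF mid[of p], of Re] by simp
      have "2 * l z = (2 * Re (z (x, x))) * q y - (2 * Re (z (y, y))) * q x"
        by (simp add: l_def)
      also have "\<dots> = l u + l v"
        unfolding m by (simp add: l_def algebra_simps)
      finally have "2 * l z = l u + l v" .
      then have "u \<in> F" "v \<in> F"
        using z g(2)[OF uv(1)] g(2)[OF uv(2)] uv by (auto simp: F_def)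
      moreover have "z p = of_real (1/2) * u p + of_real (1 - 1/2) * v p" for p
        using mid[of p] by (simp add: field_simps)
      ultimately show ?thesis using z_ext[of "1/2" u v] by simp
    qed
    interpret z: semi_inner H "\<lambda>x y. z (x, y)" by (rule K_semi[OF zK])
    have "\<exists>t\<in>H. \<forall>w\<in>H. z (w, v) = hinner V w t" if v: "v \<in> H" for v
      unfolding H_def
    proof (rule V.Riesz_representation)
      show "cmod (z (w, v)) \<le> sqrt (q v) * hnorm V w" if "w \<in> hspace V" for w
        using bound[OF zK _ v, of w] that
        by (simp add: H_def hnorm_def q_def real_sqrt_mult mult.commute)
    qed (use v in \<open>simp_all add: H_def[symmetric] z.add_left z.scaleC_left\<close>)
    then obtain T where T: "\<And>v. v \<in> H \<Longrightarrow> T v \<in> H" "\<And>v w. \<lbrakk>v \<in> H; w \<in> H\<rbrakk> \<Longrightarrow> z (w, v) = hinner V w (T v)"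
      by metis
    have T': "z (v, w) = hinner V (T v) w" if "v \<in> H" "w \<in> H" for v w
    proof -
      have "z (v, w) = cnj (z (w, v))" by (rule K_commute[OF zK that(2,1)])
      also have "\<dots> = hinner V (T v) w"
        unfolding T(2)[OF that] by (rule V.hinner_commute[symmetric]) (use that T(1) H_def in auto)
      finally show ?thesis .
    qed
    have T_act: "hinner V w (T (haction V (star b) v)) = hinner V w (haction V (star b) (T v))"
      if "b \<in> B" "v \<in> H" "w \<in> H" for b v w
    proof -
      have "hinner V w (T (haction V (star b) v)) = z (haction V b w, v)"
        using that by (simp add: K_act[OF zK] T(2)[symmetric] H_act starB)
      also have "\<dots> = hinner V w (haction V (star b) (T v))"
        using that by (simp add: T H_act H_def[symmetric] V.haction_star)
      finally show ?thesis .
    qed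
    define r where "r v w = hinner V (T v) (T w)" for v w
    have r_eq: "r v w = z (v, T w)" if "v \<in> H" "w \<in> H" for v w
      using that by (simp add: r_def T' T(1))
    \<comment> \<open>This is T^2 \<le> T: Cauchy-Schwarz for the form \<open>z\<close> at
      \<open>v\<close> and \<open>T v\<close> gives |Tv|^4 \<le> z(v,v) z(Tv,Tv) \<le> z(v,v)
      |Tv|^2.\<close>
    have r_le: "Re (r v v) \<le> Re (z (v, v))" if v: "v \<in> H" for v
    proof -
      have "(q (T v))\<^sup>2 \<le> Re (z (v, v)) * Re (z (T v, T v))"
        using CS[OF zK v T(1)[OF v]] unfolding T'[OF v T(1)[OF v]] inner_self[OF T(1)[OF v]] by simp
      also have "\<dots> \<le> Re (z (v, v)) * q (T v)"
        by (intro mult_left_mono K_le zK T v f_ge)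
      finally have "q (T v) * q (T v) \<le> Re (z (v, v)) * q (T v)"
        by (simp add: power2_eq_square)
      then show ?thesis
        using q_ge[OF T(1)[OF v]] f_ge[OF zK v] unfolding r_def q_def[symmetric]
        by (cases "q (T v) = 0") auto
    qed
    have r_act: "r (haction V b v) w = r v (haction V (star b) w)" if "b \<in> B" "v \<in> H" "w \<in> H" for b v w
    proof -
      have "r (haction V b v) w = hinner V (T v) (haction V (star b) (T w))"
        unfolding r_eq[OF H_act[OF that(1,2)] that(3)] K_act[OF zK that(1,2) T(1)[OF that(3)]]
        by (rule T') (use that in \<open>simp_all add: H_act starB T(1)\<close>)
      also have "\<dots> = r v (haction V (star b) w)"
        using that by (simp add: r_def T_act T(1))
      finally show ?thesis .
    qed
    have r_semi: "semi_inner H r"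
    proof
      show "csubspace H" unfolding H_def by (rule V.hspace_subspace)
      show "r w v = cnj (r v w)" if "v \<in> H" "w \<in> H" for v w
        unfolding r_def by (rule V.hinner_commute) (use that T(1) H_def in auto)
      show "r (u + v) w = r u w + r v w" if "u \<in> H" "v \<in> H" "w \<in> H" for u v w
        using that by (simp add: r_eq H_add T(1) z.add_left)
      show "r (c *\<^sub>C v) w = c * r v w" if "v \<in> H" "w \<in> H" for c v w
        using that by (simp add: r_eq H_scale T(1) z.scaleC_left)
      show "0 \<le> Re (r v v)" if "v \<in> H" for v
        using that q_ge[OF T(1)] by (simp add: r_def q_def)
    qed
    interpret r: semi_inner H r by (rule r_semi)
    define r' where "r' v w = 2 * z (v, w) - r v w" for v w
    have "semi_inner H r'"
    proof
      show "csubspace H" unfolding H_def by (rule V.hspace_subspace)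
      show "r' w v = cnj (r' v w)" if "v \<in> H" "w \<in> H" for v w
        unfolding r'_def K_commute[OF zK that] r.commute[OF that] by simp
      show "r' (u + v) w = r' u w + r' v w" if "u \<in> H" "v \<in> H" "w \<in> H" for u v w
        using that by (simp add: r'_def r.add_left z.add_left)
      show "r' (c *\<^sub>C v) w = c * r' v w" if "v \<in> H" "w \<in> H" for c v w
        using that by (simp add: r'_def r.scaleC_left z.scaleC_left algebra_simps)
      show "0 \<le> Re (r' v v)" if "v \<in> H" for v
        using that r_le[OF that] f_ge[OF zK that] by (simp add: r'_def)
    qed
    \<comment> \<open>The bound 2T - T^2 \<le> 1 comes from 1 - (2T - T^2) = (1 - T)^2 \<ge>
      0.\<close>
    moreover have "Re (r' v v) \<le> q v" if v: "v \<in> H" for v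
    proof -
      have vT: "v \<in> hspace V" "T v \<in> hspace V" using v T(1)[OF v] by (simp_all add: H_def)
      have "hinner V (v - T v) (v - T v) = hinner V v v - z (v, v) - (z (v, v) - r v v)"
        using vT by (simp add: V.S.diff_left V.S.diff_right V.diff_mem r_def T(2)[OF v v, symmetric]
            T'[OF v v, symmetric])
      then have "q (v - T v) = q v - Re (r' v v)"
        by (simp add: q_def r'_def)
      then show ?thesis using q_ge[OF H_diff[OF v T(1)[OF v]]] by simp
    qed
    ultimately have r'_K: "(\<lambda>(v, w). if v \<in> H \<and> w \<in> H then r' v w else 0) \<in> K"
      by (rule K_I) (simp_all add: r'_def r_act K_act[OF zK])
    have "(\<lambda>(v, w). if v \<in> H \<and> w \<in> H then r v w else 0) \<in> K"
    proof (rule K_I[OF r_semi])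
      show "Re (r v v) \<le> q v" if "v \<in> H" for v
        using r_le[OF that] K_le[OF zK that] by linarith
    qed (rule r_act)
    then have r_z: "(\<lambda>(v, w). if v \<in> H \<and> w \<in> H then r v w else 0) = z"
    proof (rule ext[OF _ r'_K])
      show "2 * z p = (case p of (v, w) \<Rightarrow> if v \<in> H \<and> w \<in> H then r v w else 0) +
          (case p of (v, w) \<Rightarrow> if v \<in> H \<and> w \<in> H then r' v w else 0)" for p
        using K_outside[OF zK, of "fst p" "snd p"] by (cases p) (simp add: r'_def)
    qed
    have rz: "r v w = z (v, w)" if "v \<in> H" "w \<in> H" for v w
      using fun_cong[OF r_z, of "(v, w)"] that by simp
    \<comment> \<open>The kernel of \<open>T\<close> is a closed submodule. If it is zero, T(v - Tv)
      = 0 forces T = 1; if it is everything, T = 0.\<close>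
    define N where "N = {v \<in> H. \<forall>w\<in>H. z (v, w) = 0}"
    have "csubspace N"
      unfolding complex_vector.subspace_def N_def
      by (auto simp: H0 H_add H_scale z.zero_left z.add_left z.scaleC_left)
    moreover have "N \<subseteq> hspace V" by (auto simp: N_def H_def)
    moreover have "\<forall>b\<in>B. \<forall>v\<in>N. haction V b v \<in> N"
      by (auto simp: N_def H_act K_act[OF zK] starB)
    moreover have "closedin (htopology V) N"
    proof -
      have "N = \<Inter>(insert (hspace V) ((\<lambda>w. {v \<in> hspace V. hinner V v (T w) = 0}) ` H))"
        by (auto simp: N_def H_def[symmetric] T(2))
      moreover have "closedin (htopology V) \<dots>"
        using T(1) V.closedin_orthogonal closedin_topspace[of "htopology V"]
        by (intro closedin_Inter) (auto simp: H_def)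
      ultimately show ?thesis by simp
    qed
    ultimately consider "N = {0}" | "N = H"
      using V unfolding irreducible_rep_def H_def by blast
    then have "l z = 0"
    proof cases
      case 1
      have "T v = v" if v: "v \<in> H" for v
      proof -
        have "z (v - T v, w) = 0" if "w \<in> H" for w
          using rz[OF v that] v that by (simp add: z.diff_left T(1) T(2) r_def)
        then have "v - T v \<in> N" using v T(1) by (simp add: N_def H_diff)
        then show ?thesis using 1 by simp
      qed
      then have "z (v, v) = of_real (q v)" if "v \<in> H" for v
        using that T(2)[OF that that] inner_self[OF that] by simp
      then show ?thesis using xy by (simp add: l_def)
    next
      case 2
      then have "z (v, v) = 0" if "v \<in> H" for v using that by (auto simp: N_def)
      then show ?thesis using xy by (simp add: l_def)
    qed
    then have "l f \<le> 0" using g(2)[OF f] z by (simp add: F_def)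
    then show ?thesis by (simp add: l_def)
  qed
  interpret s: semi_inner H s using s unfolding H_def .
  have "(\<lambda>(x, y). if x \<in> H \<and> y \<in> H then s x y else 0) \<in> K"
    using s s_le s_act by (intro K_I) (simp_all add: H_def q_def)
  then have s_eq: "Re (s x x) * q y = Re (s y y) * q x" if "x \<in> H" "y \<in> H" for x y
    using le[OF _ that] le[OF _ that(2,1)] that by fastforce
  obtain x0 where x0: "x0 \<in> H" "x0 \<noteq> 0"
    using V H0 by (auto simp: irreducible_rep_def H_def)
  then have "q x0 \<noteq> 0"
    using V.hinner_eq_zero[of x0] inner_self by (auto simp: H_def)
  define c where "c = Re (s x0 x0) / q x0"
  have sc: "Re (s x x) = c * q x" if "x \<in> H" for x
    using s_eq[OF that x0(1)] \<open>q x0 \<noteq> 0\<close> by (simp add: c_def field_simps)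
  \<comment> \<open>The diagonal vanishes by the choice of \<open>c\<close>, so the form is positive
    semidefinite, and Cauchy-Schwarz makes all of it vanish.\<close>
  have "semi_inner H (\<lambda>x y. s x y - of_real c * hinner V x y)"
  proof
    show "csubspace H" unfolding H_def by (rule V.hspace_subspace)
    show "s y x - of_real c * hinner V y x = cnj (s x y - of_real c * hinner V x y)"
      if "x \<in> H" "y \<in> H" for x y
      using s.commute[OF that] V.hinner_commute[of x y] that by (simp add: H_def)
  qed (simp_all add: s.add_left s.scaleC_left V.hinner_add_left V.hinner_scaleC_left sc
      H_def[symmetric] q_def[symmetric] algebra_simps)
  then have "s x y = of_real c * hinner V x y" if "x \<in> H" "y \<in> H" for x y
    using semi_inner.Cauchy_Schwarz_square[of H "\<lambda>x y. s x y - of_real c * hinner V x y" x y] sc that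
    by (simp add: q_def)
  then show ?thesis unfolding H_def by blast
qed

section \<open>Completion of a semi-inner product space\<close>

text \<open>
  A vector \<open>v\<close> of the completion is represented by the function \<open>x \<mapsto> \<langle>v, x\<rangle>\<close> on \<open>X\<close>; these are the
  limits of the functions \<open>x \<mapsto> s y x\<close> in the dual norm.
\<close>

context semi_inner
begin

text \<open>For \<epsilon> \<ge> 0 this bounds the distance from \<open>f\<close> to
  \<open>s y\<close> in the dual norm by \<epsilon>.\<close>

definition approximates :: "('x \<Rightarrow> complex) \<Rightarrow> 'x \<Rightarrow> real \<Rightarrow> bool"
  where "approximates f y \<epsilon> \<longleftrightarrow> (\<forall>x\<in>X. cmod (f x - s y x) \<le> \<epsilon> * seminorm x)"

text \<open>Because vectors are functions on the type of \<open>X\<close>, the GNS space of an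
  algebra lies directly on the type of \<open>universal_rep\<close>. The value 0 outside
  \<open>X\<close> makes a vector determined by its values on \<open>X\<close>, where it is
  conjugate-linear like \<open>s\<close> in its second argument.\<close>

definition completion :: "('x \<Rightarrow> complex) set"
  where "completion = {f. (\<forall>x. x \<notin> X \<longrightarrow> f x = 0) \<and> (\<forall>\<epsilon>>0. \<exists>y\<in>X. approximates f y \<epsilon>)}"

definition converges :: "(nat \<Rightarrow> 'x) \<Rightarrow> ('x \<Rightarrow> complex) \<Rightarrow> bool"
  where "converges b f \<longleftrightarrow> (\<forall>n. b n \<in> X) \<and> (\<exists>\<epsilon>. \<epsilon> \<longlonglongrightarrow> 0 \<and> (\<forall>n. approximates f (b n) (\<epsilon> n)))"

text \<open>Since \<open>f x\<close> stands for <f, x>, the inner product with the limit of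
  \<open>b n\<close> has to be the limit of \<open>f (b n)\<close>. Independence of the chosen
  sequence is part of \<open>completion_inner_lim\<close>.\<close>

definition completion_inner :: "('x \<Rightarrow> complex) \<Rightarrow> ('x \<Rightarrow> complex) \<Rightarrow> complex"
  where "completion_inner f g = lim (\<lambda>n. f ((SOME b. converges b g) n))"

text \<open>The canonical map from \<open>X\<close> into the completion; by
  \<open>completion_inner_kernel\<close> it is a reproducing kernel.\<close>

definition kernel :: "'x \<Rightarrow> 'x \<Rightarrow> complex"
  where "kernel y = (\<lambda>x. if x \<in> X then s y x else 0)"

lemma convergesE:
  assumes "converges b f"
  obtains \<epsilon> where "\<And>n. b n \<in> X" "\<epsilon> \<longlonglongrightarrow> 0"
    "\<And>n x. x \<in> X \<Longrightarrow> cmod (f x - s (b n) x) \<le> \<epsilon> n * seminorm x"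
  using assms unfolding converges_def approximates_def by blast

lemma completion_support: "f \<in> completion \<Longrightarrow> x \<notin> X \<Longrightarrow> f x = 0"
  by (simp add: completion_def)

lemma completion_approx:
  "f \<in> completion \<Longrightarrow> \<epsilon> > 0 \<Longrightarrow> \<exists>y\<in>X. \<forall>x\<in>X. cmod (f x - s y x) \<le> \<epsilon> * seminorm x"
  by (simp add: completion_def approximates_def)

lemma ex_converges:
  assumes "f \<in> completion"
  shows "\<exists>b. converges b f"
proof -
  have "\<forall>n. \<exists>y\<in>X. approximates f y (inverse (real (Suc n)))"
    using assms by (simp add: completion_def)
  then obtain b where "\<forall>n. b n \<in> X \<and> approximates f (b n) (inverse (real (Suc n)))"
    by metis
  then show ?thesis
    unfolding converges_def using LIMSEQ_inverse_real_of_nat by blast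
qed

lemma completionI:
  assumes "converges b f" "\<And>x. x \<notin> X \<Longrightarrow> f x = 0"
  shows "f \<in> completion"
proof -
  obtain e where e: "\<And>n. b n \<in> X" "e \<longlonglongrightarrow> 0"
    "\<And>n x. x \<in> X \<Longrightarrow> cmod (f x - s (b n) x) \<le> e n * seminorm x"
    by (rule convergesE[OF assms(1)]) blast
  have "\<exists>y\<in>X. approximates f y \<epsilon>" if pos: "\<epsilon> > 0" for \<epsilon>
  proof -
    obtain n where n: "e n < \<epsilon>"
      using order_tendstoD(2)[OF e(2) pos] by (auto simp: eventually_sequentially)
    have "approximates f (b n) \<epsilon>"
      unfolding approximates_def
    proof
      fix x assume x: "x \<in> X"
      have "e n * seminorm x \<le> \<epsilon> * seminorm x"
        using n x by (intro mult_right_mono seminorm_ge_zero) auto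
      then show "cmod (f x - s (b n) x) \<le> \<epsilon> * seminorm x" using e(3)[OF x, of n] by linarith
    qed
    then show ?thesis using e(1) by blast
  qed
  then show ?thesis using assms(2) by (simp add: completion_def)
qed

lemma converges_pointwise:
  assumes "converges b f" and x: "x \<in> X"
  shows "(\<lambda>n. s (b n) x) \<longlonglongrightarrow> f x"
proof -
  obtain e where e: "\<And>n. b n \<in> X" "e \<longlonglongrightarrow> 0"
    "\<And>n x. x \<in> X \<Longrightarrow> cmod (f x - s (b n) x) \<le> e n * seminorm x"
    by (rule convergesE[OF assms(1)]) blast
  have "(\<lambda>n. e n * seminorm x) \<longlonglongrightarrow> 0"
    using tendsto_mult_right[OF e(2), of "seminorm x"] by simp
  then have "(\<lambda>n. f x - s (b n) x) \<longlonglongrightarrow> 0"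
    by (rule Lim_null_comparison[rotated]) (use e(3)[OF x] in simp)
  then show ?thesis
    using tendsto_diff[OF tendsto_const[of "f x"], of "\<lambda>n. f x - s (b n) x" 0 sequentially] by simp
qed

lemma converges_kernel: "y \<in> X \<Longrightarrow> converges (\<lambda>_. y) (kernel y)"
  unfolding converges_def approximates_def kernel_def by (auto intro!: exI[of _ "\<lambda>_. 0"])

lemma kernel_completion: "y \<in> X \<Longrightarrow> kernel y \<in> completion"
  by (rule completionI[OF converges_kernel]) (simp_all add: kernel_def)

lemma converges_add:
  assumes "converges a f" "converges b g"
  shows "converges (\<lambda>n. a n + b n) (f + g)"
proof -
  obtain d where d: "\<And>n. a n \<in> X" "d \<longlonglongrightarrow> 0"
    "\<And>n x. x \<in> X \<Longrightarrow> cmod (f x - s (a n) x) \<le> d n * seminorm x"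
    by (rule convergesE[OF assms(1)]) blast
  obtain e where e: "\<And>n. b n \<in> X" "e \<longlonglongrightarrow> 0"
    "\<And>n x. x \<in> X \<Longrightarrow> cmod (g x - s (b n) x) \<le> e n * seminorm x"
    by (rule convergesE[OF assms(2)]) blast
  have "cmod ((f + g) x - s (a n + b n) x) \<le> (d n + e n) * seminorm x" if "x \<in> X" for n x
  proof -
    have "(f + g) x - s (a n + b n) x = (f x - s (a n) x) + (g x - s (b n) x)"
      using that d(1) e(1) by (simp add: add_left)
    then show ?thesis
      using norm_triangle_le[OF add_mono[OF d(3)[OF that, of n] e(3)[OF that, of n]]]
      by (simp only: distrib_right)
  qed
  moreover have "(\<lambda>n. d n + e n) \<longlonglongrightarrow> 0"
    using tendsto_add[OF d(2) e(2)] by simp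
  ultimately show ?thesis
    unfolding converges_def approximates_def using d(1) e(1) add_in by blast
qed

lemma converges_scaleC:
  assumes "converges a f"
  shows "converges (\<lambda>n. c *\<^sub>C a n) (c *\<^sub>C f)"
proof -
  obtain d where d: "\<And>n. a n \<in> X" "d \<longlonglongrightarrow> 0"
    "\<And>n x. x \<in> X \<Longrightarrow> cmod (f x - s (a n) x) \<le> d n * seminorm x"
    by (rule convergesE[OF assms(1)]) blast
  have "cmod ((c *\<^sub>C f) x - s (c *\<^sub>C a n) x) \<le> (cmod c * d n) * seminorm x" if "x \<in> X" for n x
  proof -
    have "(c *\<^sub>C f) x - s (c *\<^sub>C a n) x = c * (f x - s (a n) x)"
      using that d(1) by (simp add: scaleC_left scaleC_fun_def scaleC_complex_def algebra_simps)
    then show ?thesis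
      using mult_left_mono[OF d(3)[OF that, of n] norm_ge_zero[of c]]
      by (simp add: norm_mult mult.assoc)
  qed
  moreover have "(\<lambda>n. cmod c * d n) \<longlonglongrightarrow> 0"
    using tendsto_mult_left[OF d(2), of "cmod c"] by simp
  ultimately show ?thesis
    unfolding converges_def approximates_def using d(1) scaleC_in by blast
qed

lemma completion_diff:
  assumes "f \<in> completion" "x \<in> X" "y \<in> X"
  shows "f (x - y) = f x - f y"
proof -
  obtain b where b: "converges b f" using ex_converges[OF assms(1)] by blast
  then have "b n \<in> X" for n by (simp add: converges_def)
  then have "(\<lambda>n. s (b n) x - s (b n) y) \<longlonglongrightarrow> f (x - y)"
    using converges_pointwise[OF b diff_in[OF assms(2,3)]] assms(2,3) by (simp add: diff_right)
  moreover have "(\<lambda>n. s (b n) x - s (b n) y) \<longlonglongrightarrow> f x - f y"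
    by (intro tendsto_diff converges_pointwise[OF b] assms)
  ultimately show ?thesis by (rule LIMSEQ_unique)
qed

lemma completion_bounded:
  assumes "f \<in> completion"
  shows "\<exists>C\<ge>0. \<forall>x\<in>X. cmod (f x) \<le> C * seminorm x"
proof -
  obtain y where y: "y \<in> X" "approximates f y 1"
    using assms by (auto simp: completion_def dest: spec[of _ "1 :: real"])
  have "cmod (f x) \<le> (1 + seminorm y) * seminorm x" if "x \<in> X" for x
    using y that Cauchy_Schwarz[OF y(1) that] norm_triangle_ineq[of "f x - s y x" "s y x"]
    by (fastforce simp: approximates_def distrib_right)
  then show ?thesis using seminorm_ge_zero[OF y(1)] by (intro exI[of _ "1 + seminorm y"]) auto
qed

lemma converges_bounded:
  assumes "converges b g" "g \<in> completion"
  shows "Bseq (\<lambda>n. seminorm (b n))"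
    and "\<And>b'. converges b' g \<Longrightarrow> (\<lambda>n. seminorm (b n - b' n)) \<longlonglongrightarrow> 0"
    and "\<And>\<epsilon>. \<epsilon> > 0 \<Longrightarrow> \<exists>N. \<forall>m\<ge>N. \<forall>n\<ge>N. seminorm (b m - b n) < \<epsilon>"
proof -
  obtain e where e: "\<And>n. b n \<in> X" "e \<longlonglongrightarrow> 0"
    "\<And>n x. x \<in> X \<Longrightarrow> cmod (g x - s (b n) x) \<le> e n * seminorm x"
    by (rule convergesE[OF assms(1)]) blast
  \<comment> \<open>\<open>seminorm_leI\<close> turns two dual estimates into one for the seminorm.
    The absolute values are there because the error bounds are not known to be nonnegative.\<close>
  have diff: "seminorm (b n - b' m) \<le> \<bar>e n\<bar> + \<bar>d m\<bar>"
    if b': "\<And>n. b' n \<in> X" and d: "\<And>n x. x \<in> X \<Longrightarrow> cmod (g x - s (b' n) x) \<le> d n * seminorm x" for b' d n m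
  proof (rule seminorm_leI)
    fix x assume x: "x \<in> X"
    have "e n * seminorm x \<le> \<bar>e n\<bar> * seminorm x" "d m * seminorm x \<le> \<bar>d m\<bar> * seminorm x"
      using x by (auto intro!: mult_right_mono seminorm_ge_zero)
    moreover have "s (b n - b' m) x = (g x - s (b' m) x) - (g x - s (b n) x)"
      using x e(1) b' by (simp add: diff_left)
    ultimately show "cmod (s (b n - b' m) x) \<le> (\<bar>e n\<bar> + \<bar>d m\<bar>) * seminorm x"
      using norm_triangle_ineq4[of "g x - s (b' m) x" "g x - s (b n) x"] e(3)[OF x, of n] d[OF x, of m]
      by (simp add: distrib_right)
  qed (use e b' diff_in in auto)
  show cauchy: "\<exists>N. \<forall>m\<ge>N. \<forall>n\<ge>N. seminorm (b m - b n) < \<epsilon>" if "\<epsilon> > 0" for \<epsilon>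
  proof -
    have "\<epsilon> / 2 > 0" using that by simp
    then obtain N where N: "\<And>n. n \<ge> N \<Longrightarrow> \<bar>e n\<bar> < \<epsilon> / 2"
      using LIMSEQ_D[OF e(2)] by fastforce
    have "seminorm (b m - b n) < \<epsilon>" if "m \<ge> N" "n \<ge> N" for m n
    proof -
      have "seminorm (b m - b n) \<le> \<bar>e m\<bar> + \<bar>e n\<bar>" by (rule diff) (rule e(1), rule e(3))
      then show ?thesis using N[OF that(1)] N[OF that(2)] by linarith
    qed
    then show ?thesis by blast
  qed
  show "(\<lambda>n. seminorm (b n - b' n)) \<longlonglongrightarrow> 0" if b': "converges b' g" for b'
  proof -
    obtain d where d: "\<And>n. b' n \<in> X" "d \<longlonglongrightarrow> 0"
      "\<And>n x. x \<in> X \<Longrightarrow> cmod (g x - s (b' n) x) \<le> d n * seminorm x"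
      by (rule convergesE[OF b']) blast
    have "(\<lambda>n. \<bar>e n\<bar> + \<bar>d n\<bar>) \<longlonglongrightarrow> 0"
      using tendsto_add[OF tendsto_rabs_zero[OF e(2)] tendsto_rabs_zero[OF d(2)]] by simp
    moreover have "norm (seminorm (b n - b' n)) \<le> \<bar>e n\<bar> + \<bar>d n\<bar>" for n
    proof -
      have "seminorm (b n - b' n) \<le> \<bar>e n\<bar> + \<bar>d n\<bar>" by (rule diff) (rule d(1), rule d(3))
      then show ?thesis using seminorm_ge_zero[OF diff_in[OF e(1) d(1)]] by simp
    qed
    ultimately show ?thesis
      by (rule Lim_null_comparison[OF always_eventually[OF allI], rotated])
  qed
  obtain N where N: "\<forall>m\<ge>N. \<forall>n\<ge>N. seminorm (b m - b n) < 1" using cauchy[of 1] by auto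
  have "norm (seminorm (b n)) \<le> 1 + seminorm (b N)" if "n \<ge> N" for n
    using seminorm_diff(2)[OF e(1) e(1), of n N] N that seminorm_ge_zero[OF e(1), of n]
    by (simp, smt (verit) order_refl)
  then show "Bseq (\<lambda>n. seminorm (b n))"
    by (intro BfunI[of _ "1 + seminorm (b N)"]) (auto simp: eventually_sequentially)
qed

text \<open>The bounded functional \<open>f\<close> maps norm-Cauchy sequences to Cauchy sequences,
  and two sequences converging to the same \<open>g\<close> to sequences with the same
  limit.\<close>

lemma completion_inner_lim:
  assumes f: "f \<in> completion" and b: "converges b g" and g: "g \<in> completion"
  shows "(\<lambda>n. f (b n)) \<longlonglongrightarrow> completion_inner f g"
proof -
  define b' where "b' = (SOME b. converges b g)"
  have b': "converges b' g" unfolding b'_def using b by (rule someI[of "\<lambda>b. converges b g"])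
  have in_X: "b n \<in> X" "b' n \<in> X" for n using b b' by (simp_all add: converges_def)
  obtain C where C: "C \<ge> 0" "\<And>x. x \<in> X \<Longrightarrow> cmod (f x) \<le> C * seminorm x"
    using completion_bounded[OF f] by blast
  have "Cauchy (\<lambda>n. f (b' n))"
  proof (rule metric_CauchyI)
    fix \<epsilon> :: real assume "\<epsilon> > 0"
    then have "\<epsilon> / (C + 1) > 0" using C(1) by simp
    then obtain N where N: "\<forall>m\<ge>N. \<forall>n\<ge>N. seminorm (b' m - b' n) < \<epsilon> / (C + 1)"
      using converges_bounded(3)[OF b' g] by blast
    have "dist (f (b' m)) (f (b' n)) < \<epsilon>" if "m \<ge> N" "n \<ge> N" for m n
    proof -
      have "dist (f (b' m)) (f (b' n)) \<le> C * seminorm (b' m - b' n)"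
        using C(2)[OF diff_in[OF in_X(2) in_X(2)], of m n] in_X
        by (simp add: dist_norm completion_diff[OF f])
      also have "\<dots> \<le> (C + 1) * seminorm (b' m - b' n)"
        using seminorm_ge_zero[OF diff_in[OF in_X(2) in_X(2)], of m n] by (simp add: distrib_right)
      also have "\<dots> < \<epsilon>"
        using N that C(1) by (simp add: field_simps)
      finally show ?thesis .
    qed
    then show "\<exists>M. \<forall>m\<ge>M. \<forall>n\<ge>M. dist (f (b' m)) (f (b' n)) < \<epsilon>" by blast
  qed
  then have lim': "(\<lambda>n. f (b' n)) \<longlonglongrightarrow> completion_inner f g"
    unfolding completion_inner_def b'_def[symmetric]
    using Cauchy_convergent convergent_LIMSEQ_iff by blast
  have "(\<lambda>n. C * seminorm (b n - b' n)) \<longlonglongrightarrow> 0"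
    using tendsto_mult_left[OF converges_bounded(2)[OF b g b'], of C] by simp
  then have "(\<lambda>n. f (b n) - f (b' n)) \<longlonglongrightarrow> 0"
    by (rule Lim_null_comparison[rotated])
      (use C(2)[OF diff_in[OF in_X]] in_X in \<open>simp add: completion_diff[OF f]\<close>)
  from tendsto_add[OF this lim'] show ?thesis by simp
qed

text \<open>With this symmetric description the axioms of a semi-inner product pass from
  \<open>s\<close> to the completion by taking limits.\<close>

lemma completion_inner_lim2:
  assumes f: "f \<in> completion" and a: "converges a f" and g: "g \<in> completion" and b: "converges b g"
  shows "(\<lambda>n. s (a n) (b n)) \<longlonglongrightarrow> completion_inner f g"
proof -
  obtain e where e: "\<And>n. a n \<in> X" "e \<longlonglongrightarrow> 0"
    "\<And>n x. x \<in> X \<Longrightarrow> cmod (f x - s (a n) x) \<le> e n * seminorm x"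
    by (rule convergesE[OF a]) blast
  have bX: "b n \<in> X" for n using b by (simp add: converges_def)
  obtain K where K: "\<And>n. seminorm (b n) \<le> K"
  proof -
    obtain K where "\<forall>n. norm (seminorm (b n)) \<le> K"
      using converges_bounded(1)[OF b g] unfolding Bseq_def by blast
    then have "seminorm (b n) \<le> K" for n using abs_le_D1[of "seminorm (b n)" K] by simp
    then show thesis by (rule that)
  qed
  have "(\<lambda>n. \<bar>e n\<bar> * K) \<longlonglongrightarrow> 0"
    using tendsto_mult_right[OF tendsto_rabs_zero[OF e(2)], of K] by simp
  moreover have "norm (f (b n) - s (a n) (b n)) \<le> \<bar>e n\<bar> * K" for n
  proof -
    have "e n * seminorm (b n) \<le> \<bar>e n\<bar> * K"
      using K[of n] seminorm_ge_zero[OF bX, of n] by (intro mult_mono) auto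
    then show ?thesis using e(3)[OF bX, of n n] by linarith
  qed
  ultimately have "(\<lambda>n. f (b n) - s (a n) (b n)) \<longlonglongrightarrow> 0"
    by (rule Lim_null_comparison[OF always_eventually[OF allI], rotated])
  from tendsto_diff[OF completion_inner_lim[OF f b g] this] show ?thesis by simp
qed

lemma completion_inner_kernel:
  assumes "f \<in> completion" "y \<in> X"
  shows "completion_inner f (kernel y) = f y"
  using completion_inner_lim[OF assms(1) converges_kernel[OF assms(2)] kernel_completion[OF assms(2)]]
  by (simp add: LIMSEQ_const_iff)

lemma semi_inner_completion: "semi_inner completion completion_inner"
proof
  have supp: "(c *\<^sub>C f) x = 0" if "f \<in> completion" "x \<notin> X" for c f x
    using that by (simp add: completion_support scaleC_fun_def scaleC_complex_def)
  have add: "f + g \<in> completion" if "f \<in> completion" "g \<in> completion" for f g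
  proof -
    obtain a b where ab: "converges a f" "converges b g"
      using \<open>f \<in> completion\<close> \<open>g \<in> completion\<close> ex_converges by metis
    show ?thesis
      by (rule completionI[OF converges_add[OF ab]]) (use that in \<open>simp add: completion_support\<close>)
  qed
  have scale: "c *\<^sub>C f \<in> completion" if "f \<in> completion" for c f
  proof -
    obtain a where a: "converges a f" using \<open>f \<in> completion\<close> ex_converges by metis
    show ?thesis by (rule completionI[OF converges_scaleC[OF a]]) (rule supp[OF that])
  qed
  have "kernel 0 = 0"
    by (auto simp: kernel_def zero_left fun_eq_iff)
  then have "0 \<in> completion" using kernel_completion[OF zero_in] by simp
  then show "csubspace completion"
    unfolding complex_vector.subspace_def using add scale by blast
  fix f g h :: "'x \<Rightarrow> complex" and c
  assume f: "f \<in> completion" and g: "g \<in> completion"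
  obtain a b where a: "converges a f" and b: "converges b g"
    using ex_converges f g by metis
  have X: "a n \<in> X" "b n \<in> X" for n using a b by (simp_all add: converges_def)
  note ab = completion_inner_lim2[OF f a g b]
  have "(\<lambda>n. s (b n) (a n)) \<longlonglongrightarrow> cnj (completion_inner f g)"
    using tendsto_cnj[OF ab] commute[OF X] by simp
  then show "completion_inner g f = cnj (completion_inner f g)"
    using completion_inner_lim2[OF g b f a] LIMSEQ_unique by blast
  have "(\<lambda>n. s (c *\<^sub>C a n) (b n)) \<longlonglongrightarrow> c * completion_inner f g"
    using tendsto_mult_left[OF ab, of c] X by (simp add: scaleC_left)
  then show "completion_inner (c *\<^sub>C f) g = c * completion_inner f g"
    using completion_inner_lim2[OF scale[OF f] converges_scaleC[OF a] g b] LIMSEQ_unique by blast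
  show "completion_inner (f + g) h = completion_inner f h + completion_inner g h" if h: "h \<in> completion"
  proof -
    obtain d where d: "converges d h" using ex_converges h by blast
    then have "d n \<in> X" for n by (simp add: converges_def)
    then have "(\<lambda>n. s (a n + b n) (d n)) \<longlonglongrightarrow> completion_inner f h + completion_inner g h"
      using tendsto_add[OF completion_inner_lim2[OF f a h d] completion_inner_lim2[OF g b h d]] X
      by (simp add: add_left)
    then show ?thesis
      using completion_inner_lim2[OF add[OF f g] converges_add[OF a b] h d] LIMSEQ_unique by blast
  qed
next
  fix f assume f: "f \<in> completion"
  obtain a where a: "converges a f" using ex_converges f by blast
  then have X: "a n \<in> X" for n by (simp add: converges_def)
  show "0 \<le> Re (completion_inner f f)"
    by (rule LIMSEQ_le_const[OF tendsto_Re[OF completion_inner_lim2[OF f a f a]]])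
      (use ge_zero[OF X] in blast)
qed

interpretation C: semi_inner completion completion_inner
  by (rule semi_inner_completion)

lemma completion_seminorm_lim:
  assumes f: "f \<in> completion" and b: "converges b f"
  shows "(\<lambda>n. seminorm (b n)) \<longlonglongrightarrow> C.seminorm f"
  unfolding seminorm_def C.seminorm_def
  by (intro tendsto_real_sqrt tendsto_Re completion_inner_lim2 f b)

text \<open>Together with \<open>completion_seminorm_leI\<close> this identifies the norm of the
  completion with the dual norm of functionals on \<open>X\<close>, so norm estimates can be made by
  evaluating at points of \<open>X\<close>.\<close>

lemma completion_eval_le:
  assumes f: "f \<in> completion" and x: "x \<in> X"
  shows "cmod (f x) \<le> C.seminorm f * seminorm x"
proof -
  obtain b where b: "converges b f" using ex_converges f by blast
  then have X: "b n \<in> X" for n by (simp add: converges_def)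
  show ?thesis
  proof (rule LIMSEQ_le)
    show "(\<lambda>n. cmod (s (b n) x)) \<longlonglongrightarrow> cmod (f x)"
      by (intro tendsto_norm converges_pointwise b x)
    show "(\<lambda>n. seminorm (b n) * seminorm x) \<longlonglongrightarrow> C.seminorm f * seminorm x"
      by (intro tendsto_mult_right completion_seminorm_lim f b)
  qed (use Cauchy_Schwarz[OF X x] in blast)
qed

lemma completion_seminorm_leI:
  assumes f: "f \<in> completion" and K: "K \<ge> 0" and le: "\<And>x. x \<in> X \<Longrightarrow> cmod (f x) \<le> K * seminorm x"
  shows "C.seminorm f \<le> K"
proof (rule C.seminorm_leI[OF f K])
  fix g assume g: "g \<in> completion"
  obtain b where b: "converges b g" using ex_converges g by blast
  then have X: "b n \<in> X" for n by (simp add: converges_def)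
  show "cmod (completion_inner f g) \<le> K * C.seminorm g"
  proof (rule LIMSEQ_le)
    show "(\<lambda>n. cmod (f (b n))) \<longlonglongrightarrow> cmod (completion_inner f g)"
      by (intro tendsto_norm completion_inner_lim f g b)
    show "(\<lambda>n. K * seminorm (b n)) \<longlonglongrightarrow> K * C.seminorm g"
      by (intro tendsto_mult_left completion_seminorm_lim g b)
  qed (use le[OF X] in blast)
qed

text \<open>A norm-Cauchy sequence converges pointwise, and uniformly relative to the seminorm; a
  uniform limit of limits of the functions \<open>s y\<close> is again such a limit. Only two fields
  of \<open>W\<close> are prescribed because \<open>W\<close> may also carry an action.\<close>

lemma hilbert_space_completion:
  assumes W: "hspace W = completion" "hinner W = completion_inner"
  shows "hilbert_space W"
proof (rule hilbert_spaceI; (unfold W)?)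
  have norm: "hnorm W f = C.seminorm f" for f
    by (simp add: hnorm_def C.seminorm_def W)
  show "semi_inner completion completion_inner" by (rule semi_inner_completion)
  show "f = 0" if f: "f \<in> completion" and 0: "completion_inner f f = 0" for f
  proof
    fix x
    have "C.seminorm f = 0" using 0 by (simp add: C.seminorm_def)
    then show "f x = 0 x"
      using completion_eval_le[OF f, of x] completion_support[OF f, of x] by (cases "x \<in> X") auto
  qed
  fix \<sigma> :: "nat \<Rightarrow> 'x \<Rightarrow> complex"
  assume \<sigma>: "\<And>n. \<sigma> n \<in> completion"
    and cauchy: "\<And>\<epsilon>. \<epsilon> > 0 \<Longrightarrow> \<exists>N. \<forall>m\<ge>N. \<forall>n\<ge>N. hnorm W (\<sigma> m - \<sigma> n) < \<epsilon>"
  have eval: "cmod (\<sigma> m x - \<sigma> n x) \<le> hnorm W (\<sigma> m - \<sigma> n) * seminorm x" if "x \<in> X" for m n x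
    using completion_eval_le[OF C.diff_in[OF \<sigma> \<sigma>] that] by (simp add: norm)
  have "\<exists>y. (\<lambda>n. \<sigma> n x) \<longlonglongrightarrow> y" for x
  proof (cases "x \<in> X")
    case True
    have "Cauchy (\<lambda>n. \<sigma> n x)"
    proof (rule metric_CauchyI)
      fix \<epsilon> :: real assume "\<epsilon> > 0"
      have p: "seminorm x + 1 > 0" using seminorm_ge_zero[OF True] by simp
      then obtain N where N: "\<forall>m\<ge>N. \<forall>n\<ge>N. hnorm W (\<sigma> m - \<sigma> n) < \<epsilon> / (seminorm x + 1)"
        using cauchy[of "\<epsilon> / (seminorm x + 1)"] \<open>\<epsilon> > 0\<close> by auto
      have "dist (\<sigma> m x) (\<sigma> n x) < \<epsilon>" if "m \<ge> N" "n \<ge> N" for m n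
      proof -
        have "dist (\<sigma> m x) (\<sigma> n x) \<le> hnorm W (\<sigma> m - \<sigma> n) * (seminorm x + 1)"
          using eval[OF True, of m n] C.seminorm_ge_zero[OF C.diff_in[OF \<sigma> \<sigma>], of m n]
          by (simp add: dist_norm norm distrib_left)
        also have "\<dots> < \<epsilon>"
          using N that p by (simp add: pos_less_divide_eq)
        finally show ?thesis .
      qed
      then show "\<exists>M. \<forall>m\<ge>M. \<forall>n\<ge>M. dist (\<sigma> m x) (\<sigma> n x) < \<epsilon>" by blast
    qed
    then show ?thesis using Cauchy_convergent convergent_def by blast
  next
    case False
    then have "\<sigma> n x = 0" for n using completion_support[OF \<sigma>] by blast
    then show ?thesis by (intro exI[of _ 0]) simp
  qed
  then obtain f where f: "\<And>x. (\<lambda>n. \<sigma> n x) \<longlonglongrightarrow> f x" by metis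
  have near: "\<exists>N. \<forall>m\<ge>N. \<forall>x\<in>X. cmod (\<sigma> m x - f x) \<le> \<epsilon> * seminorm x" if pos: "\<epsilon> > 0" for \<epsilon>
  proof -
    obtain N where N: "\<And>m n. \<lbrakk>m \<ge> N; n \<ge> N\<rbrakk> \<Longrightarrow> hnorm W (\<sigma> m - \<sigma> n) < \<epsilon>"
      using cauchy[OF pos] by blast
    have "cmod (\<sigma> m x - f x) \<le> \<epsilon> * seminorm x" if m: "m \<ge> N" and x: "x \<in> X" for m x
    proof (rule LIMSEQ_le_const2)
      show "(\<lambda>n. cmod (\<sigma> m x - \<sigma> n x)) \<longlonglongrightarrow> cmod (\<sigma> m x - f x)"
        by (intro tendsto_intros f)
      have "cmod (\<sigma> m x - \<sigma> n x) \<le> \<epsilon> * seminorm x" if "n \<ge> N" for n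
        using eval[OF x, of m n] mult_right_mono[OF less_imp_le[OF N[OF m that]] seminorm_ge_zero[OF x]]
        by linarith
      then show "\<exists>N. \<forall>n\<ge>N. cmod (\<sigma> m x - \<sigma> n x) \<le> \<epsilon> * seminorm x" by blast
    qed
    then show ?thesis by blast
  qed
  have f_in: "f \<in> completion"
    unfolding completion_def
  proof (intro CollectI conjI allI impI)
    show "f x = 0" if "x \<notin> X" for x
    proof -
      have "\<sigma> n x = 0" for n using completion_support[OF \<sigma> that] .
      then show ?thesis using f[of x] by (simp add: LIMSEQ_const_iff)
    qed
    fix \<epsilon> :: real assume "\<epsilon> > 0"
    then have e: "\<epsilon> / 2 > 0" by simp
    obtain m where m: "\<forall>x\<in>X. cmod (\<sigma> m x - f x) \<le> \<epsilon> / 2 * seminorm x" using near[OF e] by blast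
    obtain y where y: "y \<in> X" "\<forall>x\<in>X. cmod (\<sigma> m x - s y x) \<le> \<epsilon> / 2 * seminorm x"
      using completion_approx[OF \<sigma> e] by blast
    have "cmod (f x - s y x) \<le> \<epsilon> * seminorm x" if "x \<in> X" for x
    proof -
      have "cmod (f x - s y x) \<le> cmod (\<sigma> m x - f x) + cmod (\<sigma> m x - s y x)"
        using norm_triangle_ineq4[of "\<sigma> m x - s y x" "\<sigma> m x - f x"] by (simp add: add.commute)
      also have "\<dots> \<le> \<epsilon> / 2 * seminorm x + \<epsilon> / 2 * seminorm x"
        using m y(2) that by (intro add_mono) auto
      finally show ?thesis by simp
    qed
    then show "\<exists>y\<in>X. approximates f y \<epsilon>" using y(1) by (auto simp: approximates_def)
  qed
  have "(\<lambda>n. hnorm W (\<sigma> n - f)) \<longlonglongrightarrow> 0"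
  proof (rule LIMSEQ_I)
    fix \<epsilon> :: real assume "\<epsilon> > 0"
    then have e: "\<epsilon> / 2 > 0" by simp
    obtain N where N: "\<And>m x. \<lbrakk>m \<ge> N; x \<in> X\<rbrakk> \<Longrightarrow> cmod (\<sigma> m x - f x) \<le> \<epsilon> / 2 * seminorm x"
      using near[OF e] by blast
    have "norm (hnorm W (\<sigma> n - f) - 0) < \<epsilon>" if "n \<ge> N" for n
    proof -
      have "hnorm W (\<sigma> n - f) \<le> \<epsilon> / 2"
        unfolding norm using N[OF that] e by (intro completion_seminorm_leI C.diff_in \<sigma> f_in) auto
      then show ?thesis
        using C.seminorm_ge_zero[OF C.diff_in[OF \<sigma> f_in], of n] \<open>\<epsilon> > 0\<close> by (simp add: norm)
    qed
    then show "\<exists>N. \<forall>n\<ge>N. norm (hnorm W (\<sigma> n - f) - 0) < \<epsilon>" by blast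
  qed
  then show "\<exists>x. hlim W \<sigma> x"
    using \<sigma> f_in W by (intro exI[of _ f]) (auto simp: hlim_def)
qed

lemma completion_dense:
  assumes W: "hspace W = completion" "hinner W = completion_inner"
    and f: "f \<in> completion" and "\<epsilon> > 0"
  shows "\<exists>y\<in>X. hnorm W (kernel y - f) < \<epsilon>"
proof -
  have norm: "hnorm W f = C.seminorm f" for f
    by (simp add: hnorm_def C.seminorm_def W)
  have e: "\<epsilon> / 2 > 0" using \<open>\<epsilon> > 0\<close> by simp
  then obtain y where y: "y \<in> X" "\<forall>x\<in>X. cmod (f x - s y x) \<le> \<epsilon> / 2 * seminorm x"
    using completion_approx[OF f] by blast
  have "C.seminorm (f - kernel y) \<le> \<epsilon> / 2"
    using y e by (intro completion_seminorm_leI C.diff_in f kernel_completion) (auto simp: kernel_def)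
  then show ?thesis
    using y(1) e C.seminorm_diff(3)[OF f kernel_completion[OF y(1)]] by (intro bexI[of _ y]) (auto simp: norm)
qed

end

lemma (in semi_inner) completion_scaleC:
  assumes "f \<in> completion" "x \<in> X"
  shows "f (c *\<^sub>C x) = cnj c * f x"
proof -
  obtain b where b: "converges b f" using ex_converges[OF assms(1)] by blast
  then have "b n \<in> X" for n by (simp add: converges_def)
  then have "(\<lambda>n. cnj c * s (b n) x) \<longlonglongrightarrow> f (c *\<^sub>C x)"
    using converges_pointwise[OF b scaleC_in[OF assms(2)]] assms(2) by (simp add: scaleC_right)
  moreover have "(\<lambda>n. cnj c * s (b n) x) \<longlonglongrightarrow> cnj c * f x"
    by (intro tendsto_mult_left converges_pointwise[OF b] assms)
  ultimately show ?thesis by (rule LIMSEQ_unique)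
qed

section \<open>The Gelfand-Naimark-Segal construction\<close>

text \<open>The self-adjoint element \<open>e\<close> replaces the unit: by \<open>unit\<close>,
  \<psi> does not change under right multiplication by \<open>e\<close>, so the class of
  \<open>e\<close> is a cyclic vector. The assumption \<open>bdd\<close> is what makes left
  multiplications bounded operators, as \<open>A\<close> carries no norm.\<close>

lemma GNS:
  fixes A :: "'a::star_algebra set" and \<psi> :: "'a \<Rightarrow> complex"
  assumes A: "star_subalgebra A" and e: "e \<in> A" "star e = e"
    and add: "\<And>a b. \<lbrakk>a \<in> A; b \<in> A\<rbrakk> \<Longrightarrow> \<psi> (a + b) = \<psi> a + \<psi> b"
    and scale: "\<And>c a. a \<in> A \<Longrightarrow> \<psi> (c *\<^sub>C a) = c * \<psi> a"
    and adj: "\<And>a. a \<in> A \<Longrightarrow> \<psi> (star a) = cnj (\<psi> a)"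
    and pos: "\<And>a. a \<in> A \<Longrightarrow> 0 \<le> Re (\<psi> (star a * a))"
    and bdd: "\<And>a. a \<in> A \<Longrightarrow> \<exists>K. \<forall>x\<in>A. Re (\<psi> (star (a * x) * (a * x))) \<le> K * Re (\<psi> (star x * x))"
    and unit: "\<And>a. a \<in> A \<Longrightarrow> \<psi> (a * e) = \<psi> a"
  obtains V :: "'a universal_rep" and \<xi> where "unitary_rep A V" "\<xi> \<in> hspace V" "haction V e \<xi> = \<xi>"
    "\<And>a. a \<in> A \<Longrightarrow> \<psi> a = hinner V (haction V a \<xi>) \<xi>"
    "\<And>v \<epsilon>. \<lbrakk>v \<in> hspace V; \<epsilon> > 0\<rbrakk> \<Longrightarrow> \<exists>a\<in>A. hnorm V (haction V a \<xi> - v) < \<epsilon>"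
proof -
  have A_sub: "csubspace A" and mult: "\<And>a b. \<lbrakk>a \<in> A; b \<in> A\<rbrakk> \<Longrightarrow> a * b \<in> A"
    and st: "\<And>a. a \<in> A \<Longrightarrow> star a \<in> A"
    using A by (auto simp: star_subalgebra_def)
  define s where "s x y = \<psi> (star y * x)" for x y
  interpret P: semi_inner A s
  proof
    show "s y x = cnj (s x y)" if "x \<in> A" "y \<in> A" for x y
      using adj[OF mult[OF st[OF that(2)] that(1)]] by (simp add: s_def star_mult star_star)
    show "s (x + y) z = s x z + s y z" if "x \<in> A" "y \<in> A" "z \<in> A" for x y z
      using that by (simp add: s_def distrib_left add mult st)
    show "s (c *\<^sub>C x) y = c * s x y" if "x \<in> A" "y \<in> A" for c x y
      using that by (simp add: s_def scaleC_mult_right scale mult st)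
    show "0 \<le> Re (s x x)" if "x \<in> A" for x
      using pos[OF that] by (simp add: s_def)
  qed (rule A_sub)
  have s_act: "s x (star a * y) = s (a * x) y" for a x y
    by (simp add: s_def star_mult star_star mult.assoc)
  have seminorm_act: "\<exists>K\<ge>0. \<forall>x\<in>A. P.seminorm (a * x) \<le> K * P.seminorm x" if a: "a \<in> A" for a
  proof -
    obtain K where K: "\<forall>x\<in>A. Re (s (a * x) (a * x)) \<le> K * Re (s x x)"
      using bdd[OF a] by (auto simp: s_def)
    have "P.seminorm (a * x) \<le> sqrt \<bar>K\<bar> * P.seminorm x" if x: "x \<in> A" for x
    proof -
      have "Re (s (a * x) (a * x)) \<le> \<bar>K\<bar> * Re (s x x)"
        using K x P.ge_zero[OF x] by (meson abs_ge_self mult_right_mono order_trans)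
      then show ?thesis
        unfolding P.seminorm_def real_sqrt_mult[symmetric] by (rule real_sqrt_le_mono)
    qed
    then show ?thesis by (intro exI[of _ "sqrt \<bar>K\<bar>"]) auto
  qed
  \<comment> \<open>The formula <a v, x> = <v, a* x>, read in the realization of vectors as
    functions.\<close>
  define act where "act a f = (\<lambda>x. if x \<in> A then f (star a * x) else 0)" for a and f :: "'a \<Rightarrow> complex"
  define V :: "'a universal_rep"
    where "V = \<lparr>hspace = P.completion, hinner = P.completion_inner, haction = act\<rparr>"
  have V: "hspace V = P.completion" "hinner V = P.completion_inner" "haction V = act"
    by (simp_all add: V_def)
  interpret V: hilbert_space V
    by (rule P.hilbert_space_completion) (rule V)+
  have norm: "semi_inner.seminorm P.completion_inner f = hnorm V f" for f
    by (simp add: semi_inner.seminorm_def[OF P.semi_inner_completion] hnorm_def V)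
  note eval_le = P.completion_eval_le[unfolded norm]
  note norm_leI = P.completion_seminorm_leI[unfolded norm]
  have act_conv: "P.converges (\<lambda>n. a * b n) (act a f)" if a: "a \<in> A" and b: "P.converges b f" for a b f
  proof -
    obtain d where d: "\<And>n. b n \<in> A" "d \<longlonglongrightarrow> 0"
      "\<And>n x. x \<in> A \<Longrightarrow> cmod (f x - s (b n) x) \<le> d n * P.seminorm x"
      by (rule P.convergesE[OF b]) blast
    obtain K where K: "K \<ge> 0" "\<And>x. x \<in> A \<Longrightarrow> P.seminorm (star a * x) \<le> K * P.seminorm x"
      using seminorm_act[OF st[OF a]] by blast
    have "cmod (act a f x - s (a * b n) x) \<le> (\<bar>d n\<bar> * K) * P.seminorm x" if x: "x \<in> A" for n x
    proof -
      have ax: "star a * x \<in> A" by (intro mult st a x)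
      have "cmod (act a f x - s (a * b n) x) \<le> d n * P.seminorm (star a * x)"
        using d(3)[OF ax, of n] x by (simp add: act_def s_act)
      also have "\<dots> \<le> \<bar>d n\<bar> * (K * P.seminorm x)"
        using K(2)[OF x] P.seminorm_ge_zero[OF ax] by (intro mult_mono) auto
      finally show ?thesis by (simp add: mult.assoc)
    qed
    moreover have "(\<lambda>n. \<bar>d n\<bar> * K) \<longlonglongrightarrow> 0"
      using tendsto_mult_right[OF tendsto_rabs_zero[OF d(2)], of K] by simp
    ultimately show ?thesis
      unfolding P.converges_def P.approximates_def using mult[OF a d(1)] by blast
  qed
  have act_in: "act a f \<in> P.completion" if a: "a \<in> A" and f: "f \<in> P.completion" for a f
  proof -
    obtain b where b: "P.converges b f" using P.ex_converges[OF f] by blast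
    show ?thesis by (rule P.completionI[OF act_conv[OF a b]]) (simp add: act_def)
  qed
  have f_add: "f (x + y) = f x + f y" if "f \<in> P.completion" "x \<in> A" "y \<in> A" for f x y
    using P.completion_diff[OF that(1) P.add_in[OF that(2,3)] that(3)] by simp
  have act_star: "P.completion_inner (act a f) g = P.completion_inner f (act (star a) g)"
    if a: "a \<in> A" and f: "f \<in> P.completion" and g: "g \<in> P.completion" for a f g
  proof -
    obtain b where b: "P.converges b g" using P.ex_converges[OF g] by blast
    then have bA: "b n \<in> A" for n by (simp add: P.converges_def)
    have "(\<lambda>n. act a f (b n)) \<longlonglongrightarrow> P.completion_inner (act a f) g"
      by (rule P.completion_inner_lim[OF act_in[OF a f] b g])
    moreover have "(\<lambda>n. f (star a * b n)) \<longlonglongrightarrow> P.completion_inner f (act (star a) g)"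
      by (rule P.completion_inner_lim[OF f act_conv[OF st[OF a] b] act_in[OF st[OF a] g]])
    ultimately show ?thesis
      using LIMSEQ_unique bA by (simp add: act_def)
  qed
  have act_bdd: "\<exists>K. \<forall>f\<in>P.completion. hnorm V (act a f) \<le> K * hnorm V f" if a: "a \<in> A" for a
  proof -
    obtain K where K: "K \<ge> 0" "\<And>x. x \<in> A \<Longrightarrow> P.seminorm (star a * x) \<le> K * P.seminorm x"
      using seminorm_act[OF st[OF a]] by blast
    have "hnorm V (act a f) \<le> K * hnorm V f" if f: "f \<in> P.completion" for f
    proof (rule norm_leI[OF act_in[OF a f]])
      have nf: "0 \<le> hnorm V f" using V.hnorm_ge_zero f by (simp add: V)
      then show "0 \<le> K * hnorm V f" using K(1) by simp
      fix x assume x: "x \<in> A"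
      have ax: "star a * x \<in> A" by (intro mult st a x)
      have "cmod (act a f x) \<le> hnorm V f * P.seminorm (star a * x)"
        using eval_le[OF f ax] x by (simp add: act_def)
      also have "\<dots> \<le> hnorm V f * (K * P.seminorm x)"
        by (rule mult_left_mono[OF K(2)[OF x] nf])
      finally show "cmod (act a f x) \<le> K * hnorm V f * P.seminorm x" by (simp add: mult_ac)
    qed
    then show ?thesis by blast
  qed
  define \<xi> where "\<xi> = P.kernel e"
  \<comment> \<open>The vector a \<xi> is the class of \<open>a\<close>, because \<psi>(x* a e) =
    \<psi>(x* a). Density of A \<xi> is then density of the kernels.\<close>
  have act_xi: "act a \<xi> = P.kernel a" if a: "a \<in> A" for a
  proof
    fix x
    show "act a \<xi> x = P.kernel a x"
    proof (cases "x \<in> A")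
      case True
      then have "act a \<xi> x = \<psi> (star x * a * e)"
        using a e by (simp add: act_def \<xi>_def P.kernel_def mult st s_act) (simp add: s_def mult.assoc)
      then show ?thesis
        using True a unit[OF mult[OF st[OF True] a]] by (simp add: P.kernel_def s_def)
    qed (simp add: act_def P.kernel_def)
  qed
  have xi: "\<xi> \<in> P.completion" unfolding \<xi>_def by (rule P.kernel_completion[OF e(1)])
  have state: "\<psi> a = P.completion_inner (act a \<xi>) \<xi>" if a: "a \<in> A" for a
  proof -
    have "P.completion_inner (act a \<xi>) \<xi> = \<psi> (star e * a)"
      unfolding act_xi[OF a] using P.completion_inner_kernel[OF P.kernel_completion[OF a] e(1)] e(1)
      by (simp add: \<xi>_def P.kernel_def s_def)
    \<comment> \<open>The assumption \<open>unit\<close> concerns right multiplication; \<psi>(e a)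
      = \<psi>(a) follows by taking adjoints.\<close>
    also have "\<dots> = cnj (\<psi> (star a * e))"
      using adj[OF mult[OF st[OF a] e(1)]] by (simp add: star_mult star_star)
    also have "\<dots> = \<psi> a"
      using unit[OF st[OF a]] adj[OF a] by simp
    finally show ?thesis ..
  qed
  have dense: "\<exists>a\<in>A. hnorm V (act a \<xi> - v) < \<epsilon>" if v: "v \<in> P.completion" and pos: "\<epsilon> > 0" for v \<epsilon>
    using P.completion_dense[OF V(1,2) v pos] act_xi by auto
  have "unitary_rep A V"
  proof
    fix a b u v c
    show "haction V a v \<in> hspace V" if "a \<in> A" "v \<in> hspace V"
      using that act_in by (simp add: V)
    show "haction V a (u + v) = haction V a u + haction V a v"
      by (auto simp: V act_def)
    show "haction V a (c *\<^sub>C v) = c *\<^sub>C haction V a v"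
      by (auto simp: V act_def scaleC_fun_def scaleC_complex_def)
    show "haction V (a + b) v = haction V a v + haction V b v"
      if "a \<in> A" "b \<in> A" "v \<in> hspace V"
      using that by (auto simp: V act_def star_add distrib_right f_add mult st)
    show "haction V (c *\<^sub>C a) v = c *\<^sub>C haction V a v" if "a \<in> A" "v \<in> hspace V"
      using that
      by (auto simp: V act_def star_scaleC scaleC_mult_left P.completion_scaleC mult st scaleC_fun_def
          scaleC_complex_def)
    show "haction V (a * b) v = haction V a (haction V b v)" if "a \<in> A" "b \<in> A" "v \<in> hspace V"
      using that by (auto simp: V act_def star_mult mult st mult.assoc)
    show "\<exists>K. \<forall>v\<in>hspace V. hnorm V (haction V a v) \<le> K * hnorm V v" if "a \<in> A"
      using act_bdd[OF that] by (simp add: V)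
    show "hinner V (haction V a u) v = hinner V u (haction V (star a) v)"
      if "a \<in> A" "u \<in> hspace V" "v \<in> hspace V"
      using act_star that by (simp add: V)
    have span: "act_span A V \<subseteq> hspace V"
      unfolding act_span_def
      by (rule complex_vector.span_minimal) (use act_in V V.hspace_subspace in auto)
    show "htopology V closure_of act_span A V = hspace V"
    proof
      show "htopology V closure_of act_span A V \<subseteq> hspace V"
        using closure_of_subset_topspace[of "htopology V"] by simp
      show "hspace V \<subseteq> htopology V closure_of act_span A V"
      proof
        fix v assume v: "v \<in> hspace V"
        have "act a \<xi> \<in> act_span A V" if "a \<in> A" for a
          unfolding act_span_def by (rule complex_vector.span_base) (use that xi V in auto)
        then show "v \<in> htopology V closure_of act_span A V"
          unfolding V.closure_of_iff_approx[OF span] using dense[of v] v V by blast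
      qed
    qed
  qed
  moreover have "haction V e \<xi> = \<xi>" using act_xi[OF e(1)] by (simp add: V \<xi>_def)
  ultimately show thesis
    using that[of V \<xi>] xi state dense by (simp add: V)
qed

section \<open>Cyclic vectors and projections of the algebra\<close>

context unitary_rep
begin

lemma hlim_act:
  assumes a: "a \<in> A" and lim: "hlim V \<sigma> x"
  shows "hlim V (\<lambda>n. haction V a (\<sigma> n)) (haction V a x)"
proof -
  note l = hlimD[OF lim]
  obtain K where K: "\<And>v. v \<in> hspace V \<Longrightarrow> hnorm V (haction V a v) \<le> K * hnorm V v"
    using haction_bounded[OF a] by blast
  have diff: "haction V a (\<sigma> n) - haction V a x = haction V a (\<sigma> n - x)" for n
    using haction_add_right[OF a diff_mem[OF l(1,2)] l(2), of n] by (simp add: diff_eq_eq)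
  show ?thesis
  proof (rule hlimI_le)
    show "hnorm V (haction V a (\<sigma> n) - haction V a x) \<le> K * hnorm V (\<sigma> n - x)" for n
      unfolding diff by (rule K[OF diff_mem[OF l(1,2)]])
    show "(\<lambda>n. K * hnorm V (\<sigma> n - x)) \<longlonglongrightarrow> 0"
      using tendsto_mult_left[OF l(3), of K] by simp
  qed (use l haction_closed[OF a] in auto)
qed

lemma haction_zero_right: "a \<in> A \<Longrightarrow> haction V a 0 = 0"
  using haction_add_right[of a 0 0] by (simp add: zero_mem)

lemma haction_diff_right:
  "\<lbrakk>a \<in> A; u \<in> hspace V; v \<in> hspace V\<rbrakk> \<Longrightarrow> haction V a (u - v) = haction V a u - haction V a v"
  using haction_add_right[of a "u - v" v] by (simp add: diff_mem)

lemma act_span_subset: "B \<subseteq> A \<Longrightarrow> act_span B V \<subseteq> hspace V"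
  unfolding act_span_def
  by (rule complex_vector.span_minimal) (use haction_closed hspace_subspace in auto)

lemma haction_in_act_span: "\<lbrakk>b \<in> B; v \<in> hspace V\<rbrakk> \<Longrightarrow> haction V b v \<in> act_span B V"
  unfolding act_span_def by (rule complex_vector.span_base) blast

lemma hinner_haction_haction:
  assumes A: "star_subalgebra A" and "a \<in> A" "b \<in> A" "x \<in> A" "v \<in> hspace V"
  shows "hinner V (haction V x (haction V a v)) (haction V b v) = hinner V (haction V (star b * x * a) v) v"
proof -
  have st: "star b \<in> A" and mult: "x * a \<in> A" "star b * x \<in> A"
    using assms by (auto simp: star_subalgebra_def)
  then show ?thesis
    using assms haction_star[OF st haction_closed[OF mult(1) assms(5)] assms(5)]
    by (simp add: haction_mult haction_closed star_star mult.assoc)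
qed

lemma hinner_star_mult:
  assumes "star_subalgebra A" "a \<in> A" "b \<in> A" "v \<in> hspace V"
  shows "hinner V (haction V (star b * a) v) v = hinner V (haction V a v) (haction V b v)"
proof -
  have "star b \<in> A" using assms by (simp add: star_subalgebra_def)
  then show ?thesis
    using assms haction_star[OF \<open>star b \<in> A\<close> haction_closed[OF assms(2,4)] assms(4)]
    by (simp add: haction_mult star_star)
qed

text \<open>If \<open>e * a * e = a\<close>, the coefficient of \<open>a\<close> at e v is the one
  at \<open>v\<close>, so projecting an approximating vector does not disturb the coefficients of
  such elements.\<close>

lemma hinner_projection:
  assumes e: "e \<in> A" "star e = e" and a: "a \<in> A" "a * e \<in> A" and v: "v \<in> hspace V"
  shows "hinner V (haction V a (haction V e v)) (haction V e v) = hinner V (haction V (e * a * e) v) v"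
  using haction_star[OF e(1) haction_closed[OF a(2) v] v] haction_mult[OF e(1) a(2) v]
    haction_mult[OF a(1) e(1) v]
  by (simp add: e(2) mult.assoc)

lemma projection_norm:
  assumes e: "e \<in> A" "e * e = e" "star e = e" and v: "v \<in> hspace V"
  shows "(hnorm V (haction V e v))\<^sup>2 = Re (hinner V (haction V e v) v)"
    and "hnorm V (haction V e v) \<le> hnorm V v"
proof -
  have ev: "haction V e v \<in> hspace V" using e(1) v by (rule haction_closed)
  have "hinner V (haction V e v) (haction V e v) = hinner V (haction V e (haction V e v)) v"
    using haction_star[OF e(1) ev v] e(3) by simp
  also have "\<dots> = hinner V (haction V e v) v"
    using haction_mult[OF e(1) e(1) v] e(2) by simp
  finally have eq: "hinner V (haction V e v) (haction V e v) = hinner V (haction V e v) v" .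
  show sq: "(hnorm V (haction V e v))\<^sup>2 = Re (hinner V (haction V e v) v)"
    unfolding eq[symmetric] using hinner_self[OF ev] by simp
  have "hnorm V (haction V e v) * hnorm V (haction V e v) \<le> hnorm V v * hnorm V (haction V e v)"
    using sq Cauchy_Schwarz[OF ev v] complex_Re_le_cmod[of "hinner V (haction V e v) v"]
    by (simp add: power2_eq_square mult.commute)
  then show "hnorm V (haction V e v) \<le> hnorm V v"
    using hnorm_ge_zero[OF ev] hnorm_ge_zero[OF v]
    by (cases "hnorm V (haction V e v) = 0") auto
qed

text \<open>A vector in the span of B V involves finitely many elements of \<open>B\<close>, and a
  projection absorbing them fixes it. The closure is reached because projections do not increase the
  norm. The set \<open>T\<close> is absorbed at the same time.\<close>

lemma ex_projection_near:
  assumes B: "idempotented_star_algebra B" "B \<subseteq> A" and T: "finite T" "T \<subseteq> B"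
    and v: "v \<in> htopology V closure_of act_span B V" and "\<epsilon> > 0"
  shows "\<exists>e\<in>B. e * e = e \<and> star e = e \<and> (\<forall>t\<in>T. e * t * e = t) \<and> hnorm V (haction V e v - v) < \<epsilon>"
proof -
  \<comment> \<open>Quantifying over all idempotents that absorb \<open>F\<close> makes the property
    additive: for a sum the finite sets are joined.\<close>
  define P where "P x \<longleftrightarrow> x \<in> hspace V \<and> (\<exists>F. finite F \<and> F \<subseteq> B \<and>
    (\<forall>e\<in>B. e * e = e \<longrightarrow> (\<forall>a\<in>F. e * a * e = a) \<longrightarrow> haction V e x = x))" for x
  have P_span: "P x" if "x \<in> act_span B V" for x
    using that unfolding act_span_def
  proof (induction rule: complex_vector.span_induct_alt)
    case base
    show ?case unfolding P_def using zero_mem haction_zero_right B(2) by (intro conjI exI[of _ "{}"]) auto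
  next
    case (step c x y)
    then obtain b w where b: "b \<in> B" "w \<in> hspace V" "x = haction V b w" by blast
    then have x: "x \<in> hspace V" using haction_closed B(2) by blast
    obtain F where F: "finite F" "F \<subseteq> B" "\<And>e. \<lbrakk>e \<in> B; e * e = e; \<forall>a\<in>F. e * a * e = a\<rbrakk> \<Longrightarrow> haction V e y = y"
      and y: "y \<in> hspace V" using step(2) unfolding P_def by blast
    have "haction V e (c *\<^sub>C x + y) = c *\<^sub>C x + y"
      if e: "e \<in> B" "e * e = e" and eF: "\<forall>a\<in>insert b F. e * a * e = a" for e
    proof -
      have eb: "e * b * e = b" using eF by simp
      \<comment> \<open>From e b e = b follows e b = b, so \<open>e\<close> fixes every vector b
        w.\<close>
      have "e * b = e * (e * b * e)" by (simp only: eb)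
      also have "\<dots> = (e * e) * b * e" by (simp only: mult.assoc)
      also have "\<dots> = b" using e(2) eb by simp
      finally have "haction V e x = x"
        using b e(1) B(2) haction_mult[of e b w] by (metis subsetD)
      moreover have "haction V e y = y" using F(3) e eF by simp
      ultimately show ?thesis
        using x y e(1) B(2) by (auto simp: haction_add_right haction_scaleC_right scaleC_mem)
    qed
    moreover have "c *\<^sub>C x + y \<in> hspace V" using x y by (intro add_mem scaleC_mem)
    ultimately show ?case
      unfolding P_def using F(1,2) b(1) by (intro conjI exI[of _ "insert b F"]) auto
  qed
  note sub = act_span_subset[OF B(2)]
  have vV: "v \<in> hspace V" using v by (simp add: closure_of_iff_approx[OF sub])
  have "\<epsilon> / 2 > 0" using \<open>\<epsilon> > 0\<close> by simp
  then obtain x where x: "x \<in> act_span B V" "hnorm V (x - v) < \<epsilon> / 2"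
    using v unfolding closure_of_iff_approx[OF sub] by blast
  then obtain F where xV: "x \<in> hspace V" and F: "finite F" "F \<subseteq> B"
    "\<forall>e\<in>B. e * e = e \<longrightarrow> (\<forall>a\<in>F. e * a * e = a) \<longrightarrow> haction V e x = x"
    using P_span[OF x(1)] unfolding P_def by blast
  obtain e where e: "e \<in> B" "e * e = e" "star e = e" "\<forall>a\<in>T \<union> F. e * a * e = a"
  proof -
    have "finite (T \<union> F)" "T \<union> F \<subseteq> B" using T F(1,2) by auto
    then have "\<exists>e\<in>B. e * e = e \<and> star e = e \<and> (\<forall>a\<in>T \<union> F. e * a * e = a)"
      using B(1) unfolding idempotented_star_algebra_def by metis
    then show thesis using that by blast
  qed
  have eA: "e \<in> A" using e(1) B(2) by blast
  have ex: "haction V e x = x" using F(3) e by simp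
  have split: "haction V e v - v = haction V e (v - x) + (x - v)"
    using eA vV xV ex by (simp add: haction_diff_right)
  have "hnorm V (haction V e v - v) \<le> hnorm V (haction V e (v - x)) + hnorm V (x - v)"
    unfolding split by (intro hnorm_triangle haction_closed diff_mem eA vV xV)
  also have "hnorm V (haction V e (v - x)) \<le> hnorm V (x - v)"
    using projection_norm(2)[OF eA e(2,3) diff_mem[OF vV xV]] hnorm_minus_commute[OF vV xV] by simp
  finally have "hnorm V (haction V e v - v) < \<epsilon>" using x(2) by simp
  then show ?thesis using e by blast
qed

lemma haction_mem_closure:
  assumes B: "B \<subseteq> A" and b: "b \<in> B" and v: "v \<in> hspace V"
  shows "haction V b v \<in> htopology V closure_of act_span B V"
  using closure_of_subset[of "act_span B V" "htopology V"] act_span_subset[OF B]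
    haction_in_act_span[OF b v] by auto

end

section \<open>Cyclic vectors and the isometries they determine\<close>

text \<open>The closure of B u is a closed submodule. It contains \<open>u\<close> because e u = u,
  hence it is not zero and must be the whole space.\<close>

lemma irreducible_rep_cyclic:
  assumes B: "star_subalgebra B" and V: "irreducible_rep B V"
    and u: "u \<in> hspace V" "u \<noteq> 0" and e: "e \<in> B" "haction V e u = u"
    and v: "v \<in> hspace V" and "\<epsilon> > 0"
  shows "\<exists>b\<in>B. hnorm V (haction V b u - v) < \<epsilon>"
proof -
  interpret V: unitary_rep B V using V by (simp add: irreducible_rep_def)
  let ?M = "(\<lambda>b. haction V b u) ` B"
  have M: "?M \<subseteq> hspace V" using u V.haction_closed by auto
  have B_cl: "csubspace B" "\<And>a b. \<lbrakk>a \<in> B; b \<in> B\<rbrakk> \<Longrightarrow> a * b \<in> B"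
    using B by (auto simp: star_subalgebra_def)
  have "csubspace ?M"
    unfolding complex_vector.subspace_def
  proof (intro conjI ballI allI)
    have "haction V 0 u = 0"
      using V.haction_scaleC_left[of e u 0] e u by (simp add: complex_vector.scale_zero_left)
    then show "0 \<in> ?M" using complex_vector.subspace_0[OF B_cl(1)] by (metis imageI)
    show "x + y \<in> ?M" if "x \<in> ?M" "y \<in> ?M" for x y
      using that u complex_vector.subspace_add[OF B_cl(1)] by (auto simp flip: V.haction_add_left)
    show "c *\<^sub>C x \<in> ?M" if "x \<in> ?M" for c x
      using that u complex_vector.subspace_scale[OF B_cl(1)] by (auto simp flip: V.haction_scaleC_left)
  qed
  define W where "W = htopology V closure_of ?M"
  note iff = V.closure_of_iff_hlim[OF M]
  have "csubspace W" unfolding W_def by (rule V.csubspace_closure_of) fact+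
  moreover have "closedin (htopology V) W" unfolding W_def by (rule closedin_closure_of)
  moreover have "W \<subseteq> hspace V" using closedin_subset[OF calculation(2)] by simp
  moreover have "haction V b w \<in> W" if b: "b \<in> B" and w: "w \<in> W" for b w
  proof -
    obtain \<sigma> where \<sigma>: "\<And>n. \<sigma> n \<in> ?M" "hlim V \<sigma> w" using w unfolding W_def iff by blast
    have "haction V b (\<sigma> n) \<in> ?M" for n
    proof -
      obtain a where a: "a \<in> B" "\<sigma> n = haction V a u" using \<sigma>(1) by blast
      then show ?thesis using V.haction_mult[OF b a(1) u(1)] B_cl(2)[OF b a(1)] by force
    qed
    with V.hlim_act[OF b \<sigma>(2)] show ?thesis
      unfolding W_def iff by (intro exI[of _ "\<lambda>n. haction V b (\<sigma> n)"]) simp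
  qed
  ultimately have "W = {0} \<or> W = hspace V"
    using V unfolding irreducible_rep_def by blast
  moreover have "u \<in> W"
  proof -
    have "u \<in> ?M" using e by (metis imageI)
    then show ?thesis
      unfolding W_def using closure_of_subset[of ?M "htopology V"] M by auto
  qed
  ultimately have "v \<in> W" using u(2) v by auto
  then show ?thesis
    using \<open>\<epsilon> > 0\<close> unfolding W_def V.closure_of_iff_approx[OF M] by blast
qed

text \<open>Uniqueness in the GNS construction: b u \<mapsto> b \<xi> preserves inner products since
  <a u, b u> = <b* a u, u>, and it extends to the closure. The vector \<xi> belongs to a
  representation of the larger algebra; its state is compared with that of \<open>u\<close> on
  \<open>B\<close> only.\<close>

lemma cyclic_isometry:
  fixes U :: "('a::star_algebra, 'u::complex_vector) hrep" and V :: "('a, 'v::complex_vector) hrep"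
  assumes A: "star_subalgebra A" and B: "star_subalgebra B" "B \<subseteq> A"
    and U: "unitary_rep B U" and V: "unitary_rep A V"
    and u: "u \<in> hspace U" and \<xi>: "\<xi> \<in> hspace V"
    and eq: "\<And>b. b \<in> B \<Longrightarrow> hinner U (haction U b u) u = hinner V (haction V b \<xi>) \<xi>"
    and dense: "\<And>x \<epsilon>. \<lbrakk>x \<in> hspace U; \<epsilon> > 0\<rbrakk> \<Longrightarrow> \<exists>b\<in>B. hnorm U (haction U b u - x) < \<epsilon>"
  obtains f where "isometric_hom B U V f" "\<And>b. b \<in> B \<Longrightarrow> f (haction U b u) = haction V b \<xi>"
proof -
  interpret U: unitary_rep B U by (rule U)
  interpret V: unitary_rep A V by (rule V)
  have B_cl: "\<And>a b. \<lbrakk>a \<in> B; b \<in> B\<rbrakk> \<Longrightarrow> a * b \<in> B" "\<And>a. a \<in> B \<Longrightarrow> star a \<in> B"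
    "\<And>a b. \<lbrakk>a \<in> B; b \<in> B\<rbrakk> \<Longrightarrow> a + b \<in> B" "\<And>a b. \<lbrakk>a \<in> B; b \<in> B\<rbrakk> \<Longrightarrow> a - b \<in> B"
    "\<And>c a. a \<in> B \<Longrightarrow> c *\<^sub>C a \<in> B"
    using B(1) by (auto simp: star_subalgebra_def complex_vector.subspace_add
        complex_vector.subspace_diff complex_vector.subspace_scale)
  have BA: "b \<in> A" if "b \<in> B" for b using that B(2) by blast
  have inner_eq: "hinner U (haction U a u) (haction U b u) = hinner V (haction V a \<xi>) (haction V b \<xi>)"
    if "a \<in> B" "b \<in> B" for a b
  proof -
    have "hinner U (haction U (star b * a) u) u = hinner U (haction U a u) (haction U b u)"
      by (rule U.hinner_star_mult[OF B(1) that u])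
    moreover have "hinner V (haction V (star b * a) \<xi>) \<xi> = hinner V (haction V a \<xi>) (haction V b \<xi>)"
      by (rule V.hinner_star_mult[OF A BA[OF that(1)] BA[OF that(2)] \<xi>])
    ultimately show ?thesis using eq[OF B_cl(1)[OF B_cl(2)[OF that(2)] that(1)]] by simp
  qed
  have diffU: "haction U a u - haction U b u = haction U (a - b) u" if "a \<in> B" "b \<in> B" for a b
    using U.haction_add_left[OF B_cl(4)[OF that] that(2) u] by (simp add: diff_eq_eq)
  have diffV: "haction V a \<xi> - haction V b \<xi> = haction V (a - b) \<xi>" if "a \<in> B" "b \<in> B" for a b
    using V.haction_add_left[OF BA[OF B_cl(4)[OF that]] BA[OF that(2)] \<xi>] by (simp add: diff_eq_eq)
  have norm_eq: "hnorm U (haction U a u - haction U b u) = hnorm V (haction V a \<xi> - haction V b \<xi>)"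
    if "a \<in> B" "b \<in> B" for a b
    unfolding diffU[OF that] diffV[OF that] hnorm_def using inner_eq B_cl(4)[OF that] by simp
  \<comment> \<open>The extension is built as a relation, the closure of the graph of b u \<mapsto>
    b \<xi>. Algebraic properties hold for the relation itself, and \<open>R_inner\<close> makes it
    single-valued: the difference of two values has norm 0.\<close>
  define R where "R x y \<longleftrightarrow> (\<exists>b. (\<forall>n. b n \<in> B) \<and> hlim U (\<lambda>n. haction U (b n) u) x \<and>
    hlim V (\<lambda>n. haction V (b n) \<xi>) y)" for x y
  have R_inner: "hinner V y y' = hinner U x x'" if xy: "R x y" "R x' y'" for x y x' y'
  proof -
    obtain a where a: "\<forall>n. a n \<in> B" "hlim U (\<lambda>n. haction U (a n) u) x" "hlim V (\<lambda>n. haction V (a n) \<xi>) y"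
      using xy(1) unfolding R_def by blast
    obtain b where b: "\<forall>n. b n \<in> B" "hlim U (\<lambda>n. haction U (b n) u) x'" "hlim V (\<lambda>n. haction V (b n) \<xi>) y'"
      using xy(2) unfolding R_def by blast
    have "(\<lambda>n. hinner V (haction V (a n) \<xi>) (haction V (b n) \<xi>)) \<longlonglongrightarrow> hinner U x x'"
      using U.hlim_inner[OF a(2) b(2)] a(1) b(1) by (simp add: inner_eq)
    then show ?thesis using V.hlim_inner[OF a(3) b(3)] LIMSEQ_unique by blast
  qed
  have R_add: "R (x + x') (y + y')" if xy: "R x y" "R x' y'" for x y x' y'
  proof -
    obtain a where a: "\<forall>n. a n \<in> B" "hlim U (\<lambda>n. haction U (a n) u) x" "hlim V (\<lambda>n. haction V (a n) \<xi>) y"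
      using xy(1) unfolding R_def by blast
    obtain b where b: "\<forall>n. b n \<in> B" "hlim U (\<lambda>n. haction U (b n) u) x'" "hlim V (\<lambda>n. haction V (b n) \<xi>) y'"
      using xy(2) unfolding R_def by blast
    show ?thesis
      unfolding R_def using U.hlim_add[OF a(2) b(2)] V.hlim_add[OF a(3) b(3)] a(1) b(1)
      by (intro exI[of _ "\<lambda>n. a n + b n"])
        (simp add: B_cl U.haction_add_left V.haction_add_left BA u \<xi>)
  qed
  have R_scale: "R (c *\<^sub>C x) (c *\<^sub>C y)" if xy: "R x y" for c x y
  proof -
    obtain a where a: "\<forall>n. a n \<in> B" "hlim U (\<lambda>n. haction U (a n) u) x" "hlim V (\<lambda>n. haction V (a n) \<xi>) y"
      using xy unfolding R_def by blast
    show ?thesis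
      unfolding R_def using U.hlim_scaleC[OF a(2), of c] V.hlim_scaleC[OF a(3), of c] a(1)
      by (intro exI[of _ "\<lambda>n. c *\<^sub>C a n"])
        (simp add: B_cl U.haction_scaleC_left V.haction_scaleC_left BA u \<xi>)
  qed
  have R_act: "R (haction U c x) (haction V c y)" if xy: "R x y" and c: "c \<in> B" for c x y
  proof -
    obtain a where a: "\<forall>n. a n \<in> B" "hlim U (\<lambda>n. haction U (a n) u) x" "hlim V (\<lambda>n. haction V (a n) \<xi>) y"
      using xy unfolding R_def by blast
    show ?thesis
      unfolding R_def using U.hlim_act[OF c a(2)] V.hlim_act[OF BA[OF c] a(3)] a(1)
      by (intro exI[of _ "\<lambda>n. c * a n"])
        (simp add: B_cl U.haction_mult V.haction_mult BA u \<xi> c)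
  qed
  have R_in: "y \<in> hspace V" if "R x y" for x y
    using that V.hlimD(2) unfolding R_def by blast
  have R_unique: "y = y'" if xy: "R x y" "R x y'" for x y y'
  proof -
    have "hinner V (y - y') (y - y') = 0"
      using R_inner[OF xy(1) xy(1)] R_inner[OF xy(1) xy(2)] R_inner[OF xy(2) xy(1)] R_inner[OF xy(2) xy(2)]
        R_in[OF xy(1)] R_in[OF xy(2)]
      by (simp add: V.S.diff_left V.S.diff_right V.diff_mem)
    then show ?thesis
      using V.hinner_eq_zero[OF V.diff_mem[OF R_in[OF xy(1)] R_in[OF xy(2)]]] by simp
  qed
  have R_ex: "\<exists>y. R x y" if x: "x \<in> hspace U" for x
  proof -
    have sub: "(\<lambda>b. haction U b u) ` B \<subseteq> hspace U" using U.haction_closed u by auto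
    obtain \<sigma> where \<sigma>: "\<And>n. \<sigma> n \<in> (\<lambda>b. haction U b u) ` B" "hlim U \<sigma> x"
      by (rule U.ex_hlim_of_approx[OF sub x]) (use dense[OF x] in auto)
    then have "\<forall>n. \<exists>b\<in>B. \<sigma> n = haction U b u" by blast
    then obtain b where b: "\<And>n. b n \<in> B" "\<And>n. \<sigma> n = haction U (b n) u" by metis
    have "\<sigma> = (\<lambda>n. haction U (b n) u)" using b(2) by (rule ext)
    then have lim: "hlim U (\<lambda>n. haction U (b n) u) x" using \<sigma>(2) by simp
    obtain y where "hlim V (\<lambda>n. haction V (b n) \<xi>) y"
    proof (rule V.hlim_complete)
      show "haction V (b n) \<xi> \<in> hspace V" for n by (intro V.haction_closed BA b \<xi>)
      fix \<epsilon> :: real assume "\<epsilon> > 0"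
      then have "\<epsilon> / 2 > 0" by simp
      then obtain N where N: "\<And>n. n \<ge> N \<Longrightarrow> hnorm U (haction U (b n) u - x) < \<epsilon> / 2"
        using order_tendstoD(2)[OF U.hlimD(3)[OF lim]] unfolding eventually_sequentially by blast
      have "hnorm V (haction V (b m) \<xi> - haction V (b n) \<xi>) < \<epsilon>" if "m \<ge> N" "n \<ge> N" for m n
      proof -
        have d: "haction U (b k) u - x \<in> hspace U" for k
          by (intro U.diff_mem U.haction_closed b u x)
        have "haction U (b m) u - haction U (b n) u = (haction U (b m) u - x) - (haction U (b n) u - x)"
          by simp
        then have "hnorm U (haction U (b m) u - haction U (b n) u) < \<epsilon>"
          using U.S.seminorm_diff(1)[OF d d, of m n] N[OF that(1)] N[OF that(2)] by simp
        then show ?thesis using norm_eq b(1) by simp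
      qed
      then show "\<exists>N. \<forall>m\<ge>N. \<forall>n\<ge>N. hnorm V (haction V (b m) \<xi> - haction V (b n) \<xi>) < \<epsilon>" by blast
    qed
    then show ?thesis unfolding R_def using b(1) lim by blast
  qed
  define f where "f x = (THE y. R x y)" for x
  have f: "R x (f x)" if x: "x \<in> hspace U" for x
  proof -
    obtain y where y: "R x y" using R_ex[OF x] by blast
    show ?thesis unfolding f_def by (rule theI, rule y, rule R_unique[OF _ y])
  qed
  have f_eqI: "f x = y" if "R x y" for x y
    unfolding f_def by (rule the_equality, rule that, rule R_unique[OF _ that])
  have "isometric_hom B U V f"
    unfolding isometric_hom_def
  proof (intro conjI ballI allI)
    show "f x \<in> hspace V" if "x \<in> hspace U" for x using R_in[OF f[OF that]] .
    show "f (x + y) = f x + f y" if "x \<in> hspace U" "y \<in> hspace U" for x y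
      by (intro f_eqI R_add f that)
    show "f (c *\<^sub>C x) = c *\<^sub>C f x" if "x \<in> hspace U" for c x
      by (intro f_eqI R_scale f that)
    show "f (haction U b x) = haction V b (f x)" if "b \<in> B" "x \<in> hspace U" for b x
      by (intro f_eqI R_act f that)
    show "hinner V (f x) (f y) = hinner U x y" if "x \<in> hspace U" "y \<in> hspace U" for x y
      by (intro R_inner f that)
  qed
  moreover have "f (haction U b u) = haction V b \<xi>" if b: "b \<in> B" for b
  proof (rule f_eqI)
    show "R (haction U b u) (haction V b \<xi>)"
      unfolding R_def
      using U.hlim_const[OF U.haction_closed[OF b u]] V.hlim_const[OF V.haction_closed[OF BA[OF b] \<xi>]] b
      by (intro exI[of _ "\<lambda>_. b"]) simp
  qed
  ultimately show thesis by (rule that)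
qed

section \<open>Approximation of functionals by vector states\<close>

text \<open>With the value 0 outside \<open>A\<close>, the states of unit vectors are bounded in
  every coordinate and determined by their values on \<open>A\<close>.\<close>

definition vector_state :: "'a set \<Rightarrow> ('a, 'v) hrep \<Rightarrow> 'v \<Rightarrow> 'a \<Rightarrow> complex"
  where "vector_state A V v = (\<lambda>a. if a \<in> A then hinner V (haction V a v) v else 0)"

text \<open>Weak containment for a single functional, with the approximating unit vectors confined
  to \<open>M\<close>. In the applications \<open>M\<close> is the whole space, the closure of B V,
  or the set of vectors fixed by a projection.\<close>

definition approximable :: "'a set \<Rightarrow> ('a, 'v) hrep \<Rightarrow> 'v set \<Rightarrow> ('a \<Rightarrow> complex) \<Rightarrow> bool"
  where "approximable A V M \<phi> \<longleftrightarrow> (\<forall>T \<epsilon>. finite T \<longrightarrow> T \<subseteq> A \<longrightarrow> \<epsilon> > 0 \<longrightarrow>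
    (\<exists>v\<in>M. hnorm V v = 1 \<and> (\<forall>a\<in>T. cmod (\<phi> a - hinner V (haction V a v) v) < \<epsilon>)))"

lemma approximableD:
  assumes "approximable A V M \<phi>" "finite T" "T \<subseteq> A" "\<epsilon> > 0"
  obtains v where "v \<in> M" "hnorm V v = 1" "\<And>a. a \<in> T \<Longrightarrow> cmod (\<phi> a - hinner V (haction V a v) v) < \<epsilon>"
proof -
  have "\<exists>v\<in>M. hnorm V v = 1 \<and> (\<forall>a\<in>T. cmod (\<phi> a - hinner V (haction V a v) v) < \<epsilon>)"
    using assms unfolding approximable_def by simp
  then show thesis using that by blast
qed

lemma weakly_contained_iff_approximable:
  "weakly_contained A V W \<longleftrightarrow>
    (\<forall>v\<in>hspace V. hnorm V v = 1 \<longrightarrow> approximable A W (hspace W) (\<lambda>a. hinner V (haction V a v) v))"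
  unfolding weakly_contained_def approximable_def by blast

text \<open>With \<open>closure_approximable\<close> it turns weak containment into a question about
  pointwise closures, where compactness can be used.\<close>

lemma approximable_in_closure:
  assumes "approximable A V M \<phi>" "\<And>a. a \<notin> A \<Longrightarrow> \<phi> a = 0"
  shows "\<phi> \<in> closure {vector_state A V v | v. v \<in> M \<and> hnorm V v = 1}"
  unfolding closure_fun_iff
proof (intro allI impI)
  fix T :: "'a set" and \<epsilon> :: real assume "finite T" "\<epsilon> > 0"
  then obtain v where v: "v \<in> M" "hnorm V v = 1"
    "\<And>a. a \<in> T \<inter> A \<Longrightarrow> cmod (\<phi> a - hinner V (haction V a v) v) < \<epsilon>"
    using approximableD[OF assms(1), of "T \<inter> A" \<epsilon>] by blast
  have "dist (vector_state A V v a) (\<phi> a) < \<epsilon>" if "a \<in> T" for a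
    using that v(3) assms(2) \<open>\<epsilon> > 0\<close> by (auto simp: vector_state_def dist_norm norm_minus_commute)
  then show "\<exists>g\<in>{vector_state A V v | v. v \<in> M \<and> hnorm V v = 1}. \<forall>i\<in>T. dist (g i) (\<phi> i) < \<epsilon>"
    using v by blast
qed

lemma closure_approximable:
  assumes \<phi>: "\<phi> \<in> closure {vector_state A V v | v. v \<in> M \<and> hnorm V v = 1}"
  shows "approximable A V M \<phi>"
  unfolding approximable_def
proof (intro allI impI)
  fix T :: "'a set" and \<epsilon> :: real assume T: "finite T" "T \<subseteq> A" and "\<epsilon> > 0"
  then obtain v where v: "v \<in> M" "hnorm V v = 1" "\<forall>a\<in>T. dist (vector_state A V v a) (\<phi> a) < \<epsilon>"
    using \<phi> unfolding closure_fun_iff by blast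
  have "cmod (\<phi> a - hinner V (haction V a v) v) < \<epsilon>" if "a \<in> T" for a
    using bspec[OF v(3) that] subsetD[OF T(2) that] by (simp add: vector_state_def dist_norm norm_minus_commute)
  then show "\<exists>v\<in>M. hnorm V v = 1 \<and> (\<forall>a\<in>T. cmod (\<phi> a - hinner V (haction V a v) v) < \<epsilon>)"
    using v by blast
qed

section \<open>Normalizing and projecting approximating vectors\<close>

context unitary_rep
begin

text \<open>Vectors produced by projecting or by acting have norm only close to 1. Since
  \<open>M\<close> is stable under scaling, they can be rescaled at the cost of a small
  error.\<close>

lemma approximable_normalize:
  assumes B: "B \<subseteq> A" and M: "M \<subseteq> hspace V" "\<And>c v. v \<in> M \<Longrightarrow> c *\<^sub>C v \<in> M"
    and approx: "\<And>T \<epsilon>. \<lbrakk>finite T; T \<subseteq> B; \<epsilon> > 0\<rbrakk> \<Longrightarrow> \<exists>v\<in>M. \<bar>(hnorm V v)\<^sup>2 - 1\<bar> < \<epsilon> \<and>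
      (\<forall>a\<in>T. cmod (\<phi> a - hinner V (haction V a v) v) < \<epsilon>)"
  shows "approximable B V M \<phi>"
  unfolding approximable_def
proof (intro allI impI)
  fix T and \<epsilon> :: real assume T: "finite T" "T \<subseteq> B" and "\<epsilon> > 0"
  define C where "C = 1 + (\<Sum>a\<in>T. cmod (\<phi> a))"
  have "C \<ge> 1" by (simp add: C_def sum_nonneg)
  have C: "1 + cmod (\<phi> a) \<le> C" if "a \<in> T" for a
    using member_le_sum[OF that, of "\<lambda>a. cmod (\<phi> a)"] T(1) by (simp add: C_def)
  \<comment> \<open>The bound 1/2 keeps \<open>n\<close> at least 1/2. The error after division by
    \<open>n\<close> is then at most 2 \<delta> C, and the factor 4 makes this at most \<epsilon> /
    2. The constant \<open>C\<close> dominates 1 + |\<phi> a| for all \<open>a\<close> in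
    \<open>T\<close>.\<close>
  define \<delta> where "\<delta> = min (1/2) (\<epsilon> / (4 * C))"
  have \<delta>: "\<delta> > 0" "\<delta> \<le> 1/2" "4 * \<delta> * C \<le> \<epsilon>"
    using \<open>\<epsilon> > 0\<close> \<open>C \<ge> 1\<close> by (auto simp: \<delta>_def min_def field_simps)
  obtain v where v: "v \<in> M" "\<bar>(hnorm V v)\<^sup>2 - 1\<bar> < \<delta>"
    "\<And>a. a \<in> T \<Longrightarrow> cmod (\<phi> a - hinner V (haction V a v) v) < \<delta>"
    using approx[OF T \<delta>(1)] by blast
  define n where "n = (hnorm V v)\<^sup>2"
  define w where "w = of_real (1 / hnorm V v) *\<^sub>C v"
  have vV: "v \<in> hspace V" using v(1) M(1) by blast
  have n: "n \<ge> 1/2" "\<bar>n - 1\<bar> < \<delta>" using v(2) \<delta>(2) by (auto simp: n_def)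
  then have pos: "hnorm V v > 0" using hnorm_ge_zero[OF vV] by (cases "hnorm V v = 0") (auto simp: n_def)
  have norm_w: "hnorm V w = 1"
    using S.seminorm_scaleC[OF vV, of "of_real (1 / hnorm V v)"] pos by (simp add: w_def norm_divide)
  have "cmod (\<phi> a - hinner V (haction V a w) w) < \<epsilon>" if a: "a \<in> T" for a
  proof -
    define z where "z = hinner V (haction V a v) v"
    have aA: "a \<in> A" using a T(2) B by blast
    have "hinner V (haction V a w) w = of_real (1 / hnorm V v) * (of_real (1 / hnorm V v) * z)"
      using aA vV by (simp add: w_def z_def haction_scaleC_right hinner_scaleC_left hinner_scaleC_right
          haction_closed scaleC_mem)
    also have "\<dots> = z / of_real n"
      by (simp add: n_def power2_eq_square)
    finally have w: "hinner V (haction V a w) w = z / of_real n" .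
    have "of_real n * (\<phi> a - z / of_real n) = of_real n * \<phi> a - z"
      using n(1) by (simp add: right_diff_distrib)
    also have "\<dots> = (\<phi> a - z) + of_real (n - 1) * \<phi> a"
      by (simp add: algebra_simps)
    finally have "n * cmod (\<phi> a - z / of_real n) = cmod ((\<phi> a - z) + of_real (n - 1) * \<phi> a)"
      using n(1) by (metis abs_of_nonneg norm_mult norm_of_real order_trans zero_le_divide_1_iff zero_le_numeral)
    also have "\<dots> \<le> cmod (\<phi> a - z) + \<bar>n - 1\<bar> * cmod (\<phi> a)"
      by (rule order_trans[OF norm_triangle_ineq]) (simp add: norm_mult flip: of_real_diff)
    also have "\<dots> \<le> \<delta> + \<delta> * cmod (\<phi> a)"
      using v(3)[OF a] n(2) by (intro add_mono mult_right_mono) (auto simp: z_def)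
    also have "\<dots> \<le> \<delta> * C"
      using mult_left_mono[OF C[OF a], of \<delta>] \<delta>(1) by (simp add: distrib_left)
    finally have "n * cmod (\<phi> a - z / of_real n) \<le> \<delta> * C" .
    moreover have "1/2 * cmod (\<phi> a - z / of_real n) \<le> n * cmod (\<phi> a - z / of_real n)"
      by (intro mult_right_mono n(1)) simp
    moreover have "\<delta> * C > 0" using \<delta>(1) \<open>C \<ge> 1\<close> by simp
    ultimately show ?thesis
      unfolding w using \<delta>(3) by linarith
  qed
  moreover have "w \<in> M" unfolding w_def by (rule M(2)[OF v(1)])
  ultimately show "\<exists>v\<in>M. hnorm V v = 1 \<and> (\<forall>a\<in>T. cmod (\<phi> a - hinner V (haction V a v) v) < \<epsilon>)"
    using norm_w by blast
qed

text \<open>Each approximating \<open>v\<close> is replaced by e v. Testing at \<open>e\<close>,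
  where \<phi> is 1, shows that the norm of e v is almost 1; testing at \<open>e * a * e\<close>
  controls the coefficient of \<open>a\<close> at e v.\<close>

lemma approximable_compress:
  assumes B: "star_subalgebra B" "B \<subseteq> A" and e: "e \<in> B" "e * e = e" "star e = e"
    and \<phi>: "\<phi> e = 1" "\<And>a. a \<in> B \<Longrightarrow> \<phi> (e * a * e) = \<phi> a"
    and M: "M \<subseteq> hspace V" and approx: "approximable B V M \<phi>"
  shows "approximable B V {v \<in> hspace V. haction V e v = v} \<phi>"
proof (rule approximable_normalize[OF B(2)])
  have eA: "e \<in> A" using e(1) B(2) by blast
  show "{v \<in> hspace V. haction V e v = v} \<subseteq> hspace V" by blast
  show "c *\<^sub>C v \<in> {v \<in> hspace V. haction V e v = v}" if "v \<in> {v \<in> hspace V. haction V e v = v}" for c v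
    using that eA by (simp add: scaleC_mem haction_scaleC_right)
  fix T and \<epsilon> :: real assume T: "finite T" "T \<subseteq> B" and "\<epsilon> > 0"
  have eT: "insert e ((\<lambda>a. e * a * e) ` T) \<subseteq> B"
    using B(1) e(1) T(2) by (auto simp: star_subalgebra_def)
  obtain v where v: "v \<in> M" "hnorm V v = 1"
    "\<And>a. a \<in> insert e ((\<lambda>a. e * a * e) ` T) \<Longrightarrow> cmod (\<phi> a - hinner V (haction V a v) v) < \<epsilon>"
    by (rule approximableD[OF approx _ eT \<open>\<epsilon> > 0\<close>]) (use T(1) in auto)
  have vV: "v \<in> hspace V" using v(1) M by blast
  have ev: "haction V e v \<in> hspace V" using eA vV by (rule haction_closed)
  have "\<bar>(hnorm V (haction V e v))\<^sup>2 - 1\<bar> < \<epsilon>"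
  proof -
    have "\<bar>(hnorm V (haction V e v))\<^sup>2 - 1\<bar> = \<bar>Re (\<phi> e - hinner V (haction V e v) v)\<bar>"
      unfolding projection_norm(1)[OF eA e(2,3) vV] using \<phi>(1) by simp
    then show ?thesis
      using v(3)[of e] abs_Re_le_cmod[of "\<phi> e - hinner V (haction V e v) v"] by simp
  qed
  moreover have "cmod (\<phi> a - hinner V (haction V a (haction V e v)) (haction V e v)) < \<epsilon>" if a: "a \<in> T" for a
  proof -
    have aB: "a \<in> B" using a T(2) by blast
    have "a * e \<in> A" using B(1) aB e(1) B(2) by (auto simp: star_subalgebra_def)
    from hinner_projection[OF eA e(3) _ this vV] show ?thesis
      using v(3)[of "e * a * e"] a \<phi>(2)[OF aB] aB B(2) by auto
  qed
  moreover have "haction V e (haction V e v) = haction V e v"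
    using haction_mult[OF eA eA vV] e(2) by simp
  ultimately show "\<exists>v\<in>{v \<in> hspace V. haction V e v = v}. \<bar>(hnorm V v)\<^sup>2 - 1\<bar> < \<epsilon> \<and>
      (\<forall>a\<in>T. cmod (\<phi> a - hinner V (haction V a v) v) < \<epsilon>)"
    using ev by (intro bexI[of _ "haction V e v"]) auto
qed

end

text \<open>One cyclic vector suffices: \<eta> is close to some a \<xi>, and if \<open>v\<close>
  approximates the state of \<xi> at \<open>star a * a\<close> and at \<open>star a * t * a\<close>,
  then a v has almost unit norm and approximates the state of \<eta> at \<open>t\<close>.\<close>

lemma weakly_contained_cyclic:
  fixes H :: "('a::star_algebra, 'w::complex_vector) hrep" and V :: "('a, 'v::complex_vector) hrep"
  assumes A: "star_subalgebra A" and H: "unitary_rep A H" and V: "unitary_rep A V"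
    and M: "M \<subseteq> hspace V" and \<xi>: "\<xi> \<in> hspace H"
    and approx: "approximable A V M (\<lambda>a. hinner H (haction H a \<xi>) \<xi>)"
    and dense: "\<And>v \<epsilon>. \<lbrakk>v \<in> hspace H; \<epsilon> > 0\<rbrakk> \<Longrightarrow> \<exists>a\<in>A. hnorm H (haction H a \<xi> - v) < \<epsilon>"
  shows "weakly_contained A H V"
  unfolding weakly_contained_iff_approximable
proof (intro ballI impI)
  interpret H: unitary_rep A H by (rule H)
  interpret V: unitary_rep A V by (rule V)
  have A_cl: "\<And>a b. \<lbrakk>a \<in> A; b \<in> A\<rbrakk> \<Longrightarrow> a * b \<in> A" "\<And>a. a \<in> A \<Longrightarrow> star a \<in> A"
    using A by (auto simp: star_subalgebra_def)
  fix \<eta> assume \<eta>: "\<eta> \<in> hspace H" "hnorm H \<eta> = 1"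
  have sub: "(\<lambda>a. haction H a \<xi>) ` A \<subseteq> hspace H" using H.haction_closed \<xi> by auto
  obtain \<sigma> where \<sigma>: "\<And>n. \<sigma> n \<in> (\<lambda>a. haction H a \<xi>) ` A" "hlim H \<sigma> \<eta>"
    by (rule H.ex_hlim_of_approx[OF sub \<eta>(1)]) (use dense[OF \<eta>(1)] in auto)
  show "approximable A V (hspace V) (\<lambda>a. hinner H (haction H a \<eta>) \<eta>)"
  proof (rule V.approximable_normalize)
    fix T and \<epsilon> :: real assume T: "finite T" "T \<subseteq> A" and "\<epsilon> > 0"
    then have e2: "\<epsilon> / 2 > 0" by simp
    have "\<forall>\<^sub>F n in sequentially. \<forall>t\<in>T.
        dist (hinner H (haction H t (\<sigma> n)) (\<sigma> n)) (hinner H (haction H t \<eta>) \<eta>) < \<epsilon> / 2"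
      using T e2 by (intro eventually_ball_finite ballI tendstoD[OF H.hlim_inner[OF H.hlim_act[OF _ \<sigma>(2)] \<sigma>(2)]]) auto
    moreover have "\<forall>\<^sub>F n in sequentially. dist ((hnorm H (\<sigma> n))\<^sup>2) ((hnorm H \<eta>)\<^sup>2) < \<epsilon> / 2"
      by (intro tendstoD tendsto_power H.hlim_norm \<sigma>(2) e2)
    ultimately have "\<forall>\<^sub>F n in sequentially. dist ((hnorm H (\<sigma> n))\<^sup>2) ((hnorm H \<eta>)\<^sup>2) < \<epsilon> / 2 \<and> (\<forall>t\<in>T.
        dist (hinner H (haction H t (\<sigma> n)) (\<sigma> n)) (hinner H (haction H t \<eta>) \<eta>) < \<epsilon> / 2)"
      by eventually_elim blast
    then obtain n where n: "dist ((hnorm H (\<sigma> n))\<^sup>2) ((hnorm H \<eta>)\<^sup>2) < \<epsilon> / 2"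
      "\<And>t. t \<in> T \<Longrightarrow> dist (hinner H (haction H t (\<sigma> n)) (\<sigma> n)) (hinner H (haction H t \<eta>) \<eta>) < \<epsilon> / 2"
      unfolding eventually_sequentially by blast
    obtain a where a: "a \<in> A" "\<sigma> n = haction H a \<xi>" using \<sigma>(1) by blast
    let ?T = "insert (star a * a) ((\<lambda>t. star a * t * a) ` T)"
    have T': "finite ?T" "?T \<subseteq> A" using T a(1) A_cl by auto
    obtain v where v: "v \<in> M" "hnorm V v = 1"
      "\<And>t. t \<in> ?T \<Longrightarrow> cmod (hinner H (haction H t \<xi>) \<xi> - hinner V (haction V t v) v) < \<epsilon> / 2"
      using approximableD[OF approx T' e2] by blast
    have vV: "v \<in> hspace V" using v(1) M by blast
    have norm_H: "(hnorm H (\<sigma> n))\<^sup>2 = Re (hinner H (haction H (star a * a) \<xi>) \<xi>)"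
      unfolding a(2) H.hinner_star_mult[OF A a(1) a(1) \<xi>]
      by (metis H.hinner_self H.haction_closed[OF a(1) \<xi>] Re_complex_of_real)
    have norm_V: "(hnorm V (haction V a v))\<^sup>2 = Re (hinner V (haction V (star a * a) v) v)"
      unfolding V.hinner_star_mult[OF A a(1) a(1) vV]
      by (metis V.hinner_self V.haction_closed[OF a(1) vV] Re_complex_of_real)
    have "\<bar>(hnorm V (haction V a v))\<^sup>2 - 1\<bar> < \<epsilon>"
    proof -
      have "\<bar>(hnorm H (\<sigma> n))\<^sup>2 - (hnorm V (haction V a v))\<^sup>2\<bar> < \<epsilon> / 2"
        unfolding norm_H norm_V
        using v(3)[of "star a * a"] abs_Re_le_cmod[of "hinner H (haction H (star a * a) \<xi>) \<xi> - hinner V (haction V (star a * a) v) v"]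
        by simp
      then show ?thesis using n(1) \<eta>(2) by (simp add: dist_real_def) argo
    qed
    moreover have "cmod (hinner H (haction H t \<eta>) \<eta> - hinner V (haction V t (haction V a v)) (haction V a v)) < \<epsilon>"
      if t: "t \<in> T" for t
    proof -
      have tA: "t \<in> A" using t T(2) by blast
      have eqs: "hinner H (haction H t (\<sigma> n)) (\<sigma> n) = hinner H (haction H (star a * t * a) \<xi>) \<xi>"
        "hinner V (haction V t (haction V a v)) (haction V a v) = hinner V (haction V (star a * t * a) v) v"
        unfolding a(2) using H.hinner_haction_haction[OF A a(1) a(1) tA \<xi>]
          V.hinner_haction_haction[OF A a(1) a(1) tA vV] by simp_all
      show ?thesis
        using n(2)[OF t] v(3)[of "star a * t * a"] t unfolding eqs
        by (metis (no_types, lifting) dist_commute dist_norm dist_triangle_half_l imageI insertI2 norm_minus_commute)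
    qed
    ultimately show "\<exists>v\<in>hspace V. \<bar>(hnorm V v)\<^sup>2 - 1\<bar> < \<epsilon> \<and>
        (\<forall>t\<in>T. cmod (hinner H (haction H t \<eta>) \<eta> - hinner V (haction V t v) v) < \<epsilon>)"
      using V.haction_closed[OF a(1) vV] by blast
  qed (auto simp: V.scaleC_mem)
qed

section \<open>Extending irreducible representations\<close>

text \<open>Extremality is asked only against functionals in \<open>D\<close> with the same
  restriction to \<open>B\<close>, and \<open>D\<close> only has to contain the states at unit
  vectors fixed by \<open>e\<close>. Schur's lemma provides the first for the two components of
  \<xi>, and commutation of \<open>P\<close> with \<open>e\<close> the second.\<close>

lemma irreducible_of_extreme_state:
  fixes U :: "('a::star_algebra, 'u::complex_vector) hrep" and H :: "('a, 'w::complex_vector) hrep"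
    and D :: "('a \<Rightarrow> complex) set"
  assumes A: "star_subalgebra A" and B: "star_subalgebra B" "B \<subseteq> A"
    and U: "irreducible_rep B U" and H: "unitary_rep A H"
    and e: "e \<in> B"
    and f: "isometric_hom B U H f" and u: "u \<in> hspace U" "hnorm U u = 1"
    and fu: "f u = \<xi>" "haction H e \<xi> = \<xi>"
    and dense: "\<And>v \<epsilon>. \<lbrakk>v \<in> hspace H; \<epsilon> > 0\<rbrakk> \<Longrightarrow> \<exists>a\<in>A. hnorm H (haction H a \<xi> - v) < \<epsilon>"
    and D: "\<And>\<eta>. \<lbrakk>\<eta> \<in> hspace H; hnorm H \<eta> = 1; haction H e \<eta> = \<eta>\<rbrakk> \<Longrightarrow> vector_state A H \<eta> \<in> D"
    and extreme: "\<And>t x y. \<lbrakk>0 < t; t < 1; x \<in> D; y \<in> D;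
      \<And>b. b \<in> B \<Longrightarrow> x b = vector_state A H \<xi> b; \<And>b. b \<in> B \<Longrightarrow> y b = vector_state A H \<xi> b;
      \<And>a. vector_state A H \<xi> a = of_real t * x a + of_real (1 - t) * y a\<rbrakk> \<Longrightarrow> x = vector_state A H \<xi>"
  shows "irreducible_rep A H"
proof -
  interpret U: unitary_rep B U using U by (simp add: irreducible_rep_def)
  interpret H: unitary_rep A H by (rule H)
  have stA: "\<And>a. a \<in> A \<Longrightarrow> star a \<in> A" and stB: "\<And>a. a \<in> B \<Longrightarrow> star a \<in> B"
    using A B by (auto simp: star_subalgebra_def)
  have BA: "b \<in> A" if "b \<in> B" for b using that B(2) by blast
  have f_in: "f x \<in> hspace H" if "x \<in> hspace U" for x using f that by (simp add: isometric_hom_def)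
  have f_add: "f (x + y) = f x + f y" if "x \<in> hspace U" "y \<in> hspace U" for x y
    using f that by (simp add: isometric_hom_def)
  have f_scale: "f (c *\<^sub>C x) = c *\<^sub>C f x" if "x \<in> hspace U" for c x
    using f that by (simp add: isometric_hom_def)
  have f_act: "f (haction U b x) = haction H b (f x)" if "b \<in> B" "x \<in> hspace U" for b x
    using f that by (simp add: isometric_hom_def)
  have f_inner: "hinner H (f x) (f y) = hinner U x y" if "x \<in> hspace U" "y \<in> hspace U" for x y
    using f that by (simp add: isometric_hom_def)
  have \<xi>: "\<xi> \<in> hspace H" using f_in[OF u(1)] fu(1) by simp
  have norm_\<xi>: "hinner H \<xi> \<xi> = 1"
    using f_inner[OF u(1) u(1)] U.hinner_self[OF u(1)] u(2) fu(1) by simp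
  have cyclic_zero: "v = 0" if v: "v \<in> hspace H" and orth: "\<And>a. a \<in> A \<Longrightarrow> hinner H (haction H a \<xi>) v = 0" for v
  proof -
    have sub: "(\<lambda>a. haction H a \<xi>) ` A \<subseteq> hspace H" using H.haction_closed \<xi> by auto
    obtain \<sigma> where \<sigma>: "\<And>n. \<sigma> n \<in> (\<lambda>a. haction H a \<xi>) ` A" "hlim H \<sigma> v"
      by (rule H.ex_hlim_of_approx[OF sub v]) (use dense[OF v] in auto)
    have "hinner H (\<sigma> n) v = 0" for n using \<sigma>(1)[of n] orth by auto
    then have "hinner H v v = 0"
      using H.hlim_inner[OF \<sigma>(2) H.hlim_const[OF v]] by (simp add: LIMSEQ_const_iff)
    then show ?thesis using H.hinner_eq_zero v by blast
  qed
  have "W = {0} \<or> W = hspace H"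
    if W: "csubspace W" "W \<subseteq> hspace H" "\<forall>a\<in>A. \<forall>w\<in>W. haction H a w \<in> W" "closedin (htopology H) W" for W
  proof -
    have "\<exists>m\<in>W. \<forall>w\<in>W. hinner H w (v - m) = 0" if "v \<in> hspace H" for v
      by (rule H.orthogonal_projection[OF W(1,4) that])
    then obtain P where P: "\<And>v. v \<in> hspace H \<Longrightarrow> P v \<in> W"
      "\<And>v w. \<lbrakk>v \<in> hspace H; w \<in> W\<rbrakk> \<Longrightarrow> hinner H w (v - P v) = 0"
      by metis
    have WH: "w \<in> hspace H" if "w \<in> W" for w using that W(2) by blast
    note PH = WH[OF P(1)]
    have P_right: "hinner H w (P v) = hinner H w v" if "v \<in> hspace H" "w \<in> W" for v w
      using P(2)[OF that] H.S.diff_right[OF that(1) PH[OF that(1)] WH[OF that(2)]] by simp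
    have P_left: "hinner H (P v) w = hinner H v w" if "v \<in> hspace H" "w \<in> W" for v w
      using P_right[OF that] H.hinner_commute[OF WH[OF that(2)] PH[OF that(1)]]
        H.hinner_commute[OF WH[OF that(2)] that(1)] by simp
    \<comment> \<open>\<open>P\<close> is only chosen through orthogonality, so its properties come
      from uniqueness; it commutes with the action because \<open>W\<close> is stable under
      \<open>star a\<close> along with \<open>a\<close>.\<close>
    have P_unique: "P v = m" if v: "v \<in> hspace H" and m: "m \<in> W" and orth: "\<And>w. w \<in> W \<Longrightarrow> hinner H w m = hinner H w v" for v m
    proof -
      have d: "P v - m \<in> W" using W(1) P(1)[OF v] m by (rule complex_vector.subspace_diff)
      have "hinner H (P v - m) (P v - m) = 0"
        using H.S.diff_right[OF PH[OF v] WH[OF m] WH[OF d]] P_right[OF v d] orth[OF d] by simp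
      then show ?thesis using H.hinner_eq_zero[OF WH[OF d]] by simp
    qed
    have P_act: "P (haction H a v) = haction H a (P v)" if a: "a \<in> A" and v: "v \<in> hspace H" for a v
    proof (rule P_unique)
      show "haction H a v \<in> hspace H" by (rule H.haction_closed[OF a v])
      show "haction H a (P v) \<in> W" using W(3) a P(1)[OF v] by blast
      fix w assume w: "w \<in> W"
      have "hinner H w (haction H a z) = hinner H (haction H (star a) w) z" if "z \<in> hspace H" for z
        using H.haction_star[OF stA[OF a] WH[OF w] that] by (simp add: star_star)
      moreover have "haction H (star a) w \<in> W" using W(3) stA[OF a] w by blast
      ultimately show "hinner H w (haction H a (P v)) = hinner H w (haction H a v)"
        using P_right[OF v] PH[OF v] v by simp
    qed
    have P_W: "P w = w" if "w \<in> W" for w by (rule P_unique) (use that WH in auto)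
    \<comment> \<open>The form of the compression of \<open>P\<close> to the image of
      \<open>U\<close>. It is invariant under \<open>B\<close> because both \<open>P\<close> and
      \<open>f\<close> commute with \<open>B\<close>.\<close>
    define s where "s x y = hinner H (P (f x)) (f y)" for x y
    have s_eq: "s x y = hinner H (P (f x)) (P (f y))" if "x \<in> hspace U" "y \<in> hspace U" for x y
      unfolding s_def using P_right[OF f_in[OF that(2)] P(1)[OF f_in[OF that(1)]]] by simp
    \<comment> \<open>Here \<open>P\<close> acts on the second argument, so linearity in the first
      is that of \<open>f\<close> and of the inner product.\<close>
    have s_left: "s x y = hinner H (f x) (P (f y))" if "x \<in> hspace U" "y \<in> hspace U" for x y
      unfolding s_eq[OF that] by (rule P_left[OF f_in[OF that(1)] P(1)[OF f_in[OF that(2)]]])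
    have pyth: "hinner H v v = hinner H (P v) (P v) + hinner H (v - P v) (v - P v)" if v: "v \<in> hspace H" for v
      using P_right[OF v P(1)[OF v]] P_left[OF v P(1)[OF v]] PH[OF v] v
      by (simp add: H.S.diff_left H.S.diff_right H.diff_mem)
    have "\<exists>c. \<forall>x\<in>hspace U. \<forall>y\<in>hspace U. s x y = c * hinner U x y"
    proof (rule Schur_form[OF B(1) U])
      show "semi_inner (hspace U) s"
      proof
        show "s y x = cnj (s x y)" if "x \<in> hspace U" "y \<in> hspace U" for x y
          unfolding s_eq[OF that] s_eq[OF that(2,1)]
          by (rule H.hinner_commute) (intro PH f_in that)+
        show "s (x + y) z = s x z + s y z" if "x \<in> hspace U" "y \<in> hspace U" "z \<in> hspace U" for x y z
          using that by (simp add: s_left U.add_mem f_add H.S.add_left f_in PH)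
        show "s (c *\<^sub>C x) y = c * s x y" if "x \<in> hspace U" "y \<in> hspace U" for c x y
          using that by (simp add: s_left U.scaleC_mem f_scale H.S.scaleC_left f_in PH)
        show "0 \<le> Re (s x x)" if "x \<in> hspace U" for x
          unfolding s_eq[OF that that] by (intro H.hinner_ge_zero PH f_in that)
      qed (rule U.hspace_subspace)
      show "Re (s x x) \<le> Re (hinner U x x)" if x: "x \<in> hspace U" for x
        unfolding s_eq[OF x x] f_inner[OF x x, symmetric] pyth[OF f_in[OF x]]
        using H.hinner_ge_zero[OF H.diff_mem[OF f_in[OF x] PH[OF f_in[OF x]]]] by simp
      show "s (haction U b x) y = s x (haction U (star b) y)"
        if "b \<in> B" "x \<in> hspace U" "y \<in> hspace U" for b x y
        using that by (simp add: s_def f_act stB P_act BA f_in H.haction_star PH)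
    qed
    then obtain c where c: "\<And>x y. \<lbrakk>x \<in> hspace U; y \<in> hspace U\<rbrakk> \<Longrightarrow> s x y = c * hinner U x y"
      by blast
    define p where "p = P \<xi>"
    define q where "q = \<xi> - p"
    have p: "p \<in> W" "p \<in> hspace H" unfolding p_def using P(1)[OF \<xi>] PH[OF \<xi>] by simp_all
    have q: "q \<in> hspace H" unfolding q_def by (rule H.diff_mem[OF \<xi> p(2)])
    have act_p: "haction H a p = P (haction H a \<xi>)" if "a \<in> A" for a
      unfolding p_def by (rule P_act[OF that \<xi>, symmetric])
    have pp: "hinner H (haction H a p) p = hinner H (haction H a p) \<xi>" if "a \<in> A" for a
      unfolding p_def by (rule P_right[OF \<xi>]) (use W(3) that P(1)[OF \<xi>] in blast)
    have qq: "hinner H (haction H a q) q = hinner H (haction H a \<xi>) \<xi> - hinner H (haction H a p) p"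
      if a: "a \<in> A" for a
    proof -
      have "hinner H (haction H a \<xi>) p = hinner H (haction H a p) p"
        unfolding act_p[OF a] by (rule P_left[symmetric]) (use H.haction_closed[OF a \<xi>] p(1) in auto)
      then show ?thesis
        using pp[OF a] a \<xi> p(2)
        by (simp add: q_def H.haction_diff_right H.S.diff_left H.S.diff_right H.haction_closed H.diff_mem)
    qed
    define \<alpha> where "\<alpha> = Re (hinner H p p)"
    have pp_\<alpha>: "hinner H p p = of_real \<alpha>"
      using H.hinner_self[OF p(2)] by (simp add: \<alpha>_def)
    \<comment> \<open>Evaluation at the unit vector \<open>u\<close> identifies the scalar of
      Schur's lemma as |P \<xi>|^2.\<close>
    have c_eq: "c = of_real \<alpha>"
      using c[OF u(1) u(1)] s_eq[OF u(1) u(1)] U.hinner_self[OF u(1)] u(2) pp_\<alpha> by (simp add: fu(1) p_def)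
    have p_B: "hinner H (haction H b p) p = of_real \<alpha> * hinner H (haction H b \<xi>) \<xi>" if b: "b \<in> B" for b
    proof -
      have bu: "haction U b u \<in> hspace U" by (rule U.haction_closed[OF b u(1)])
      have "hinner H (haction H b p) p = s (haction U b u) u"
        using pp[OF BA[OF b]] act_p[OF BA[OF b]] by (simp add: s_def f_act[OF b u(1)] fu(1))
      also have "\<dots> = of_real \<alpha> * hinner H (haction H b \<xi>) \<xi>"
        unfolding c[OF bu u(1)] c_eq f_inner[OF bu u(1), symmetric] f_act[OF b u(1)] fu(1) ..
      finally show ?thesis .
    qed
    have qq_\<alpha>: "hinner H q q = of_real (1 - \<alpha>)"
      using pyth[OF \<xi>] norm_\<xi> pp_\<alpha> by (simp add: q_def flip: p_def) (simp add: algebra_simps)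
    have \<alpha>: "0 \<le> \<alpha>" "\<alpha> \<le> 1"
      using H.hinner_ge_zero[OF p(2)] H.hinner_ge_zero[OF q] qq_\<alpha> by (simp_all add: \<alpha>_def)
    have all: "W = hspace H" if "\<xi> \<in> W"
    proof
      show "W \<subseteq> hspace H" by (rule W(2))
      show "hspace H \<subseteq> W"
      proof
        fix v assume v: "v \<in> hspace H"
        have sub: "(\<lambda>a. haction H a \<xi>) ` A \<subseteq> hspace H" using H.haction_closed \<xi> by auto
        obtain \<sigma> where \<sigma>: "\<And>n. \<sigma> n \<in> (\<lambda>a. haction H a \<xi>) ` A" "hlim H \<sigma> v"
          by (rule H.ex_hlim_of_approx[OF sub v]) (use dense[OF v] in auto)
        have "\<sigma> n \<in> W" for n using \<sigma>(1)[of n] W(3) that by auto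
        then show "v \<in> W" by (rule H.closedin_hlim[OF W(4) _ \<sigma>(2)])
      qed
    qed
    \<comment> \<open>The cases are: \<xi> orthogonal to \<open>W\<close>, \<xi> in
      \<open>W\<close>, and a proper splitting, in which the state of \<xi> is the convex
      combination of the normalized states of \<open>p\<close> and \<open>q\<close> with weights
      \<alpha> and 1 - \<alpha>.\<close>
    consider "\<alpha> = 0" | "\<alpha> = 1" | "0 < \<alpha>" "\<alpha> < 1" using \<alpha> by linarith
    then show ?thesis
    proof cases
      case 1
      then have "p = 0" using pp_\<alpha> H.hinner_eq_zero[OF p(2)] by simp
      have "w = 0" if w: "w \<in> W" for w
      proof (rule cyclic_zero[OF WH[OF w]])
        fix a assume a: "a \<in> A"
        have "hinner H (haction H a \<xi>) w = hinner H (haction H a p) w"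
          unfolding act_p[OF a] by (rule P_left[symmetric, OF H.haction_closed[OF a \<xi>] w])
        then show "hinner H (haction H a \<xi>) w = 0"
          using \<open>p = 0\<close> H.haction_zero_right[OF a] H.hinner_zero_left[OF WH[OF w]] by simp
      qed
      then show ?thesis using complex_vector.subspace_0[OF W(1)] by auto
    next
      case 2
      then have "q = 0" using qq_\<alpha> H.hinner_eq_zero[OF q] by simp
      then have "\<xi> \<in> W" using p(1) by (simp add: q_def)
      then show ?thesis using all by blast
    next
      case 3
      have state: "vector_state A H (of_real (1 / sqrt \<beta>) *\<^sub>C v) \<in> D"
          "vector_state A H (of_real (1 / sqrt \<beta>) *\<^sub>C v)
            = (\<lambda>a. if a \<in> A then hinner H (haction H a v) v / of_real \<beta> else 0)"
        if v: "v \<in> hspace H" and \<beta>: "\<beta> > 0" "hinner H v v = of_real \<beta>" and ev: "haction H e v = v" for v \<beta>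
      proof -
        have n: "hnorm H v = sqrt \<beta>" using \<beta>(2) by (simp add: hnorm_def)
        show "vector_state A H (of_real (1 / sqrt \<beta>) *\<^sub>C v) \<in> D"
        proof (rule D)
          show "hnorm H (of_real (1 / sqrt \<beta>) *\<^sub>C v) = 1"
            using H.S.seminorm_scaleC[OF v, of "of_real (1 / sqrt \<beta>)"] \<beta>(1) n
            by (simp add: norm_divide)
        qed (use v ev e BA in \<open>simp_all add: H.scaleC_mem H.haction_scaleC_right\<close>)
        have "complex_of_real (1 / sqrt \<beta>) * (of_real (1 / sqrt \<beta>) * z) = z / of_real \<beta>" for z
        proof -
          have "complex_of_real (1 / sqrt \<beta>) * of_real (1 / sqrt \<beta>) = of_real (1 / \<beta>)"
            unfolding of_real_mult[symmetric] using \<beta>(1) by (simp add: real_sqrt_mult_self)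
          then show ?thesis by (simp add: mult.assoc[symmetric])
        qed
        then show "vector_state A H (of_real (1 / sqrt \<beta>) *\<^sub>C v)
            = (\<lambda>a. if a \<in> A then hinner H (haction H a v) v / of_real \<beta> else 0)"
          using v by (auto simp: vector_state_def fun_eq_iff H.haction_scaleC_right H.S.scaleC_left
              H.S.scaleC_right H.haction_closed H.scaleC_mem)
      qed
      have ep: "haction H e p = p" using act_p[OF BA[OF e]] fu(2) by (simp add: p_def)
      have eq: "haction H e q = q" using ep fu(2) BA[OF e] \<xi> p(2) by (simp add: q_def H.haction_diff_right)
      note sp = state[OF p(2) 3(1) pp_\<alpha> ep]
      have "1 - \<alpha> > 0" using 3(2) by simp
      note sq = state[OF q this qq_\<alpha> eq]
      have "vector_state A H (of_real (1 / sqrt \<alpha>) *\<^sub>C p) = vector_state A H \<xi>"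
      proof (rule extreme[OF 3 sp(1) sq(1)])
        show "vector_state A H (of_real (1 / sqrt \<alpha>) *\<^sub>C p) b = vector_state A H \<xi> b" if "b \<in> B" for b
          unfolding sp(2) using that BA[OF that] p_B[OF that] 3(1) by (simp add: vector_state_def)
        show "vector_state A H (of_real (1 / sqrt (1 - \<alpha>)) *\<^sub>C q) b = vector_state A H \<xi> b" if "b \<in> B" for b
        proof -
          have "complex_of_real (1 - \<alpha>) \<noteq> 0" using 3(2) by (simp only: of_real_eq_0_iff)
          moreover have "hinner H (haction H b q) q = of_real (1 - \<alpha>) * hinner H (haction H b \<xi>) \<xi>"
            unfolding qq[OF BA[OF that]] p_B[OF that] by (simp add: algebra_simps)
          ultimately show ?thesis
            unfolding sq(2) using BA[OF that] by (simp add: vector_state_def del: of_real_diff)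
        qed
        show "vector_state A H \<xi> a = of_real \<alpha> * vector_state A H (of_real (1 / sqrt \<alpha>) *\<^sub>C p) a +
            of_real (1 - \<alpha>) * vector_state A H (of_real (1 / sqrt (1 - \<alpha>)) *\<^sub>C q) a" for a
        proof (cases "a \<in> A")
          case True
          have "complex_of_real \<alpha> \<noteq> 0" "complex_of_real (1 - \<alpha>) \<noteq> 0"
            using 3 by (simp_all only: of_real_eq_0_iff)
          then show ?thesis
            unfolding sp(2) sq(2) using True qq[OF True] by (simp add: vector_state_def del: of_real_diff)
        qed (simp add: vector_state_def)
      qed
      note eq = fun_cong[OF this[unfolded sp(2)]]
      have state_eq: "hinner H (haction H a p) p = of_real \<alpha> * hinner H (haction H a \<xi>) \<xi>" if "a \<in> A" for a
        using eq[of a] that 3(1) by (simp add: vector_state_def field_simps)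
      \<comment> \<open>Equal states give <a \<xi>, p> = <a p, p> = \<alpha> <a \<xi>, \<xi>> for
        all \<open>a\<close>, hence p = \<alpha> \<xi> by cyclicity; as \<alpha> > 0, \<xi> itself
        lies in \<open>W\<close>.\<close>
      have "p - of_real \<alpha> *\<^sub>C \<xi> = 0"
      proof (rule cyclic_zero)
        show "p - of_real \<alpha> *\<^sub>C \<xi> \<in> hspace H" by (intro H.diff_mem p H.scaleC_mem \<xi>)
        fix a assume a: "a \<in> A"
        have "hinner H (haction H a \<xi>) p = hinner H (haction H a p) p"
          unfolding act_p[OF a] by (rule P_left[symmetric]) (use H.haction_closed[OF a \<xi>] p(1) in auto)
        then show "hinner H (haction H a \<xi>) (p - of_real \<alpha> *\<^sub>C \<xi>) = 0"
          using state_eq[OF a] H.haction_closed[OF a \<xi>] p(2) \<xi>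
          by (simp add: H.S.diff_right H.S.scaleC_right H.scaleC_mem)
      qed
      then have "p = of_real \<alpha> *\<^sub>C \<xi>" by simp
      then have "of_real (1 / \<alpha>) *\<^sub>C p = \<xi>"
        using 3(1) by (simp add: scaleC_scaleC scaleC_one)
      then have "\<xi> \<in> W" using complex_vector.subspace_scale[OF W(1) p(1)] by metis
      then show ?thesis using all by blast
    qed
  qed
  moreover have "hspace H \<noteq> {0}"
  proof
    assume "hspace H = {0}"
    then have "\<xi> = 0" using \<xi> by blast
    then show False using norm_\<xi> H.hinner_zero_left[OF H.zero_mem] by simp
  qed
  ultimately show ?thesis using H by (auto simp: irreducible_rep_def)
qed

section \<open>Pointwise limits of vector states\<close>

lemma closure_forall:
  assumes "f \<in> closure S" "closed {f. P f}" "\<And>g. g \<in> S \<Longrightarrow> P g"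
  shows "P f"
  using closure_minimal[of S "{f. P f}"] assms by blast

context unitary_rep
begin

text \<open>The coefficient of \<open>a\<close> at a unit vector is bounded by an operator bound
  \<open>K a\<close> independent of the vector, and the states vanish outside \<open>A\<close>; the
  closure is therefore a closed subset of a product of discs.\<close>

lemma compact_closure_vector_states:
  assumes M: "M \<subseteq> hspace V"
  shows "compact (closure {vector_state A V v | v. v \<in> M \<and> hnorm V v = 1})"
proof -
  have "\<forall>a\<in>A. \<exists>K. \<forall>v\<in>hspace V. hnorm V (haction V a v) \<le> K * hnorm V v"
    using haction_bounded by blast
  then obtain K where K: "\<And>a v. \<lbrakk>a \<in> A; v \<in> hspace V\<rbrakk> \<Longrightarrow> hnorm V (haction V a v) \<le> K a * hnorm V v"
    by metis
  let ?C = "{f. \<forall>a. cmod (f a) \<le> (if a \<in> A then K a else 0)}"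
  have "closed ?C"
    by (intro closed_Collect_all closed_Collect_le continuous_intros continuous_on_product_coordinates)
  moreover have "{vector_state A V v | v. v \<in> M \<and> hnorm V v = 1} \<subseteq> ?C"
  proof clarify
    fix v a assume v: "v \<in> M" "hnorm V v = 1"
    then have vV: "v \<in> hspace V" using M by blast
    show "cmod (vector_state A V v a) \<le> (if a \<in> A then K a else 0)"
      using Cauchy_Schwarz[OF haction_closed[OF _ vV] vV, of a] K[OF _ vV, of a] v(2)
      by (auto simp: vector_state_def)
  qed
  ultimately have "closure {vector_state A V v | v. v \<in> M \<and> hnorm V v = 1} \<subseteq> ?C"
    by (intro closure_minimal)
  then have "?C \<inter> closure {vector_state A V v | v. v \<in> M \<and> hnorm V v = 1}
      = closure {vector_state A V v | v. v \<in> M \<and> hnorm V v = 1}"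
    by (rule Int_absorb1)
  moreover have "compact (?C \<inter> closure {vector_state A V v | v. v \<in> M \<and> hnorm V v = 1})"
    by (rule compact_Int_closed[OF compact_Pi_cball closed_closure])
  ultimately show ?thesis by simp
qed

text \<open>Each hypothesis of the GNS construction reduces to closed conditions on finitely many
  values of the functional, and these hold for vector states at vectors fixed by
  \<open>e\<close>.\<close>

lemma GNS_limit_state:
  assumes A: "star_subalgebra A" and e: "e \<in> A" "e * e = e" "star e = e"
    and \<psi>: "\<psi> \<in> closure {vector_state A V v | v. v \<in> {v \<in> hspace V. haction V e v = v} \<and> hnorm V v = 1}"
  obtains H :: "'a universal_rep" and \<xi> where "unitary_rep A H" "\<xi> \<in> hspace H" "haction H e \<xi> = \<xi>"
    "\<And>a. a \<in> A \<Longrightarrow> \<psi> a = hinner H (haction H a \<xi>) \<xi>"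
    "\<And>v \<epsilon>. \<lbrakk>v \<in> hspace H; \<epsilon> > 0\<rbrakk> \<Longrightarrow> \<exists>a\<in>A. hnorm H (haction H a \<xi> - v) < \<epsilon>"
proof -
  have A_cl: "\<And>a b. \<lbrakk>a \<in> A; b \<in> A\<rbrakk> \<Longrightarrow> a * b \<in> A" "\<And>a. a \<in> A \<Longrightarrow> star a \<in> A"
    "\<And>a b. \<lbrakk>a \<in> A; b \<in> A\<rbrakk> \<Longrightarrow> a + b \<in> A" "\<And>c a. a \<in> A \<Longrightarrow> c *\<^sub>C a \<in> A"
    using A by (auto simp: star_subalgebra_def complex_vector.subspace_add complex_vector.subspace_scale)
  note coord = continuous_on_product_coordinates
  have lim: "P \<psi>" if "closed {f. P f}"
    and "\<And>v. \<lbrakk>v \<in> hspace V; haction V e v = v\<rbrakk> \<Longrightarrow> P (vector_state A V v)" for P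
    by (rule closure_forall[OF \<psi> that(1)]) (use that(2) in blast)
  show thesis
  proof (rule GNS[OF A e(1,3), of \<psi>])
    show "\<psi> (a + b) = \<psi> a + \<psi> b" if "a \<in> A" "b \<in> A" for a b
      by (rule lim, intro closed_Collect_eq continuous_intros coord)
        (use that in \<open>simp add: vector_state_def A_cl haction_add_left S.add_left haction_closed\<close>)
    show "\<psi> (c *\<^sub>C a) = c * \<psi> a" if "a \<in> A" for c a
      by (rule lim, intro closed_Collect_eq continuous_intros coord)
        (use that in \<open>simp add: vector_state_def A_cl haction_scaleC_left S.scaleC_left haction_closed\<close>)
    show "\<psi> (star a) = cnj (\<psi> a)" if a: "a \<in> A" for a
    proof (rule lim)
      show "closed {f. f (star a) = cnj (f a)}" by (intro closed_Collect_eq continuous_intros coord)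
      fix v assume v: "v \<in> hspace V"
      have "hinner V (haction V (star a) v) v = hinner V v (haction V a v)"
        using haction_star[OF A_cl(2)[OF a] v v] by (simp add: star_star)
      also have "\<dots> = cnj (hinner V (haction V a v) v)"
        by (rule hinner_commute[OF haction_closed[OF a v] v])
      finally show "vector_state A V v (star a) = cnj (vector_state A V v a)"
        using a A_cl by (simp add: vector_state_def)
    qed
    have vs: "vector_state A V v (star a * a) = hinner V (haction V a v) (haction V a v)"
      if "a \<in> A" "v \<in> hspace V" for a v
      using hinner_star_mult[OF A that(1) that(1) that(2)] that(1) by (simp add: vector_state_def A_cl)
    show "0 \<le> Re (\<psi> (star a * a))" if "a \<in> A" for a
      by (rule lim, intro closed_Collect_le continuous_intros coord)
        (use that in \<open>simp add: vs hinner_ge_zero haction_closed\<close>)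
    show "\<exists>K. \<forall>x\<in>A. Re (\<psi> (star (a * x) * (a * x))) \<le> K * Re (\<psi> (star x * x))" if a: "a \<in> A" for a
    proof -
      obtain K where K: "\<And>v. v \<in> hspace V \<Longrightarrow> hnorm V (haction V a v) \<le> K * hnorm V v"
        using haction_bounded[OF a] by blast
      \<comment> \<open>The constant is the square of an operator bound of \<open>a\<close> on
        \<open>V\<close>, the same for all vector states; this uniformity lets the estimate survive
        the limit.\<close>
      have "Re (\<psi> (star (a * x) * (a * x))) \<le> K\<^sup>2 * Re (\<psi> (star x * x))" if x: "x \<in> A" for x
      proof (rule lim)
        show "closed {f. Re (f (star (a * x) * (a * x))) \<le> K\<^sup>2 * Re (f (star x * x))}"
          by (intro closed_Collect_le continuous_intros coord)
        fix v assume v: "v \<in> hspace V"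
        have xv: "haction V x v \<in> hspace V" by (rule haction_closed[OF x v])
        have "(hnorm V (haction V a (haction V x v)))\<^sup>2 \<le> (K * hnorm V (haction V x v))\<^sup>2"
          by (rule power_mono[OF K[OF xv]]) (rule hnorm_ge_zero[OF haction_closed[OF a xv]])
        then show "Re (vector_state A V v (star (a * x) * (a * x))) \<le> K\<^sup>2 * Re (vector_state A V v (star x * x))"
          unfolding vs[OF A_cl(1)[OF a x] v] vs[OF x v] haction_mult[OF a x v]
            hinner_self[OF xv] hinner_self[OF haction_closed[OF a xv]]
          by (simp add: power_mult_distrib flip: of_real_power)
      qed
      then show ?thesis by blast
    qed
    show "\<psi> (a * e) = \<psi> a" if "a \<in> A" for a
      by (rule lim, intro closed_Collect_eq continuous_intros coord)
        (use that e(1) in \<open>simp add: vector_state_def A_cl haction_mult\<close>)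
  qed (rule that)
qed

end

section \<open>The irreducible representation of \<open>A\<close> that contains
  \<open>U\<close>\<close>

lemma ex_irreducible_extension:
  fixes A B :: "'a::star_algebra set" and V' :: "('a, 'v::complex_vector) hrep"
    and U :: "('a, 'u::complex_vector) hrep"
  assumes A: "idempotented_star_algebra A" and B: "idempotented_star_algebra B" and BA: "B \<subseteq> A"
    and V': "unitary_rep A V'" and U: "irreducible_rep B U"
    and UV': "weakly_contained B U (closure_rep B V')"
  shows "\<exists>V :: 'a universal_rep.
    irreducible_rep A V \<and> weakly_contained A V V' \<and> subrep B U (closure_rep B V)"
proof -
  interpret V': unitary_rep A V' by (rule V')
  interpret U: unitary_rep B U using U by (simp add: irreducible_rep_def)
  have As: "star_subalgebra A" and Bs: "star_subalgebra B"
    using A B by (simp_all add: idempotented_star_algebra_def)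
  obtain v0 where v0: "v0 \<in> hspace U" "v0 \<noteq> 0"
    using U U.zero_mem by (auto simp: irreducible_rep_def)
  then have "hnorm U v0 > 0" using U.hnorm_eq_zero_iff U.hnorm_ge_zero by force
  moreover have "v0 \<in> htopology U closure_of act_span B U" using v0(1) U.act_span_dense by simp
  \<comment> \<open>A distance from \<open>v0\<close> smaller than the norm of \<open>v0\<close>
    guarantees e v0 \<noteq> 0; normalizing it gives a unit vector fixed by
    \<open>e\<close>.\<close>
  ultimately obtain e where e: "e \<in> B" "e * e = e" "star e = e" "hnorm U (haction U e v0 - v0) < hnorm U v0"
    using U.ex_projection_near[OF B order_refl, of "{}" v0 "hnorm U v0"] by auto
  have eA: "e \<in> A" using e(1) BA by blast
  define u0 where "u0 = haction U e v0"
  have u0: "u0 \<in> hspace U" "haction U e u0 = u0"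
    using U.haction_closed[OF e(1) v0(1)] U.haction_mult[OF e(1) e(1) v0(1)] e(2) by (simp_all add: u0_def)
  have "u0 \<noteq> 0"
    using e(4) U.hnorm_minus_commute[OF U.zero_mem v0(1)] by (auto simp: u0_def)
  then have n0: "hnorm U u0 > 0" using U.hnorm_eq_zero_iff[OF u0(1)] U.hnorm_ge_zero[OF u0(1)] by simp
  define u where "u = of_real (1 / hnorm U u0) *\<^sub>C u0"
  have u: "u \<in> hspace U" "haction U e u = u" "hnorm U u = 1"
    using U.S.seminorm_scaleC[OF u0(1), of "of_real (1 / hnorm U u0)"] n0 u0 e(1)
    by (simp_all add: u_def U.scaleC_mem U.haction_scaleC_right norm_divide)
  have "u \<noteq> 0" using u(3) U.S.seminorm_zero by auto
  define \<phi> where "\<phi> b = (if b \<in> B then hinner U (haction U b u) u else 0)" for b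
  define M where "M = {v \<in> hspace V'. haction V' e v = v}"
  have M: "M \<subseteq> hspace V'" by (auto simp: M_def)
  have \<phi>_e: "\<phi> e = 1"
    using u e(1) U.hinner_self[OF u(1)] by (simp add: \<phi>_def)
  have \<phi>_compress: "\<phi> (e * b * e) = \<phi> b" if b: "b \<in> B" for b
  proof -
    have "e * b * e \<in> B" using Bs e(1) b by (simp add: star_subalgebra_def)
    moreover have "hinner U (haction U (e * b * e) u) u = hinner U (haction U b u) u"
      using U.hinner_haction_haction[OF Bs e(1) e(1) b u(1)] by (simp add: e(3) u(2))
    ultimately show ?thesis using b by (simp add: \<phi>_def)
  qed
  have closure_V': "hspace (closure_rep B V') \<subseteq> hspace V'"
    using closure_of_subset_topspace[of "htopology V'"] by (simp add: closure_rep_def)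
  \<comment> \<open>The approximating vectors are moved into eV', so that the value 1 at
    \<open>e\<close> is shared by all the approximating states and by their limits.\<close>
  have approx_\<phi>: "approximable B V' M \<phi>"
    unfolding M_def
  proof (rule V'.approximable_compress[OF Bs BA e(1-3) \<phi>_e \<phi>_compress closure_V'])
    have "approximable B (closure_rep B V') (hspace (closure_rep B V')) (\<lambda>a. hinner U (haction U a u) u)"
      using UV' u(1,3) by (simp add: weakly_contained_iff_approximable)
    then show "approximable B V' (hspace (closure_rep B V')) \<phi>"
      unfolding approximable_def closure_rep_def hnorm_def \<phi>_def by (simp add: subset_iff)
  qed
  define D where "D = closure {vector_state A V' v | v. v \<in> M \<and> hnorm V' v = 1}"
  have "compact D" unfolding D_def by (rule V'.compact_closure_vector_states[OF M])
  note coord = continuous_on_product_coordinates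
  define D\<phi> where "D\<phi> = D \<inter> {f. \<forall>b. b \<in> B \<longrightarrow> f b = \<phi> b}"
  have "compact D\<phi>"
    unfolding D\<phi>_def
    by (intro compact_Int_closed \<open>compact D\<close> closed_Collect_all closed_Collect_imp open_Collect_const
        closed_Collect_eq continuous_intros coord)
  moreover have "D\<phi> \<noteq> {}"
  proof -
    define r where "r f = (\<lambda>b. if b \<in> B then f b else 0)" for f :: "'a \<Rightarrow> complex"
    have "continuous_on UNIV (\<lambda>f. r f b)" for b
      by (cases "b \<in> B") (simp_all add: r_def coord)
    then have "continuous_on UNIV r" by (rule continuous_on_coordinatewise_then_product)
    then have "compact (r ` D)"
      using \<open>compact D\<close> compact_continuous_image continuous_on_subset by blast
    then have closed: "closed (r ` D)" by (rule compact_imp_closed_fun)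
    have "\<phi> \<in> closure {vector_state B V' v | v. v \<in> M \<and> hnorm V' v = 1}"
      by (rule approximable_in_closure[OF approx_\<phi>]) (simp add: \<phi>_def)
    also have "\<dots> \<subseteq> r ` D"
    proof (rule closure_minimal[OF _ closed])
      have "vector_state B V' v = r (vector_state A V' v)" for v
        by (rule ext) (use BA in \<open>auto simp: vector_state_def r_def\<close>)
      moreover have "vector_state A V' v \<in> D" if "v \<in> M" "hnorm V' v = 1" for v
        unfolding D_def by (rule subsetD[OF closure_subset]) (use that in blast)
      ultimately show "{vector_state B V' v | v. v \<in> M \<and> hnorm V' v = 1} \<subseteq> r ` D" by auto
    qed
    finally obtain f where f: "f \<in> D" "\<phi> = r f" by blast
    then have "f b = \<phi> b" if "b \<in> B" for b using that by (simp add: r_def)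
    then show ?thesis using f(1) by (auto simp: D\<phi>_def)
  qed
  ultimately obtain \<psi> where \<psi>: "\<psi> \<in> D\<phi>" and extreme: "\<And>t x y. \<lbrakk>0 < t; t < 1; x \<in> D\<phi>; y \<in> D\<phi>;
      \<And>i. \<psi> i = of_real t * x i + of_real (1 - t) * y i\<rbrakk> \<Longrightarrow> x = \<psi> \<and> y = \<psi>"
    using compact_extreme_point[of D\<phi>] by metis
  have \<psi>_D: "\<psi> \<in> D" and \<psi>_B: "\<And>b. b \<in> B \<Longrightarrow> \<psi> b = \<phi> b" using \<psi> by (auto simp: D\<phi>_def)
  obtain H :: "'a universal_rep" and \<xi> where H: "unitary_rep A H" and \<xi>: "\<xi> \<in> hspace H" "haction H e \<xi> = \<xi>"
    and \<psi>_eq: "\<And>a. a \<in> A \<Longrightarrow> \<psi> a = hinner H (haction H a \<xi>) \<xi>"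
    and dense: "\<And>v \<epsilon>. \<lbrakk>v \<in> hspace H; \<epsilon> > 0\<rbrakk> \<Longrightarrow> \<exists>a\<in>A. hnorm H (haction H a \<xi> - v) < \<epsilon>"
    using V'.GNS_limit_state[OF As eA e(2,3) \<psi>_D[unfolded D_def M_def]] by metis
  interpret H: unitary_rep A H by (rule H)
  have "\<psi> a = 0" if "a \<notin> A" for a
  proof (rule closure_forall[OF \<psi>_D[unfolded D_def], of "\<lambda>f. f a = 0"])
    show "closed {f :: 'a \<Rightarrow> complex. f a = 0}"
      by (intro closed_Collect_eq continuous_intros coord)
  qed (use that in \<open>auto simp: vector_state_def\<close>)
  then have \<psi>_state: "vector_state A H \<xi> = \<psi>"
    using \<psi>_eq by (auto simp: vector_state_def fun_eq_iff)
  have "approximable A V' M \<psi>" using \<psi>_D unfolding D_def by (rule closure_approximable)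
  then have "approximable A V' M (\<lambda>a. hinner H (haction H a \<xi>) \<xi>)"
    unfolding approximable_def using \<psi>_eq by (simp add: subset_iff)
  then have HV': "weakly_contained A H V'"
    by (rule weakly_contained_cyclic[OF As H V' M \<xi>(1) _ dense])
  have \<phi>_eq: "hinner U (haction U b u) u = hinner H (haction H b \<xi>) \<xi>" if "b \<in> B" for b
    using \<psi>_B[OF that] \<psi>_eq[of b] that BA by (auto simp: \<phi>_def)
  note denseU = irreducible_rep_cyclic[OF Bs U u(1) \<open>u \<noteq> 0\<close> e(1) u(2)]
  obtain f where f: "isometric_hom B U H f" and fb: "\<And>b. b \<in> B \<Longrightarrow> f (haction U b u) = haction H b \<xi>"
    using cyclic_isometry[OF As Bs BA U.unitary_rep_axioms H u(1) \<xi>(1) \<phi>_eq denseU] by blast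
  have fu: "f u = \<xi>" using fb[OF e(1)] u(2) \<xi>(2) by simp
  \<comment> \<open>The states of the GNS space re-enter \<open>D\<close>: weak containment gives
    approximation in V', and compression by \<open>e\<close> puts the approximating vectors back
    into \<open>M\<close>.\<close>
  have states_D: "vector_state A H \<eta> \<in> D" if \<eta>: "\<eta> \<in> hspace H" "hnorm H \<eta> = 1" "haction H e \<eta> = \<eta>" for \<eta>
    unfolding D_def
  proof (rule approximable_in_closure)
    have "approximable A V' M (\<lambda>a. hinner H (haction H a \<eta>) \<eta>)"
      unfolding M_def
    proof (rule V'.approximable_compress[OF As order_refl eA e(2,3) _ _ order_refl])
      show "hinner H (haction H e \<eta>) \<eta> = 1" using H.hinner_self[OF \<eta>(1)] \<eta>(2,3) by simp
      show "hinner H (haction H (e * a * e) \<eta>) \<eta> = hinner H (haction H a \<eta>) \<eta>" if "a \<in> A" for a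
        using H.hinner_haction_haction[OF As eA eA that \<eta>(1)] by (simp add: e(3) \<eta>(3))
      show "approximable A V' (hspace V') (\<lambda>a. hinner H (haction H a \<eta>) \<eta>)"
        using HV' \<eta> by (simp add: weakly_contained_iff_approximable)
    qed
    then show "approximable A V' M (vector_state A H \<eta>)"
      unfolding approximable_def vector_state_def by (simp add: subset_iff)
  qed (simp add: vector_state_def)
  have irr: "irreducible_rep A H"
  proof (rule irreducible_of_extreme_state[OF As Bs BA U H e(1) f u(1,3) fu \<xi>(2) dense states_D])
    fix t x y
    assume t: "0 < t" "t < 1" and xy: "x \<in> D" "y \<in> D"
      "\<And>b. b \<in> B \<Longrightarrow> x b = vector_state A H \<xi> b" "\<And>b. b \<in> B \<Longrightarrow> y b = vector_state A H \<xi> b"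
      "\<And>a. vector_state A H \<xi> a = of_real t * x a + of_real (1 - t) * y a"
    have "x \<in> D\<phi>" "y \<in> D\<phi>" by (simp_all add: D\<phi>_def xy(1-4) \<psi>_state \<psi>_B)
    from extreme[OF t this xy(5)[unfolded \<psi>_state]] show "x = vector_state A H \<xi>"
      by (simp add: \<psi>_state)
  qed
  have f_in: "f x \<in> hspace H" if "x \<in> hspace U" for x using f that by (simp add: isometric_hom_def)
  have f_diff: "f (x - y) = f x - f y" if "x \<in> hspace U" "y \<in> hspace U" for x y
  proof -
    have "f (x - y + y) = f (x - y) + f y"
      using f U.diff_mem[OF that] that(2) unfolding isometric_hom_def by blast
    then show ?thesis by simp
  qed
  have f_norm: "hnorm H (f x) = hnorm U x" if "x \<in> hspace U" for x
    using f that by (simp add: isometric_hom_def hnorm_def)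
  \<comment> \<open>The vectors b u are dense in \<open>U\<close> and are mapped to b \<xi>, which
    lies in B H; the isometry carries density over to the closure.\<close>
  have "f x \<in> htopology H closure_of act_span B H" if x: "x \<in> hspace U" for x
    unfolding H.closure_of_iff_approx[OF H.act_span_subset[OF BA]]
  proof (intro conjI allI impI)
    show "f x \<in> hspace H" by (rule f_in[OF x])
    fix \<epsilon> :: real assume "\<epsilon> > 0"
    then obtain b where b: "b \<in> B" "hnorm U (haction U b u - x) < \<epsilon>" using denseU[OF x] by blast
    have bu: "haction U b u \<in> hspace U" by (rule U.haction_closed[OF b(1) u(1)])
    have "hnorm H (haction H b \<xi> - f x) < \<epsilon>"
      using b(2) f_norm[OF U.diff_mem[OF bu x]] by (simp add: f_diff[OF bu x] fb[OF b(1)])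
    then show "\<exists>y\<in>act_span B H. hnorm H (y - f x) < \<epsilon>"
      using H.haction_in_act_span[OF b(1) \<xi>(1)] by blast
  qed
  then have "isometric_hom B U (closure_rep B H) f"
    using f by (simp add: isometric_hom_def closure_rep_def)
  moreover have "inj_on f (hspace U)"
  proof (rule inj_onI)
    fix x y assume xy: "x \<in> hspace U" "y \<in> hspace U" "f x = f y"
    have "hnorm U (x - y) = 0"
      using f_norm[OF U.diff_mem[OF xy(1,2)]] f_diff[OF xy(1,2)] xy(3) H.S.seminorm_zero by simp
    then show "x = y" using U.hnorm_eq_zero_iff[OF U.diff_mem[OF xy(1,2)]] by simp
  qed
  ultimately have "subrep B U (closure_rep B H)" by (auto simp: subrep_def)
  then show ?thesis using irr HV' by blast
qed

section \<open>Restriction of spectra\<close>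

text \<open>Approximations can be composed, but the vectors obtained in V' may lie outside the
  closure of B V'. They are moved there by a projection of \<open>B\<close> that absorbs
  \<open>T\<close> and almost fixes \<open>u\<close>; the latter keeps their norms close to
  1.\<close>

lemma weakly_contained_restriction:
  fixes A B :: "'a::star_algebra set" and V :: "('a, 'v::complex_vector) hrep"
    and V' :: "('a, 'w::complex_vector) hrep" and U :: "('a, 'u::complex_vector) hrep"
  assumes B: "idempotented_star_algebra B" and BA: "B \<subseteq> A"
    and V': "unitary_rep A V'" and V: "unitary_rep A V" and U: "unitary_rep B U"
    and VV': "weakly_contained A V V'" and UV: "weakly_contained B U (closure_rep B V)"
  shows "weakly_contained B U (closure_rep B V')"
  unfolding weakly_contained_iff_approximable
proof (intro ballI impI)
  interpret V': unitary_rep A V' by (rule V')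
  interpret V: unitary_rep A V by (rule V)
  interpret U: unitary_rep B U by (rule U)
  have Bs: "star_subalgebra B" using B by (simp add: idempotented_star_algebra_def)
  fix u assume u: "u \<in> hspace U" "hnorm U u = 1"
  let ?W = "htopology V' closure_of act_span B V'"
  have sub: "act_span B V' \<subseteq> hspace V'" by (rule V'.act_span_subset[OF BA])
  have "approximable B V' ?W (\<lambda>a. hinner U (haction U a u) u)"
  proof (rule V'.approximable_normalize[OF BA])
    show "?W \<subseteq> hspace V'" using closure_of_subset_topspace[of "htopology V'"] by simp
    have "csubspace ?W"
      by (rule V'.csubspace_closure_of[OF _ sub]) (simp add: act_span_def complex_vector.subspace_span)
    then show "c *\<^sub>C v \<in> ?W" if "v \<in> ?W" for c v
      using that by (rule complex_vector.subspace_scale)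
    fix T and \<epsilon> :: real assume T: "finite T" "T \<subseteq> B" and "\<epsilon> > 0"
    \<comment> \<open>The errors are \<delta> from \<open>U\<close> to \<open>V\<close>, \<delta>
      from \<open>V\<close> to V', and \<delta> because \<open>e\<close> fixes \<open>u\<close> only
      approximately.\<close>
    define \<delta> where "\<delta> = \<epsilon> / 4"
    have \<delta>: "\<delta> > 0" using \<open>\<epsilon> > 0\<close> by (simp add: \<delta>_def)
    have "u \<in> htopology U closure_of act_span B U" using u(1) U.act_span_dense by simp
    then obtain e where e: "e \<in> B" "e * e = e" "star e = e" "\<And>t. t \<in> T \<Longrightarrow> e * t * e = t"
        "hnorm U (haction U e u - u) < \<delta>"
      using U.ex_projection_near[OF B order_refl T _ \<delta>] by blast
    have eA: "e \<in> A" using e(1) BA by blast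
    have eu: "haction U e u \<in> hspace U" by (rule U.haction_closed[OF e(1) u(1)])
    have T': "finite (insert e T)" "insert e T \<subseteq> B" "insert e T \<subseteq> A" using T e(1) BA by auto
    obtain v where v: "v \<in> hspace (closure_rep B V)" "hnorm (closure_rep B V) v = 1"
      "\<And>a. a \<in> insert e T \<Longrightarrow> cmod (hinner U (haction U a u) u -
        hinner (closure_rep B V) (haction (closure_rep B V) a v) v) < \<delta>"
      using UV u approximableD[OF _ T'(1,2) \<delta>] unfolding weakly_contained_iff_approximable by metis
    have vV: "v \<in> hspace V" "hnorm V v = 1"
      using v(1,2) closure_of_subset_topspace[of "htopology V"] by (auto simp: closure_rep_def hnorm_def)
    obtain w where w: "w \<in> hspace V'"
      "\<And>a. a \<in> insert e T \<Longrightarrow> cmod (hinner V (haction V a v) v - hinner V' (haction V' a w) w) < \<delta>"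
      using VV' vV approximableD[OF _ T'(1,3) \<delta>] unfolding weakly_contained_iff_approximable by metis
    have near: "cmod (hinner U (haction U a u) u - hinner V' (haction V' a w) w) < 2 * \<delta>" if "a \<in> insert e T" for a
      using v(3)[OF that] w(2)[OF that]
        norm_triangle_ineq[of "hinner U (haction U a u) u - hinner V (haction V a v) v"
          "hinner V (haction V a v) v - hinner V' (haction V' a w) w"]
      by (simp add: closure_rep_def)
    have ew: "haction V' e w \<in> hspace V'" by (rule V'.haction_closed[OF eA w(1)])
    have "\<bar>(hnorm V' (haction V' e w))\<^sup>2 - 1\<bar> < \<epsilon>"
    proof -
      have "hinner U (haction U e u) u - 1 = hinner U (haction U e u - u) u"
        using eu u U.hinner_self[OF u(1)] by (simp add: U.S.diff_left)
      then have "cmod (hinner U (haction U e u) u - 1) < \<delta>"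
        using U.Cauchy_Schwarz[OF U.diff_mem[OF eu u(1)] u(1)] u(2) e(5) by simp
      then have "cmod (hinner V' (haction V' e w) w - 1) < 3 * \<delta>"
        using near[of e] norm_triangle_ineq4[of "hinner U (haction U e u) u - 1"
            "hinner U (haction U e u) u - hinner V' (haction V' e w) w"] by simp
      then show ?thesis
        unfolding V'.projection_norm(1)[OF eA e(2,3) w(1)]
        using abs_Re_le_cmod[of "hinner V' (haction V' e w) w - 1"] \<delta> by (simp add: \<delta>_def)
    qed
    moreover have "cmod (hinner U (haction U t u) u - hinner V' (haction V' t (haction V' e w)) (haction V' e w)) < \<epsilon>"
      if t: "t \<in> T" for t
    proof -
      have tA: "t \<in> A" using t T(2) BA by blast
      have te: "t * e \<in> A" using Bs t T(2) e(1) BA by (auto simp: star_subalgebra_def)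
      from V'.hinner_projection[OF eA e(3) tA te w(1)] show ?thesis
        using near[of t] t e(4)[OF t] \<delta> by (simp add: \<delta>_def)
    qed
    moreover have "haction V' e w \<in> ?W" by (rule V'.haction_mem_closure[OF BA e(1) w(1)])
    ultimately show "\<exists>v\<in>?W. \<bar>(hnorm V' v)\<^sup>2 - 1\<bar> < \<epsilon> \<and>
        (\<forall>t\<in>T. cmod (hinner U (haction U t u) u - hinner V' (haction V' t v) v) < \<epsilon>)"
      by blast
  qed
  then show "approximable B (closure_rep B V') (hspace (closure_rep B V')) (\<lambda>a. hinner U (haction U a u) u)"
    by (simp add: approximable_def closure_rep_def hnorm_def)
qed

lemma isometric_hom_coefficient:
  assumes "isometric_hom A V W f" "a \<in> A" "v \<in> hspace V" "haction V a v \<in> hspace V"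
  shows "hinner W (haction W a (f v)) (f v) = hinner V (haction V a v) v"
proof -
  have "haction W a (f v) = f (haction V a v)"
    using assms(1-3) by (simp add: isometric_hom_def)
  moreover have "hinner W (f (haction V a v)) (f v) = hinner V (haction V a v) v"
    using assms unfolding isometric_hom_def by blast
  ultimately show ?thesis by simp
qed

lemma subrep_weakly_contained:
  assumes U: "unitary_rep B U" and "subrep B U W"
  shows "weakly_contained B U W"
proof -
  interpret U: unitary_rep B U by (rule U)
  obtain f where f: "isometric_hom B U W f" using assms(2) by (auto simp: subrep_def)
  show ?thesis
    unfolding weakly_contained_def
  proof (intro ballI allI impI)
    fix u and \<epsilon> :: real and T
    assume u: "u \<in> hspace U" and "\<epsilon> > 0" "hnorm U u = 1" "finite T" "T \<subseteq> B"
    moreover have "f u \<in> hspace W" "hnorm W (f u) = hnorm U u"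
      using f u by (simp_all add: isometric_hom_def hnorm_def)
    moreover have "hinner W (haction W a (f u)) (f u) = hinner U (haction U a u) u" if "a \<in> T" for a
      using that \<open>T \<subseteq> B\<close> by (intro isometric_hom_coefficient[OF f _ u] U.haction_closed u) auto
    ultimately show "\<exists>v'\<in>hspace W. hnorm W v' = 1 \<and>
        (\<forall>a\<in>T. cmod (hinner U (haction U a u) u - hinner W (haction W a v') v') < \<epsilon>)"
      by (intro bexI[of _ "f u"]) auto
  qed
qed

lemma mem_iso_class: "unitary_rep A V \<Longrightarrow> V \<in> iso_class A V"
  unfolding iso_class_def unitarily_isomorphic_def isometric_hom_def
  by (auto intro!: exI[of _ "\<lambda>x. x"] simp: bij_betw_def)

lemma weakly_contained_iso:
  assumes V: "unitary_rep A V" and iso: "unitarily_isomorphic A W V" and W: "unitary_rep A W"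
    and contained: "weakly_contained A W V'"
  shows "weakly_contained A V V'"
  unfolding weakly_contained_def
proof (intro ballI allI impI)
  interpret W: unitary_rep A W by (rule W)
  obtain f where f: "isometric_hom A W V f" "bij_betw f (hspace W) (hspace V)"
    using iso by (auto simp: unitarily_isomorphic_def)
  fix v and \<epsilon> :: real and T
  assume v: "v \<in> hspace V" "\<epsilon> > 0" "hnorm V v = 1" "finite T" "T \<subseteq> A"
  then obtain w where w: "w \<in> hspace W" "v = f w" using f(2) by (auto simp: bij_betw_def)
  have "hnorm W w = 1" using f(1) v(3) w by (simp add: isometric_hom_def hnorm_def)
  moreover have "hinner V (haction V a v) v = hinner W (haction W a w) w" if "a \<in> T" for a
    unfolding w(2) using that v(5)
    by (intro isometric_hom_coefficient[OF f(1) _ w(1)] W.haction_closed w(1)) auto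
  ultimately show "\<exists>v'\<in>hspace V'. hnorm V' v' = 1 \<and>
      (\<forall>a\<in>T. cmod (hinner V (haction V a v) v - hinner V' (haction V' a v') v') < \<epsilon>)"
    using contained w(1) v(2,4,5) unfolding weakly_contained_def by simp
qed

theorem theorem2p35:
  fixes A B :: "'a::star_algebra set"
    and V' :: "('a, 'v::complex_vector) hrep"
  assumes "idempotented_star_algebra A"
    and "idempotented_star_algebra B"
    and "B \<subseteq> A"
    and "unitary_rep A V'"
  shows "spectrum B (closure_rep B V') = spectrum_restriction A B (spectrum A V') \<and>
    (\<forall>U :: ('a, 'u::complex_vector) hrep.
      irreducible_rep B U \<and> weakly_contained B U (closure_rep B V') \<longrightarrow>
      (\<exists>V :: 'a universal_rep.
        irreducible_rep A V \<and> weakly_contained A V V' \<and> subrep B U (closure_rep B V)))"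
proof (intro conjI allI impI set_eqI iffI)
  fix U :: "('a, 'u) hrep"
  assume "irreducible_rep B U \<and> weakly_contained B U (closure_rep B V')"
  then show "\<exists>V :: 'a universal_rep.
      irreducible_rep A V \<and> weakly_contained A V V' \<and> subrep B U (closure_rep B V)"
    using ex_irreducible_extension[OF assms] by blast
next
  fix c assume "c \<in> spectrum B (closure_rep B V')"
  then obtain U :: "'a universal_rep" where U: "c = iso_class B U" "irreducible_rep B U"
    "weakly_contained B U (closure_rep B V')"
    by (auto simp: spectrum_def)
  obtain V :: "'a universal_rep" where V: "irreducible_rep A V" "weakly_contained A V V'"
    "subrep B U (closure_rep B V)"
    using ex_irreducible_extension[OF assms U(2,3)] by blast
  have "weakly_contained B U (closure_rep B V)"
    by (rule subrep_weakly_contained[OF _ V(3)]) (use U(2) in \<open>simp add: irreducible_rep_def\<close>)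
  then have "c \<in> spectrum B (closure_rep B V)" using U by (auto simp: spectrum_def)
  moreover have "iso_class A V \<in> spectrum A V'" using V by (auto simp: spectrum_def)
  ultimately show "c \<in> spectrum_restriction A B (spectrum A V')"
    using V(1) unfolding spectrum_restriction_def by blast
next
  fix c assume "c \<in> spectrum_restriction A B (spectrum A V')"
  then obtain V :: "'a universal_rep" where V: "irreducible_rep A V" "iso_class A V \<in> spectrum A V'"
    "c \<in> spectrum B (closure_rep B V)"
    unfolding spectrum_restriction_def by blast
  obtain U :: "'a universal_rep" where U: "c = iso_class B U" "irreducible_rep B U"
    "weakly_contained B U (closure_rep B V)"
    using V(3) by (auto simp: spectrum_def)
  \<comment> \<open>Membership of the class of \<open>V\<close> in the spectrum yields weak
    containment for some representative \<open>V1\<close> of the class; it is then transferred to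
    \<open>V\<close> along the isomorphism.\<close>
  obtain V1 :: "'a universal_rep" where V1: "iso_class A V = iso_class A V1" "irreducible_rep A V1"
    "weakly_contained A V1 V'"
    using V(2) by (auto simp: spectrum_def)
  have rep: "unitary_rep A V" "unitary_rep A V1" "unitary_rep B U"
    using V(1) V1(2) U(2) by (simp_all add: irreducible_rep_def)
  have "unitarily_isomorphic A V1 V"
    using mem_iso_class[OF rep(1)] unfolding V1(1) by (simp add: iso_class_def)
  then have "weakly_contained A V V'"
    by (rule weakly_contained_iso[OF rep(1) _ rep(2) V1(3)])
  then have "weakly_contained B U (closure_rep B V')"
    by (rule weakly_contained_restriction[OF assms(2,3,4) rep(1,3) _ U(3)])
  then show "c \<in> spectrum B (closure_rep B V')" using U(1,2) by (auto simp: spectrum_def)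
qed

end
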